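(* In the Markov game with parametrized policies described in the context, assume: (A5) There is $R>0$ with $|r_i(s,a)|\le R$ for all $i\in\mathcal{N}$, $(s,a)\in\mathcal{S}\times\mathcal{A}^N$. (A6) There are $B,V,\mathcal{L}\ge0$ such that for all $i,n\in\mathcal{N}$, $\theta\in\mathbb{R}^M$, $s\in\mathcal{S}$: $\mathbb{E}_{a_n\sim\pi_{n,\theta}(\cdot|s)}\|\nabla_i\log\pi_{n,\theta}(a_n|s)\|\le B$ and $\mathbb{E}_{a_n\sim\pi_{n,\theta}(\cdot|s)}\|\nabla_i\log\pi_{n,\theta}(a_n|s)\|^2\le V^2$; and for all $\theta^1,\theta^2\in\mathbb{R}^M$, $s$, $a_n$: $\|\nabla_i\log\pi_{n,\theta^1}(a_n|s)-\nabla_i\log\pi_{n,\theta^2}(a_n|s)\|\le\mathcal{L}\|\theta^1-\theta^2\|$. Then the stochastic policy gradient $\hat\nabla_iu_i(\theta_i,\theta_{-i})$ defined in the context (with any of the three choices of $\hat R_i$) is unbiased: for every $i\in\mathcal{N}$ and $\theta\in\mathbb{R}^M$, $$\mathbb{E}[\hat\nabla_iu_i(\theta_i,\theta_{-i})\mid\theta]=\nabla_iu_i(\theta_i,\theta_{-i}).$$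
   Context: **Game.** Agents $\mathcal{N}=\{1,\dots,N\}$, common action set $\mathcal{A}\subseteq\mathbb{R}^K$ and state space $\mathcal{S}$ (not necessarily finite), transition law $\mathbb{P}(s'|s,a)$ for joint actions $a\in\mathcal{A}^N$, rewards $r_i:\mathcal{S}\times\mathcal{A}^N\to\mathbb{R}$, discount $\gamma\in(0,1)$, and a fixed initial state $s_0$ (suppressed from the notation). Joint parameter $\theta=(\theta_1,\dots,\theta_N)\in\mathbb{R}^M$, $\theta_i\in\mathbb{R}^{M_i}$, $\sum_iM_i=M$. Each agent $n$ has a smooth, differentiable policy (density or mass function) $\pi_{n,\theta}(a_n|s)$ which may depend on the whole vector $\theta$; the joint policy is $\Pi_\theta(a|s)=\prod_{n}\pi_{n,\theta}(a_n|s)$. $\nabla_i$ is the gradient with respect to $\theta_i$. Utilities: $u_i(\theta)=u_i(\theta_i,\theta_{-i})=\mathbb{E}[\sum_{t\ge0}\gamma^tr_i(s_t,a_t)\mid s_0]$ with $a_t\sim\Pi_\theta(\cdot|s_t)$ and $s_{t+1}\sim\mathbb{P}(\cdot|s_t,a_t)$. **Gradient estimator $\hat\nabla_iu_i(\theta)$ at $\theta$.** $\mathrm{Geom}(p)$ is the law on $\{0,1,\dots\}$ with $\mathbb{P}(x)=(1-p)^xp$. Draw $\mathcal{T}_1\sim\mathrm{Geom}(1-\gamma)$, run the Markov chain from $s_0$ under $\Pi_\theta$ for $\mathcal{T}_1$ steps, and record $(s_{\mathcal{T}_1},a_{\mathcal{T}_1})$. Then set $$\hat\nabla_iu_i(\theta)=\frac1{1-\gamma}\hat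 R_i\sum_{n\in\mathcal{N}}\nabla_i\log\pi_{n,\theta}(a_{n,\mathcal{T}_1}|s_{\mathcal{T}_1}),$$ where $\hat R_i$ is one of: (Q) $\hat Q_i=\sum_{t=\mathcal{T}_1}^{\mathcal{T}_1+\mathcal{T}_2}\gamma^{(t-\mathcal{T}_1)/2}r_i(s_t,a_t)$, continuing the chain from $(s_{\mathcal{T}_1},a_{\mathcal{T}_1})$ under $\Pi_\theta$, with $\mathcal{T}_2\sim\mathrm{Geom}(1-\gamma^{1/2})$ independent; (advantage) $\hat Q_i-\hat V_i(s_{\mathcal{T}_1})$; (temporal difference) $r_i(s_{\mathcal{T}_1},a_{\mathcal{T}_1})+\gamma\hat V_i(s_{\mathcal{T}_1+1})-\hat V_i(s_{\mathcal{T}_1})$ with $s_{\mathcal{T}_1+1}\sim\mathbb{P}(\cdot|s_{\mathcal{T}_1},a_{\mathcal{T}_1})$. Here $\hat V_i(s)$ is the same kind of sum of $\gamma^{k/2}r_i$, $k=0,\dots,\mathcal{T}_2'$, along a fresh trajectory started at state $s$ under $\Pi_\theta$, with independent $\mathcal{T}_2'\sim\mathrm{Geom}(1-\gamma^{1/2})$; the estimate $\hat V_i(s_{\mathcal{T}_1})$ is conditionally independent of everything else given $s_{\mathcal{T}_1}$. *)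

theory Defs
  imports "HOL-Probability.Probability"
begin

section \<open>Gradients with respect to one agent's parameter block\<close>

text \<open>
  The joint parameter is \<open>\<theta> \<in> \<real>\<^sup>M\<close>, indexed by a finite type \<open>'m\<close>; a map \<open>own :: 'm \<Rightarrow> 'n\<close> says
  which agent owns each coordinate, so that \<open>\<theta>\<^sub>i\<close> consists of the coordinates \<open>j\<close> with \<open>own j = i\<close>
  and \<open>M\<^sub>i = card {j. own j = i}\<close>.  A vector of \<open>\<real>\<^bsup>M\<^sub>i\<^esup>\<close> is represented isometrically by the vector
  of \<open>\<real>\<^sup>M\<close> that vanishes outside block \<open>i\<close>.
\<close>

definition block_part :: "('m::finite \<Rightarrow> 'n) \<Rightarrow> 'n \<Rightarrow> real ^ 'm \<Rightarrow> real ^ 'm" where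
  "block_part own i h = (\<chi> j. if own j = i then h $ j else 0)"

text \<open>
  \<open>\<nabla>\<^sub>i f(\<theta>)\<close> is the gradient at \<open>0\<close> of \<open>h \<mapsto> f(\<theta>\<^sub>i + h\<^sub>i, \<theta>\<^bsub>-i\<^esub>)\<close>.  As this map does not depend on the
  coordinates of \<open>h\<close> outside block \<open>i\<close>, the gradient automatically vanishes there.
\<close>

definition block_differentiable ::
    "('m::finite \<Rightarrow> 'n) \<Rightarrow> 'n \<Rightarrow> (real ^ 'm \<Rightarrow> real) \<Rightarrow> real ^ 'm \<Rightarrow> bool" where
  "block_differentiable own i f \<theta> \<longleftrightarrow> (\<lambda>h. f (\<theta> + block_part own i h)) differentiable (at 0)"

definition block_grad ::
    "('m::finite \<Rightarrow> 'n) \<Rightarrow> 'n \<Rightarrow> (real ^ 'm \<Rightarrow> real) \<Rightarrow> real ^ 'm \<Rightarrow> real ^ 'm" where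
  "block_grad own i f \<theta> = (THE g. GDERIV (\<lambda>h. f (\<theta> + block_part own i h)) 0 :> g)"


section \<open>Markov games with parametrized policies\<close>

text \<open>
  Agents are the elements of the finite type \<open>'n\<close>, actions are vectors in \<open>\<real>\<^sup>K\<close> (\<open>K = CARD('k)\<close>), and
  a joint action is a function \<open>'n \<Rightarrow> real ^ 'k\<close>.  The value \<open>policy G n \<theta> s a\<close> is the density
  \<open>\<pi>\<^bsub>n,\<theta>\<^esub>(a|s)\<close> with respect to the \<open>\<sigma>\<close>-finite reference measure \<open>refm G n\<close> on the action set:
  Lebesgue measure gives probability densities, counting measure gives mass functions.
\<close>

record ('s, 'n, 'k, 'm) game =
  states :: "'s measure"
  actions :: "(real ^ 'k::finite) set"
  refm :: "'n \<Rightarrow> (real ^ 'k::finite) measure"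
  transition :: "'s \<times> ('n \<Rightarrow> real ^ 'k::finite) \<Rightarrow> 's measure"
  reward :: "'n \<Rightarrow> 's \<times> ('n \<Rightarrow> real ^ 'k::finite) \<Rightarrow> real"
  discount :: real
  init_state :: 's
  owner :: "'m \<Rightarrow> 'n"
  policy :: "'n \<Rightarrow> real ^ 'm::finite \<Rightarrow> 's \<Rightarrow> real ^ 'k::finite \<Rightarrow> real"

definition action_space ::
    "('s, 'n::finite, 'k::finite, 'm::finite) game \<Rightarrow> (real ^ 'k) measure" where
  "action_space G = restrict_space borel (actions G)"

definition joint_action_space ::
    "('s, 'n::finite, 'k::finite, 'm::finite) game \<Rightarrow> ('n \<Rightarrow> real ^ 'k) measure" where
  "joint_action_space G = PiM UNIV (\<lambda>_. action_space G)"

definition sa_space ::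
    "('s, 'n::finite, 'k::finite, 'm::finite) game \<Rightarrow> ('s \<times> ('n \<Rightarrow> real ^ 'k)) measure" where
  "sa_space G = states G \<Otimes>\<^sub>M joint_action_space G"

text \<open>
  Positivity of the policies on the action set is what makes \<open>log \<pi>\<^bsub>n,\<theta>\<^esub>(a|s)\<close> meaningful for every
  action; note that \<open>ln 0 = 0\<close> in HOL.
\<close>

locale markov_game =
  fixes G :: "('s, 'n::finite, 'k::finite, 'm::finite) game"
  assumes discount: "0 < discount G" "discount G < 1"
    and init_state: "init_state G \<in> space (states G)"
    and transition: "transition G \<in> sa_space G \<rightarrow>\<^sub>M prob_algebra (states G)"
    and reward: "\<And>i. reward G i \<in> borel_measurable (sa_space G)"
    and refm_sets: "\<And>n. sets (refm G n) = sets (action_space G)"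
    and refm_sigma_finite: "\<And>n. sigma_finite_measure (refm G n)"
    and policy_measurable:
      "\<And>n \<theta>. (\<lambda>(s, a). policy G n \<theta> s a) \<in> borel_measurable (states G \<Otimes>\<^sub>M action_space G)"
    and policy_pos:
      "\<And>n \<theta> s a. s \<in> space (states G) \<Longrightarrow> a \<in> actions G \<Longrightarrow> 0 < policy G n \<theta> s a"
    and policy_total:
      "\<And>n \<theta> s. s \<in> space (states G) \<Longrightarrow> (\<integral>\<^sup>+ a. ennreal (policy G n \<theta> s a) \<partial>refm G n) = 1"
    and policy_differentiable:
      "\<And>n \<theta> s a. s \<in> space (states G) \<Longrightarrow> a \<in> actions G \<Longrightarrow>
         (\<lambda>\<theta>'. policy G n \<theta>' s a) differentiable (at \<theta>)"

definition agent_law ::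
    "('s, 'n::finite, 'k::finite, 'm::finite) game \<Rightarrow> 'n \<Rightarrow> real ^ 'm \<Rightarrow> 's \<Rightarrow> (real ^ 'k) measure"
  where
  "agent_law G n \<theta> s = density (refm G n) (\<lambda>a. ennreal (policy G n \<theta> s a))"

definition joint_policy ::
    "('s, 'n::finite, 'k::finite, 'm::finite) game \<Rightarrow> real ^ 'm \<Rightarrow> 's \<Rightarrow> ('n \<Rightarrow> real ^ 'k) \<Rightarrow> real"
  where
  "joint_policy G \<theta> s a = (\<Prod>n\<in>UNIV. policy G n \<theta> s (a n))"

definition joint_law ::
    "('s, 'n::finite, 'k::finite, 'm::finite) game \<Rightarrow> real ^ 'm \<Rightarrow> 's \<Rightarrow> ('n \<Rightarrow> real ^ 'k) measure"
  where
  "joint_law G \<theta> s = density (PiM UNIV (refm G)) (\<lambda>a. ennreal (joint_policy G \<theta> s a))"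

definition score ::
    "('s, 'n::finite, 'k::finite, 'm::finite) game \<Rightarrow> 'n \<Rightarrow> 'n \<Rightarrow> real ^ 'm \<Rightarrow> 's \<Rightarrow> real ^ 'k \<Rightarrow>
      real ^ 'm"
  where
  "score G i n \<theta> s a = block_grad (owner G) i (\<lambda>\<theta>'. ln (policy G n \<theta>' s a)) \<theta>"


section \<open>Trajectories and utilities\<close>

definition start_law ::
    "('s, 'n::finite, 'k::finite, 'm::finite) game \<Rightarrow> real ^ 'm \<Rightarrow> 's \<Rightarrow>
      ('s \<times> ('n \<Rightarrow> real ^ 'k)) measure"
  where
  "start_law G \<theta> s = distr (joint_law G \<theta> s) (sa_space G) (\<lambda>a. (s, a))"

definition step_law ::
    "('s, 'n::finite, 'k::finite, 'm::finite) game \<Rightarrow> real ^ 'm \<Rightarrow> 's \<times> ('n \<Rightarrow> real ^ 'k) \<Rightarrow>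
      ('s \<times> ('n \<Rightarrow> real ^ 'k)) measure"
  where
  "step_law G \<theta> sa = Giry_Monad.bind (transition G sa) (start_law G \<theta>)"

definition traj_kernel ::
    "('s, 'n::finite, 'k::finite, 'm::finite) game \<Rightarrow> real ^ 'm \<Rightarrow> 's \<Rightarrow> nat \<Rightarrow>
      (nat \<Rightarrow> 's \<times> ('n \<Rightarrow> real ^ 'k)) \<Rightarrow> ('s \<times> ('n \<Rightarrow> real ^ 'k)) measure"
  where
  "traj_kernel G \<theta> s t \<omega> = (case t of 0 \<Rightarrow> start_law G \<theta> s | Suc k \<Rightarrow> step_law G \<theta> (\<omega> k))"

text \<open>
  The law of the trajectory \<open>(s\<^sub>t, a\<^sub>t)\<^bsub>t \<ge> 0\<^esub>\<close> started in state \<open>s\<close>: the Ionescu-Tulcea measure of the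
  kernels above.
\<close>

definition traj ::
    "('s, 'n::finite, 'k::finite, 'm::finite) game \<Rightarrow> real ^ 'm \<Rightarrow> 's \<Rightarrow>
      (nat \<Rightarrow> 's \<times> ('n \<Rightarrow> real ^ 'k)) measure"
  where
  "traj G \<theta> s = projective_family.lim UNIV
     (Ionescu_Tulcea.CI (traj_kernel G \<theta> s) (\<lambda>_. sa_space G)) (\<lambda>_. sa_space G)"

definition utility ::
    "('s, 'n::finite, 'k::finite, 'm::finite) game \<Rightarrow> 'n \<Rightarrow> real ^ 'm \<Rightarrow> real" where
  "utility G i \<theta> =
     (\<integral>\<omega>. (\<Sum>t. discount G ^ t * reward G i (\<omega> t)) \<partial>traj G \<theta> (init_state G))"


section \<open>The stochastic policy gradient\<close>

text \<open>
  The random horizons are geometric on \<open>{0, 1, \<dots>}\<close>, with mass \<open>(1 - p)\<^sup>x p\<close> at \<open>x\<close>, which is the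
  convention of \<^const>\<open>geometric_pmf\<close>.
\<close>

definition long_horizon ::
    "('s, 'n::finite, 'k::finite, 'm::finite) game \<Rightarrow> nat measure" where
  "long_horizon G = measure_pmf (geometric_pmf (1 - discount G))"

definition short_horizon ::
    "('s, 'n::finite, 'k::finite, 'm::finite) game \<Rightarrow> nat measure" where
  "short_horizon G = measure_pmf (geometric_pmf (1 - discount G powr (1 / 2)))"

definition Q_est ::
    "('s, 'n::finite, 'k::finite, 'm::finite) game \<Rightarrow> 'n \<Rightarrow> nat \<Rightarrow> nat \<Rightarrow>
      (nat \<Rightarrow> 's \<times> ('n \<Rightarrow> real ^ 'k)) \<Rightarrow> real"
  where
  "Q_est G i T1 T2 \<omega> =
     (\<Sum>t = T1..T1 + T2. discount G powr (real (t - T1) / 2) * reward G i (\<omega> t))"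

definition V_est_law ::
    "('s, 'n::finite, 'k::finite, 'm::finite) game \<Rightarrow> 'n \<Rightarrow> real ^ 'm \<Rightarrow> 's \<Rightarrow> real measure" where
  "V_est_law G i \<theta> s =
     distr (short_horizon G \<Otimes>\<^sub>M traj G \<theta> s) borel
       (\<lambda>(T, \<omega>). \<Sum>k = 0..T. discount G powr (real k / 2) * reward G i (\<omega> k))"

datatype return_est = Q_return | Advantage_return | TD_return

text \<open>
  The conditional law of \<open>R\<^sub>i\<close> given the horizon \<open>T1\<close> and the trajectory \<open>\<omega>\<close>, where
  \<open>\<omega> t = (s\<^sub>t, a\<^sub>t)\<close>.  The continuation of the chain after time \<open>T1\<close> is the tail of \<open>\<omega>\<close> itself.
\<close>

definition R_est_law ::
    "('s, 'n::finite, 'k::finite, 'm::finite) game \<Rightarrow> return_est \<Rightarrow> 'n \<Rightarrow> real ^ 'm \<Rightarrow> nat \<Rightarrow>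
      (nat \<Rightarrow> 's \<times> ('n \<Rightarrow> real ^ 'k)) \<Rightarrow> real measure"
  where
  "R_est_law G e i \<theta> T1 \<omega> = (case e of
     Q_return \<Rightarrow> distr (short_horizon G) borel (\<lambda>T2. Q_est G i T1 T2 \<omega>)
   | Advantage_return \<Rightarrow>
       distr (short_horizon G \<Otimes>\<^sub>M V_est_law G i \<theta> (fst (\<omega> T1))) borel
         (\<lambda>(T2, v). Q_est G i T1 T2 \<omega> - v)
   | TD_return \<Rightarrow>
       distr (V_est_law G i \<theta> (fst (\<omega> (Suc T1))) \<Otimes>\<^sub>M V_est_law G i \<theta> (fst (\<omega> T1))) borel
         (\<lambda>(v', v). reward G i (\<omega> T1) + discount G * v' - v))"

definition grad_est_law ::
    "('s, 'n::finite, 'k::finite, 'm::finite) game \<Rightarrow> return_est \<Rightarrow> 'n \<Rightarrow> real ^ 'm \<Rightarrow>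
      (real ^ 'm) measure"
  where
  "grad_est_law G e i \<theta> =
     Giry_Monad.bind (long_horizon G \<Otimes>\<^sub>M traj G \<theta> (init_state G)) (\<lambda>(T1, \<omega>).
       distr (R_est_law G e i \<theta> T1 \<omega>) borel (\<lambda>R.
         (1 / (1 - discount G) * R) *\<^sub>R
           (\<Sum>n\<in>UNIV. score G i n \<theta> (fst (\<omega> T1)) (snd (\<omega> T1) n))))"

end

theory Submission
  imports Defs
begin

text \<open>
  Let \<open>V\<^sub>\<theta>\<close> and \<open>Q\<^sub>\<theta>\<close> be the value functions and \<open>\<theta>'\<close> a perturbation of \<open>\<theta>\<close> in one agent's block.  Iterating
  \<open>V\<^bsub>\<theta>'\<^esub> - V\<^sub>\<theta> = \<integral> Q\<^bsub>\<theta>'\<^esub> d(\<Pi>\<^bsub>\<theta>'\<^esub> - \<Pi>\<^sub>\<theta>) + \<gamma> E\<^sub>\<theta>[(V\<^bsub>\<theta>'\<^esub> - V\<^sub>\<theta>)(s\<^sub>1)]\<close> expresses the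
  difference of utilities through the policy difference at the states visited under \<open>\<theta>\<close>.  With
  \<open>x = log (\<Pi>\<^bsub>\<theta>'\<^esub> / \<Pi>\<^sub>\<theta>)\<close> the Lipschitz condition gives \<open>x = h \<bullet> S + O(|h|\<^sup>2)\<close>, where \<open>S\<close> is the sum of the scores,
  and \<open>|e\<^sup>x - 1 - x| \<le> x\<^sup>2 (1 + e\<^sup>x)\<close> together with the second moments of the scores under both policies shows
  that \<open>\<Pi>\<^bsub>\<theta>'\<^esub> - \<Pi>\<^sub>\<theta> - (h \<bullet> S) \<Pi>\<^sub>\<theta>\<close> has total mass \<open>O(|h|\<^sup>2)\<close>, uniformly in the state.  Hence the utility is
  differentiable with derivative \<open>h \<mapsto> \<Sum>\<^sub>t \<gamma>\<^sup>t E[(h \<bullet> S) Q\<^sub>\<theta>]\<close> at \<open>(s\<^sub>t, a\<^sub>t)\<close>.  A geometric horizon supplies the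
  weights \<open>\<gamma>\<^sup>t\<close> of the estimator, the Markov property replaces the sampled return by \<open>Q\<^sub>\<theta>\<close>, and baselines
  depending only on the state drop out because the scores have mean zero.
\<close>

section \<open>Integrals, series and gradients\<close>

text \<open>The scores are unbounded and controlled only in mean square, so there is no pointwise
  majorant for differentiating under the trajectory integral, and the law of s_t depends on \<theta>
  through all earlier actions. Averaging over states visited under the old parameter removes the
  second difficulty: the perturbation is seen through a single action draw at a fixed state. The
  price is that the action value of the perturbed parameter appears there. It is exchanged for that
  of \<theta> by a bootstrap: boundedness of Q alone makes the policy difference O(|h|), contraction
  by \<gamma> then makes Q Lipschitz in h uniformly in the pair, and the product of the two errors
  is quadratic. That scores have mean zero is the same expansion for a constant integrand. Linearity
  in h of the limiting series is never proved directly: the mean of the estimator is the candidate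
  gradient, and its inner products with h are that series. Since a Bochner integral is 0 when the
  integrand is not integrable, absolute integrability of the estimator is settled before its mean is
  computed.\<close>

text \<open>Fubini for kernels under absolute integrability instead of boundedness, as scores
  require. The nonnegative case is applied to the positive and the negative part, both finite almost
  everywhere.\<close>

lemma
  fixes f :: "'b \<Rightarrow> real"
  assumes K: "K \<in> M \<rightarrow>\<^sub>M subprob_algebra N" and f: "f \<in> borel_measurable N"
    and fin: "(\<integral>\<^sup>+x. \<integral>\<^sup>+y. ennreal \<bar>f y\<bar> \<partial>K x \<partial>M) < \<infinity>"
  shows integrable_bind_kernel: "integrable (M \<bind> K) f"
    and integral_bind_kernel: "integral\<^sup>L (M \<bind> K) f = (\<integral>x. integral\<^sup>L (K x) f \<partial>M)"
    and integrable_integral_kernel: "integrable M (\<lambda>x. integral\<^sup>L (K x) f)"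
proof -
  note [measurable] = K f
  have fK: "f \<in> borel_measurable (K x)" if "x \<in> space M" for x
    using f by (simp add: subprob_measurableD(3)[OF K that])
  show int: "integrable (M \<bind> K) f"
  proof (cases "space M = {}")
    \<comment> \<open>By convention \<open>bind\<close> over an empty space is the counting measure
      on the empty set.\<close>
    case True then show ?thesis
      unfolding bind_empty[OF True] by (intro integrable_count_space) simp
  next
    case False
    have "sets (M \<bind> K) = sets N" by (rule sets_bind[OF sets_kernel[OF K] False])
    then have "f \<in> borel_measurable (M \<bind> K)"
      using f by (simp cong: measurable_cong_sets)
    moreover have "(\<integral>\<^sup>+x. ennreal (norm (f x)) \<partial>(M \<bind> K)) < \<infinity>"
      using fin by (subst nn_integral_bind[OF _ K]) auto
    ultimately show ?thesis by (simp add: integrable_iff_bounded)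
  qed
  define p where "p x = (\<integral>\<^sup>+y. ennreal (f y) \<partial>K x)" for x
  define q where "q x = (\<integral>\<^sup>+y. ennreal (- f y) \<partial>K x)" for x
  have [measurable]: "p \<in> borel_measurable M" "q \<in> borel_measurable M"
    unfolding p_def q_def by (rule measurable_compose[OF K nn_integral_measurable_subprob_algebra], measurable)+
  have meas_abs: "(\<lambda>x. \<integral>\<^sup>+y. ennreal \<bar>f y\<bar> \<partial>K x) \<in> borel_measurable M"
    by (rule measurable_compose[OF K nn_integral_measurable_subprob_algebra]) measurable
  have ple: "p x \<le> (\<integral>\<^sup>+y. ennreal \<bar>f y\<bar> \<partial>K x)" "q x \<le> (\<integral>\<^sup>+y. ennreal \<bar>f y\<bar> \<partial>K x)" for x
    unfolding p_def q_def by (auto intro!: nn_integral_mono ennreal_leI)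
  have "(\<integral>\<^sup>+x. p x \<partial>M) \<le> (\<integral>\<^sup>+x. \<integral>\<^sup>+y. ennreal \<bar>f y\<bar> \<partial>K x \<partial>M)"
    "(\<integral>\<^sup>+x. q x \<partial>M) \<le> (\<integral>\<^sup>+x. \<integral>\<^sup>+y. ennreal \<bar>f y\<bar> \<partial>K x \<partial>M)"
    by (intro nn_integral_mono ple)+
  then have pfin: "(\<integral>\<^sup>+x. p x \<partial>M) < \<infinity>" "(\<integral>\<^sup>+x. q x \<partial>M) < \<infinity>"
    using le_less_trans[OF _ fin] by blast+
  have AEfin: "AE x in M. (\<integral>\<^sup>+y. ennreal \<bar>f y\<bar> \<partial>K x) \<noteq> \<infinity>"
    by (rule nn_integral_PInf_AE[OF meas_abs]) (use fin in simp)
  have AEp: "AE x in M. ennreal (enn2real (p x)) = p x" "AE x in M. ennreal (enn2real (q x)) = q x"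
    using nn_integral_PInf_AE[of p M] nn_integral_PInf_AE[of q M] pfin
    by (auto simp: less_top[symmetric])
  \<comment> \<open>The kernel integral splits this way where the absolute integral is finite, hence
    almost everywhere; infinite values are sent to 0 by \<open>enn2real\<close>.\<close>
  have AEi: "AE x in M. integral\<^sup>L (K x) f = enn2real (p x) - enn2real (q x)"
    using AEfin AE_space
  proof eventually_elim
    case (elim x)
    then have "integrable (K x) f"
      using fK[of x] by (auto simp: integrable_iff_bounded top.not_eq_extremum)
    then show ?case by (simp add: real_lebesgue_integral_def p_def q_def)
  qed
  have np: "(\<integral>\<^sup>+x. ennreal (enn2real (p x)) \<partial>M) = integral\<^sup>N M p"
    "(\<integral>\<^sup>+x. ennreal (enn2real (q x)) \<partial>M) = integral\<^sup>N M q"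
    by (rule nn_integral_cong_AE[OF AEp(1)], rule nn_integral_cong_AE[OF AEp(2)])
  have ip: "integrable M (\<lambda>x. enn2real (p x))" "integrable M (\<lambda>x. enn2real (q x))"
    using pfin np by (auto intro!: integrableI_nonneg)
  have meas: "(\<lambda>x. integral\<^sup>L (K x) f) \<in> borel_measurable M"
    by (rule measurable_compose[OF K integral_measurable_subprob_algebra]) (rule f)
  show "integrable M (\<lambda>x. integral\<^sup>L (K x) f)"
    by (rule integrable_cong_AE_imp[OF Bochner_Integration.integrable_diff[OF ip] meas])
       (use AEi in \<open>auto elim!: eventually_mono\<close>)
  have "(\<integral>x. integral\<^sup>L (K x) f \<partial>M) = (\<integral>x. enn2real (p x) - enn2real (q x) \<partial>M)"
    by (rule integral_cong_AE[OF meas _ AEi]) measurable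
  also have "\<dots> = (\<integral>x. enn2real (p x) \<partial>M) - (\<integral>x. enn2real (q x) \<partial>M)"
    by (rule Bochner_Integration.integral_diff[OF ip])
  also have "\<dots> = enn2real (integral\<^sup>N M p) - enn2real (integral\<^sup>N M q)"
    by (simp add: integral_eq_nn_integral np)
  also have "\<dots> = integral\<^sup>L (M \<bind> K) f"
    unfolding real_lebesgue_integral_def[OF int] p_def q_def
    by (simp add: nn_integral_bind[OF _ K])
  finally show "integral\<^sup>L (M \<bind> K) f = (\<integral>x. integral\<^sup>L (K x) f \<partial>M)" by simp
qed

section \<open>Exponential remainders, geometric series and geometric horizons\<close>

text \<open>This is the mean value bound with the maximum of 1 and e^x weakened to their sum; both
  signs follow from e^y >= 1 + y.\<close>

lemma abs_exp_minus_1_le: "\<bar>exp x - 1\<bar> \<le> \<bar>x\<bar> * (1 + exp (x::real))"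
proof (cases "x \<ge> 0")
  case True
  have "1 - x \<le> exp (-x)" using exp_ge_add_one_self[of "-x"] by simp
  then have "(1 - x) * exp x \<le> exp (-x) * exp x" by (intro mult_right_mono) auto
  then have "exp x - 1 \<le> x * exp x" by (simp add: exp_minus algebra_simps)
  with True show ?thesis by (simp add: algebra_simps)
next
  case False
  have "1 - exp x \<le> - x" using exp_ge_add_one_self[of x] by linarith
  moreover have "0 \<le> (-x) * exp x" using False by (intro mult_nonneg_nonneg) auto
  moreover have "exp x \<le> 1" using False by simp
  ultimately have "1 - exp x \<le> - x + - x * exp x" by linarith
  moreover have "\<bar>exp x - 1\<bar> = 1 - exp x" "\<bar>x\<bar> = - x" using False by auto
  ultimately show ?thesis by (simp only: distrib_left mult_1_right)
qed

text \<open>The remainder is nonnegative, and (1 - x) e^x <= 1 bounds it by x (e^x - 1); the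
  preceding bound contributes the second factor |x|.\<close>

lemma abs_exp_minus_1_minus_le: "\<bar>exp x - 1 - x\<bar> \<le> x\<^sup>2 * (1 + exp (x::real))"
proof -
  have "1 - x \<le> exp (-x)" using exp_ge_add_one_self[of "-x"] by simp
  then have "(1 - x) * exp x \<le> exp (-x) * exp x" by (intro mult_right_mono) auto
  then have "exp x - 1 - x \<le> x * (exp x - 1)" by (simp add: exp_minus algebra_simps)
  also have "\<dots> \<le> \<bar>x\<bar> * \<bar>exp x - 1\<bar>" by (metis abs_ge_self abs_mult)
  also have "\<dots> \<le> \<bar>x\<bar> * (\<bar>x\<bar> * (1 + exp x))"
    by (intro mult_left_mono abs_exp_minus_1_le) auto
  also have "\<dots> = x\<^sup>2 * (1 + exp x)" by (simp add: power2_eq_square)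
  finally show ?thesis using exp_ge_add_one_self[of x] by linarith
qed

lemma
  fixes q :: real
  assumes q: "0 \<le> q" "q < 1" and x: "\<And>k. \<bar>x k\<bar> \<le> R"
  shows summable_geometric_bounded: "summable (\<lambda>k. q ^ k * x k)"
    and abs_suminf_geometric_le: "\<bar>\<Sum>k. q ^ k * x k\<bar> \<le> R / (1 - q)"
    and abs_sum_geometric_le: "\<bar>\<Sum>k<n. q ^ k * x k\<bar> \<le> R / (1 - q)"
proof -
  have R: "0 \<le> R" using x[of 0] by simp
  have bd: "norm (q ^ k * x k) \<le> R * q ^ k" for k
    using q x[of k] R by (simp add: abs_mult mult.commute mult_right_mono)
  have sg: "summable (\<lambda>k. R * q ^ k)"
    using q by (intro summable_mult summable_geometric) auto
  show s: "summable (\<lambda>k. q ^ k * x k)"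
    by (rule summable_comparison_test'[OF sg]) (use bd in auto)
  have sum: "(\<Sum>k. R * q ^ k) = R / (1 - q)"
    using q suminf_mult[OF summable_geometric[of q], of R] by (simp add: suminf_geometric divide_simps)
  have sn: "summable (\<lambda>k. norm (q ^ k * x k))"
    by (rule summable_comparison_test'[OF sg]) (use bd in auto)
  have "norm (\<Sum>k. q ^ k * x k) \<le> (\<Sum>k. norm (q ^ k * x k))" by (rule summable_norm[OF sn])
  also have "\<dots> \<le> (\<Sum>k. R * q ^ k)" by (rule suminf_le[OF bd sn sg])
  finally show "\<bar>\<Sum>k. q ^ k * x k\<bar> \<le> R / (1 - q)" using sum by simp
  have "\<bar>\<Sum>k<n. q ^ k * x k\<bar> \<le> (\<Sum>k<n. R * q ^ k)"
    using bd by (intro order_trans[OF sum_abs] sum_mono) auto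
  also have "\<dots> \<le> (\<Sum>k. R * q ^ k)"
    using R q by (intro sum_le_suminf[OF sg]) auto
  finally show "\<bar>\<Sum>k<n. q ^ k * x k\<bar> \<le> R / (1 - q)" using sum by simp
qed

lemma integral_geometric_pmf:
  fixes f :: "nat \<Rightarrow> real"
  assumes p: "0 < p" "p \<le> 1" and f: "\<And>n. \<bar>f n\<bar> \<le> R"
  shows "(\<integral>n. f n \<partial>measure_pmf (geometric_pmf p)) = (\<Sum>n. (1 - p) ^ n * p * f n)"
proof -
  have "integrable (measure_pmf (geometric_pmf p)) f"
    by (rule measure_pmf.integrable_const_bound[where B=R]) (use f in auto)
  then have i: "integrable (count_space UNIV) (\<lambda>n. pmf (geometric_pmf p) n *\<^sub>R f n)"
    unfolding measure_pmf_eq_density by (subst (asm) integrable_density) auto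
  have "(\<integral>n. f n \<partial>measure_pmf (geometric_pmf p)) = (\<integral>n. pmf (geometric_pmf p) n *\<^sub>R f n \<partial>count_space UNIV)"
    unfolding measure_pmf_eq_density by (subst integral_density) auto
  also have "\<dots> = (\<Sum>n. pmf (geometric_pmf p) n *\<^sub>R f n)"
    using sums_integral_count_space_nat[OF i] by (simp add: sums_iff)
  finally show ?thesis using p by simp
qed

text \<open>
  A geometric horizon of parameter \<open>1 - q\<close> survives past \<open>k\<close> with probability \<open>q\<^sup>k\<close>, so it turns the
  weights \<open>q\<^sup>k\<close> into \<open>q\<^bsup>2k\<^esup>\<close>.
\<close>

lemma integral_geometric_pmf_partial_sums:
  fixes x :: "nat \<Rightarrow> real"
  assumes q: "0 < q" "q < 1" and x: "\<And>k. \<bar>x k\<bar> \<le> R"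
  shows "(\<integral>n. (\<Sum>k\<le>n. q ^ k * x k) \<partial>measure_pmf (geometric_pmf (1 - q))) = (\<Sum>k. (q\<^sup>2) ^ k * x k)"
proof -
  have q2: "0 \<le> q\<^sup>2" "q\<^sup>2 < 1" using q by (auto simp: power_less_one_iff abs_square_less_1)
  have "(\<integral>n. (\<Sum>k\<le>n. q ^ k * x k) \<partial>measure_pmf (geometric_pmf (1 - q)))
      = (\<Sum>n. (1 - (1 - q)) ^ n * (1 - q) * (\<Sum>k\<le>n. q ^ k * x k))"
    using q abs_sum_geometric_le[of q x R, OF _ _ x]
    by (intro integral_geometric_pmf[where R="R / (1 - q)"])
       (auto simp flip: lessThan_Suc_atMost simp del: sum.lessThan_Suc)
  \<comment> \<open>For k <= n the weights satisfy q^n q^k = (q^2)^k q^(n-k). The double sum is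
    therefore a Cauchy product with the geometric series, whose value cancels the factor 1 -
    q.\<close>
  also have "\<dots> = (\<Sum>n. (1 - q) * (\<Sum>k\<le>n. ((q\<^sup>2) ^ k * x k) * q ^ (n - k)))"
  proof (intro suminf_cong)
    fix n
    have "q ^ n * (q ^ k * x k) = ((q\<^sup>2) ^ k * x k) * q ^ (n - k)" if "k \<le> n" for k
    proof -
      have "q ^ n = q ^ k * q ^ (n - k)" using that by (simp flip: power_add)
      then show ?thesis by (simp add: power2_eq_square power_mult_distrib)
    qed
    then have "q ^ n * (\<Sum>k\<le>n. q ^ k * x k) = (\<Sum>k\<le>n. ((q\<^sup>2) ^ k * x k) * q ^ (n - k))"
      unfolding sum_distrib_left by (intro sum.cong) auto
    then show "(1 - (1 - q)) ^ n * (1 - q) * (\<Sum>k\<le>n. q ^ k * x k) = (1 - q) * (\<Sum>k\<le>n. ((q\<^sup>2) ^ k * x k) * q ^ (n - k))"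
      by (simp add: mult_ac)
  qed
  also have "\<dots> = (1 - q) * (\<Sum>n. \<Sum>k\<le>n. ((q\<^sup>2) ^ k * x k) * q ^ (n - k))"
  proof (rule suminf_mult)
    show "summable (\<lambda>n. \<Sum>k\<le>n. ((q\<^sup>2) ^ k * x k) * q ^ (n - k))"
    proof (rule summable_Cauchy_product)
      show "summable (\<lambda>k. norm ((q\<^sup>2) ^ k * x k))"
        using summable_geometric_bounded[OF q2, of "\<lambda>k. \<bar>x k\<bar>" R] x by (simp add: abs_mult)
    qed (use q in \<open>simp add: summable_geometric\<close>)
  qed
  also have "(\<Sum>n. \<Sum>k\<le>n. ((q\<^sup>2) ^ k * x k) * q ^ (n - k)) = (\<Sum>k. (q\<^sup>2) ^ k * x k) * (\<Sum>k. q ^ k)"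
  proof (rule Cauchy_product[symmetric])
    show "summable (\<lambda>k. norm ((q\<^sup>2) ^ k * x k))"
      using summable_geometric_bounded[OF q2, of "\<lambda>k. \<bar>x k\<bar>" R] x by (simp add: abs_mult)
  qed (use q in \<open>simp add: summable_geometric\<close>)
  also have "(\<Sum>k. q ^ k) = 1 / (1 - q)" using q by (simp add: suminf_geometric)
  finally show ?thesis using q by simp
qed

section \<open>Existence and uniqueness of gradients\<close>

text \<open>Riesz representation in finite dimension: the gradient collects the values of the
  derivative on an orthonormal basis.\<close>

lemma differentiable_imp_GDERIV:
  fixes f :: "'a::euclidean_space \<Rightarrow> real"
  assumes "f differentiable (at x)"
  shows "\<exists>D. GDERIV f x :> D"
proof -
  from assms obtain f' where f': "(f has_derivative f') (at x)" by (auto simp: differentiable_def)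
  then interpret f': bounded_linear f' by (rule has_derivative_bounded_linear)
  have "f' h = h \<bullet> (\<Sum>b\<in>Basis. f' b *\<^sub>R b)" for h
  proof -
    have "f' h = f' (\<Sum>b\<in>Basis. (h \<bullet> b) *\<^sub>R b)" by (simp add: euclidean_representation)
    also have "\<dots> = (\<Sum>b\<in>Basis. (h \<bullet> b) * f' b)" by (simp add: f'.sum f'.scale)
    finally show ?thesis by (simp add: inner_sum_right mult.commute)
  qed
  then have "f' = (\<lambda>h. h \<bullet> (\<Sum>b\<in>Basis. f' b *\<^sub>R b))" by (rule ext)
  with f' have "(f has_derivative (\<lambda>h. h \<bullet> (\<Sum>b\<in>Basis. f' b *\<^sub>R b))) (at x)" by (metis (no_types))
  then show ?thesis unfolding gderiv_def by blast
qed

lemma GDERIV_unique: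
  fixes f :: "'a::real_inner \<Rightarrow> real"
  assumes "GDERIV f x :> D" "GDERIV f x :> E"
  shows "D = E"
proof -
  have "(\<lambda>h. h \<bullet> D) = (\<lambda>h. h \<bullet> E)"
    using assms has_derivative_unique unfolding gderiv_def by blast
  then have "(D - E) \<bullet> D = (D - E) \<bullet> E" by (rule fun_cong)
  then have "(D - E) \<bullet> (D - E) = 0" by (simp add: inner_diff_right)
  then show ?thesis by simp
qed

text \<open>Differentiability is a conclusion here: a quadratic error on the unit ball, divided by
  \<open>norm h\<close>, tends to 0. The utility is differentiated in this way.\<close>

lemma GDERIV_quadratic_bound:
  fixes f :: "'a::real_inner \<Rightarrow> real"
  assumes "\<And>h. norm h \<le> 1 \<Longrightarrow> \<bar>f (x + h) - f x - h \<bullet> D\<bar> \<le> C * (norm h)\<^sup>2"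
  shows "GDERIV f x :> D"
  unfolding gderiv_def has_derivative_at
proof (intro conjI bounded_linear_inner_left)
  have "((\<lambda>h::'a. C * norm h) \<longlongrightarrow> C * norm (0::'a)) (at 0)"
    by (rule tendsto_mult[OF tendsto_const tendsto_norm[OF tendsto_ident_at]])
  then have C0: "((\<lambda>h::'a. C * norm h) \<longlongrightarrow> 0) (at 0)" by simp
  have ev: "\<forall>\<^sub>F h in at (0::'a). norm h \<le> 1"
    unfolding eventually_at by (rule exI[of _ 1]) (auto simp: dist_norm)
  show "((\<lambda>h. norm (f (x + h) - f x - h \<bullet> D) / norm h) \<longlongrightarrow> 0) (at 0)"
  proof (rule tendsto_sandwich[OF _ _ tendsto_const C0])
    show "\<forall>\<^sub>F h in at 0. norm (f (x + h) - f x - h \<bullet> D) / norm h \<le> C * norm h"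
      using ev
    proof eventually_elim
      case (elim h)
      then show ?case using assms[of h]
        by (cases "h = 0") (auto simp: divide_simps power2_eq_square mult.assoc)
    qed
  qed auto
qed

section \<open>Integrals of discounted series, of bounded functions and on products\<close>

text \<open>The factor \<open>f\<close> is only integrable because score components are inserted for
  it; the bounded \<open>g k\<close> and the geometric weights give the summable majorant \<gamma>^k
  R |f|.\<close>

lemma integral_mult_discounted_suminf:
  fixes f :: "'a \<Rightarrow> real"
  assumes \<gamma>: "0 \<le> \<gamma>" "\<gamma> < 1" and f: "integrable M f"
    and g: "\<And>k. g k \<in> borel_measurable M" and g_le: "\<And>k x. x \<in> space M \<Longrightarrow> \<bar>g k x\<bar> \<le> R"
  shows "(\<integral>x. f x * (\<Sum>k. \<gamma> ^ k * g k x) \<partial>M) = (\<Sum>k. \<gamma> ^ k * (\<integral>x. f x * g k x \<partial>M))"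
proof -
  have fg_le: "\<bar>f x * (\<gamma> ^ k * g k x)\<bar> \<le> \<gamma> ^ k * (R * \<bar>f x\<bar>)" if "x \<in> space M" for x k
  proof -
    have "\<bar>f x\<bar> * (\<gamma> ^ k * \<bar>g k x\<bar>) \<le> \<bar>f x\<bar> * (\<gamma> ^ k * R)"
      using g_le[OF that] \<gamma> by (intro mult_left_mono) auto
    then show ?thesis using \<gamma> by (simp add: abs_mult mult_ac)
  qed
  have int: "integrable M (\<lambda>x. f x * (\<gamma> ^ k * g k x))" for k
  proof (rule Bochner_Integration.integrable_bound)
    show "integrable M (\<lambda>x. \<gamma> ^ k * (R * \<bar>f x\<bar>))" using f by simp
    show "(\<lambda>x. f x * (\<gamma> ^ k * g k x)) \<in> borel_measurable M" using f g by auto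
    show "AE x in M. norm (f x * (\<gamma> ^ k * g k x)) \<le> norm (\<gamma> ^ k * (R * \<bar>f x\<bar>))"
      using fg_le by (intro AE_I2) (auto intro: order_trans[OF _ abs_ge_self])
  qed
  have sg: "summable (\<lambda>k. \<gamma> ^ k * c)" for c
    using \<gamma> by (intro summable_mult2 summable_geometric) auto
  have ae: "AE x in M. summable (\<lambda>k. norm (f x * (\<gamma> ^ k * g k x)))"
    using fg_le by (intro AE_I2 summable_comparison_test'[OF sg, where N=0]) auto
  have "(\<integral>x. norm (f x * (\<gamma> ^ k * g k x)) \<partial>M) \<le> (\<integral>x. \<gamma> ^ k * (R * \<bar>f x\<bar>) \<partial>M)" for k
    using fg_le f by (intro integral_mono integrable_norm[OF int]) (auto)
  then have sm: "summable (\<lambda>k. \<integral>x. norm (f x * (\<gamma> ^ k * g k x)) \<partial>M)"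
    by (intro summable_comparison_test'[OF sg[of "\<integral>x. R * \<bar>f x\<bar> \<partial>M"], where N=0])
       simp
  have eq: "(\<integral>x. f x * (\<gamma> ^ k * g k x) \<partial>M) = \<gamma> ^ k * (\<integral>x. f x * g k x \<partial>M)" for k
    by (subst integral_mult_right_zero[symmetric]) (simp add: mult_ac)
  have sx: "summable (\<lambda>k. \<gamma> ^ k * g k x)" if "x \<in> space M" for x
    by (rule summable_geometric_bounded[OF \<gamma> g_le[OF that]])
  have "(\<integral>x. f x * (\<Sum>k. \<gamma> ^ k * g k x) \<partial>M) = (\<integral>x. (\<Sum>k. f x * (\<gamma> ^ k * g k x)) \<partial>M)"
    by (intro Bochner_Integration.integral_cong refl suminf_mult[symmetric] sx)
  also have "\<dots> = (\<Sum>k. \<integral>x. f x * (\<gamma> ^ k * g k x) \<partial>M)" by (rule integral_suminf[OF int ae sm])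
  finally show ?thesis by (simp add: eq)
qed

lemma (in prob_space) integral_discounted_suminf:
  fixes g :: "nat \<Rightarrow> 'a \<Rightarrow> real"
  assumes "0 \<le> \<gamma>" "\<gamma> < 1" "\<And>k. g k \<in> borel_measurable M" "\<And>k x. x \<in> space M \<Longrightarrow> \<bar>g k x\<bar> \<le> R"
  shows "(\<integral>x. (\<Sum>k. \<gamma> ^ k * g k x) \<partial>M) = (\<Sum>k. \<gamma> ^ k * (\<integral>x. g k x \<partial>M))"
  using integral_mult_discounted_suminf[of \<gamma> M "\<lambda>_. 1" g R] assms by simp

text \<open>A non-integrable function has integral 0 by convention, and \<open>0 \<le> C\<close>
  covers that case, so the bound can be used without a measurability argument.\<close>

lemma (in prob_space) abs_integral_le_const:
  fixes f :: "'a \<Rightarrow> real"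
  assumes "\<And>x. x \<in> space M \<Longrightarrow> \<bar>f x\<bar> \<le> C" "0 \<le> C"
  shows "\<bar>\<integral>x. f x \<partial>M\<bar> \<le> C"
proof (cases "integrable M f")
  case True
  have "\<bar>\<integral>x. f x \<partial>M\<bar> \<le> (\<integral>x. \<bar>f x\<bar> \<partial>M)" by (rule integral_abs_bound)
  also have "\<dots> \<le> (\<integral>x. C \<partial>M)" using True assms by (intro integral_mono) auto
  finally show ?thesis by (simp add: prob_space)
qed (use assms in \<open>simp add: not_integrable_integral_eq\<close>)

lemma (in prob_space) integrable_bounded_on_space:
  fixes f :: "'a \<Rightarrow> real"
  assumes "f \<in> borel_measurable M" "\<And>x. x \<in> space M \<Longrightarrow> \<bar>f x\<bar> \<le> C"
  shows "integrable M f"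
  using assms by (intro integrable_const_bound[where B=C]) auto

lemma integral_bind_bounded:
  fixes f :: "'b \<Rightarrow> real"
  assumes M: "prob_space M" and K: "K \<in> M \<rightarrow>\<^sub>M prob_algebra N"
    and f: "f \<in> borel_measurable N" "\<And>x. x \<in> space N \<Longrightarrow> \<bar>f x\<bar> \<le> C"
  shows "integral\<^sup>L (M \<bind> K) f = (\<integral>x. integral\<^sup>L (K x) f \<partial>M)"
proof (rule integral_bind[OF f measurable_prob_algebraD[OF K]])
  interpret prob_space M by fact
  show "finite_measure M" by unfold_locales
  show "AE x in M. emeasure (K x) (space (K x)) \<le> ennreal 1"
    using measurable_space[OF K]
    by (auto simp: space_prob_algebra prob_space.emeasure_space_1 intro!: AE_I2)
qed

lemma measurable_integral_kernel:
  fixes f :: "'b \<Rightarrow> real"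
  assumes "K \<in> M \<rightarrow>\<^sub>M prob_algebra N" "f \<in> borel_measurable N"
  shows "(\<lambda>x. integral\<^sup>L (K x) f) \<in> borel_measurable M"
  by (rule measurable_compose[OF measurable_prob_algebraD[OF assms(1)]
        integral_measurable_subprob_algebra[OF assms(2)]])

lemma (in prob_space) distr_pair_snd:
  assumes "sigma_finite_measure N"
  shows "distr (M \<Otimes>\<^sub>M N) N snd = N"
proof (intro measure_eqI)
  interpret N: sigma_finite_measure N by fact
  fix A assume A: "A \<in> sets (distr (M \<Otimes>\<^sub>M N) N snd)"
  then have "emeasure (distr (M \<Otimes>\<^sub>M N) N snd) A = emeasure (M \<Otimes>\<^sub>M N) (space M \<times> A)"
    by (auto simp: emeasure_distr space_pair_measure dest: sets.sets_into_space intro!: arg_cong2[where f=emeasure])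
  with A show "emeasure (distr (M \<Otimes>\<^sub>M N) N snd) A = emeasure N A"
    by (simp add: N.emeasure_pair_measure_Times emeasure_space_1)
qed simp

text \<open>Each summand depends on one factor of the product, whose law is recovered as a marginal.
  This handles a sampled return minus an independently sampled baseline.\<close>

lemma
  fixes f :: "'a \<Rightarrow> real" and g :: "'b \<Rightarrow> real"
  assumes M: "prob_space M" and N: "prob_space N" and f: "integrable M f" and g: "integrable N g"
  shows integrable_pair_add: "integrable (M \<Otimes>\<^sub>M N) (\<lambda>x. f (fst x) + g (snd x))"
    and integral_pair_add: "(\<integral>x. f (fst x) + g (snd x) \<partial>(M \<Otimes>\<^sub>M N)) = (\<integral>x. f x \<partial>M) + (\<integral>x. g x \<partial>N)"
proof -
  interpret M: prob_space M by fact
  interpret N: prob_space N by fact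
  have m: "f \<in> borel_measurable M" "g \<in> borel_measurable N" using f g by auto
  have d: "distr (M \<Otimes>\<^sub>M N) M fst = M" "distr (M \<Otimes>\<^sub>M N) N snd = N"
    by (rule N.distr_pair_fst, rule M.distr_pair_snd) unfold_locales
  have i: "integrable (M \<Otimes>\<^sub>M N) (\<lambda>x. f (fst x))" "integrable (M \<Otimes>\<^sub>M N) (\<lambda>x. g (snd x))"
    using f g integrable_distr_eq[OF measurable_fst m(1), of N] integrable_distr_eq[OF measurable_snd m(2), of M]
    by (simp_all add: d)
  show "integrable (M \<Otimes>\<^sub>M N) (\<lambda>x. f (fst x) + g (snd x))" using i by simp
  show "(\<integral>x. f (fst x) + g (snd x) \<partial>(M \<Otimes>\<^sub>M N)) = (\<integral>x. f x \<partial>M) + (\<integral>x. g x \<partial>N)"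
    using integral_distr[OF measurable_fst m(1), of N] integral_distr[OF measurable_snd m(2), of M] i
    by (simp add: d)
qed

lemma integral_abs_pair_add_le:
  fixes f :: "'a \<Rightarrow> real" and g :: "'b \<Rightarrow> real"
  assumes M: "prob_space M" and N: "prob_space N" and f: "integrable M f" and g: "integrable N g"
  shows "(\<integral>x. \<bar>f (fst x) + g (snd x)\<bar> \<partial>(M \<Otimes>\<^sub>M N)) \<le> (\<integral>x. \<bar>f x\<bar> \<partial>M) + (\<integral>x. \<bar>g x\<bar> \<partial>N)"
proof -
  have "(\<integral>x. \<bar>f (fst x) + g (snd x)\<bar> \<partial>(M \<Otimes>\<^sub>M N)) \<le> (\<integral>x. \<bar>f (fst x)\<bar> + \<bar>g (snd x)\<bar> \<partial>(M \<Otimes>\<^sub>M N))"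
    by (intro integral_mono integrable_abs integrable_pair_add[OF M N f g]
        integrable_pair_add[OF M N integrable_abs[OF f] integrable_abs[OF g]] abs_triangle_ineq)
  also have "\<dots> = (\<integral>x. \<bar>f x\<bar> \<partial>M) + (\<integral>x. \<bar>g x\<bar> \<partial>N)"
    by (rule integral_pair_add[OF M N integrable_abs[OF f] integrable_abs[OF g]])
  finally show ?thesis .
qed

section \<open>Perturbations within one block of coordinates\<close>

lemma bounded_linear_block_part: "bounded_linear (block_part own i)"
proof -
  have "linear (block_part own i)"
    by (rule linearI) (auto simp: block_part_def vec_eq_iff)
  then show ?thesis by (simp add: linear_conv_bounded_linear)
qed

lemma norm_block_part_le: "norm (block_part own i h) \<le> norm h"
  by (rule norm_le_componentwise_cart) (auto simp: block_part_def)

lemma block_part_0 [simp]: "block_part own i 0 = 0"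
  by (simp add: block_part_def vec_eq_iff)

lemma has_derivative_add_block_part:
  "((\<lambda>h. \<theta> + block_part own i h) has_derivative block_part own i) (at x)"
  using has_derivative_add[OF has_derivative_const bounded_linear_imp_has_derivative[OF bounded_linear_block_part]]
  by simp

text \<open>The chain rule along a line makes the mean value theorem and sequences of difference
  quotients available.\<close>

lemma GDERIV_imp_DERIV_line:
  assumes "GDERIV f 0 :> D"
  shows "((\<lambda>t::real. f (t *\<^sub>R b)) has_real_derivative (b \<bullet> D)) (at 0)"
proof -
  have "((\<lambda>t::real. t *\<^sub>R b) has_derivative (\<lambda>t. t *\<^sub>R b)) (at 0)"
    by (intro bounded_linear_imp_has_derivative bounded_linear_scaleR_left)
  moreover have "(f has_derivative (\<lambda>h. h \<bullet> D)) (at ((0::real) *\<^sub>R b))"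
    using assms by (simp add: gderiv_def)
  ultimately have "((\<lambda>t::real. f (t *\<^sub>R b)) has_derivative (\<lambda>t. (t *\<^sub>R b) \<bullet> D)) (at 0)"
    by (rule has_derivative_compose)
  then show ?thesis
    by (simp add: has_field_derivative_def mult_commute_abs)
qed

lemma norm_sum_squared_le:
  fixes v :: "'a::finite \<Rightarrow> 'b::real_normed_vector"
  shows "(norm (\<Sum>n\<in>UNIV. v n))\<^sup>2 \<le> real CARD('a) * (\<Sum>n\<in>UNIV. (norm (v n))\<^sup>2)"
proof -
  have "(norm (\<Sum>n\<in>UNIV. v n))\<^sup>2 \<le> (\<Sum>n\<in>UNIV. norm (v n))\<^sup>2"
    by (intro power_mono norm_sum) auto
  also have "\<dots> \<le> (\<Sum>n\<in>UNIV. (norm (v n))\<^sup>2) * real CARD('a)"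
    by (rule sum_squared_le_sum_of_squares)
  finally show ?thesis by (simp add: mult.commute)
qed

section \<open>The trajectory measure\<close>

context markov_game
begin

section \<open>Action laws and one-step kernels\<close>

lemma space_action_space: "space (action_space G) = actions G"
  by (simp add: action_space_def space_restrict_space)

lemma space_refm: "space (refm G n) = actions G"
  using sets_eq_imp_space_eq[OF refm_sets[of n]] by (simp add: space_action_space)

lemma measurable_refm: "measurable (refm G n) N = measurable (action_space G) N"
  by (rule measurable_cong_sets[OF refm_sets refl])

lemma space_joint_action_space: "a \<in> space (joint_action_space G) \<longleftrightarrow> (\<forall>n. a n \<in> actions G)"
  by (auto simp: joint_action_space_def space_PiM space_action_space)

lemma space_sa_space:
  "sa \<in> space (sa_space G) \<longleftrightarrow> fst sa \<in> space (states G) \<and> (\<forall>n. snd sa n \<in> actions G)"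
  by (cases sa) (simp add: sa_space_def space_pair_measure space_joint_action_space)

lemma sets_PiM_refm: "sets (PiM UNIV (refm G)) = sets (joint_action_space G)"
  unfolding joint_action_space_def by (intro sets_PiM_cong refl refm_sets)

lemma measurable_PiM_refm: "measurable (PiM UNIV (refm G)) N = measurable (joint_action_space G) N"
  by (rule measurable_cong_sets[OF sets_PiM_refm refl])

lemma measurable_fst_sa [measurable]: "fst \<in> sa_space G \<rightarrow>\<^sub>M states G"
  by (simp add: sa_space_def)

lemma measurable_snd_sa [measurable]: "(\<lambda>sa. snd sa n) \<in> sa_space G \<rightarrow>\<^sub>M action_space G"
  by (simp add: sa_space_def joint_action_space_def)

lemma measurable_Pair_sa: "s \<in> space (states G) \<Longrightarrow> Pair s \<in> joint_action_space G \<rightarrow>\<^sub>M sa_space G"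
  by (simp add: sa_space_def)

lemma measurable_policy_action:
  assumes "s \<in> space (states G)"
  shows "policy G n \<theta> s \<in> borel_measurable (action_space G)"
  using measurable_Pair2[OF policy_measurable assms] by simp

lemma measurable_joint_policy:
  "(\<lambda>(s, a). joint_policy G \<theta> s a) \<in> borel_measurable (states G \<Otimes>\<^sub>M joint_action_space G)"
proof -
  have "(\<lambda>x. (fst x, snd x n)) \<in> states G \<Otimes>\<^sub>M joint_action_space G \<rightarrow>\<^sub>M states G \<Otimes>\<^sub>M action_space G" for n
    by (simp add: joint_action_space_def)
  from measurable_compose[OF this policy_measurable]
  have "(\<lambda>x. policy G n \<theta> (fst x) (snd x n)) \<in> borel_measurable (states G \<Otimes>\<^sub>M joint_action_space G)" for n
    by simp
  then show ?thesis
    by (auto simp: joint_policy_def split_beta' intro!: borel_measurable_prod)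
qed

lemma measurable_joint_policy_action:
  assumes "s \<in> space (states G)"
  shows "joint_policy G \<theta> s \<in> borel_measurable (joint_action_space G)"
  using measurable_Pair2[OF measurable_joint_policy assms] by simp

lemma sets_agent_law: "sets (agent_law G n \<theta> s) = sets (action_space G)"
  by (simp add: agent_law_def refm_sets)

lemma prob_space_agent_law:
  assumes s: "s \<in> space (states G)"
  shows "prob_space (agent_law G n \<theta> s)"
proof
  have "emeasure (agent_law G n \<theta> s) (space (agent_law G n \<theta> s))
      = (\<integral>\<^sup>+a. ennreal (policy G n \<theta> s a) * indicator (space (refm G n)) a \<partial>refm G n)"
    using measurable_policy_action[OF s, of n \<theta>]
    by (simp add: agent_law_def emeasure_density measurable_refm)
  also have "\<dots> = (\<integral>\<^sup>+a. ennreal (policy G n \<theta> s a) \<partial>refm G n)"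
    by (intro nn_integral_cong) simp
  finally show "emeasure (agent_law G n \<theta> s) (space (agent_law G n \<theta> s)) = 1"
    using policy_total[OF s] by simp
qed

lemma sigma_finite_PiM_refm: "sigma_finite_measure (PiM UNIV (refm G))"
proof -
  interpret product_sigma_finite "refm G" by (rule product_sigma_finite.intro) (rule refm_sigma_finite)
  show ?thesis by (rule sigma_finite) simp
qed

text \<open>The two measures are compared on rectangles, where Tonelli factorises the product
  density over the agents. The product form shows that the joint law is a probability measure and
  exposes its marginals.\<close>

lemma joint_law_eq_PiM:
  assumes s: "s \<in> space (states G)"
  shows "joint_law G \<theta> s = PiM UNIV (\<lambda>n. agent_law G n \<theta> s)"
proof -
  interpret R: product_sigma_finite "refm G" by (rule product_sigma_finite.intro) (rule refm_sigma_finite)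
  interpret P: product_prob_space "\<lambda>n. agent_law G n \<theta> s" UNIV
    by (intro product_prob_spaceI prob_space_agent_law s)
  have pm: "policy G n \<theta> s \<in> borel_measurable (refm G n)" for n
    using measurable_policy_action[OF s] by (simp add: measurable_refm)
  show ?thesis
  proof (rule P.PiM_eqI)
    show "sets (joint_law G \<theta> s) = sets (PiM UNIV (\<lambda>n. agent_law G n \<theta> s))"
      unfolding joint_law_def sets_density
      by (intro sets_PiM_cong) (auto simp: agent_law_def)
    fix A :: "'n \<Rightarrow> (real ^ 'k) set"
    assume "\<And>i. i \<in> UNIV \<Longrightarrow> A i \<in> sets (agent_law G i \<theta> s)"
    then have A: "A i \<in> sets (refm G i)" for i by (simp add: agent_law_def)
    have A': "Pi\<^sub>E UNIV A \<in> sets (PiM UNIV (refm G))"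
      using A by (intro sets_PiM_I_finite) auto
    have jp: "joint_policy G \<theta> s \<in> borel_measurable (PiM UNIV (refm G))"
      using measurable_joint_policy_action[OF s] by (simp add: measurable_PiM_refm)
    have "emeasure (joint_law G \<theta> s) (Pi\<^sub>E UNIV A)
        = (\<integral>\<^sup>+a. ennreal (joint_policy G \<theta> s a) * indicator (Pi\<^sub>E UNIV A) a \<partial>PiM UNIV (refm G))"
      unfolding joint_law_def using A' jp by (intro emeasure_density) auto
    also have "\<dots> = (\<integral>\<^sup>+a. (\<Prod>n\<in>UNIV. ennreal (policy G n \<theta> s (a n)) * indicator (A n) (a n)) \<partial>PiM UNIV (refm G))"
    proof (rule nn_integral_cong)
      fix a assume "a \<in> space (PiM UNIV (refm G))"
      then have "a n \<in> actions G" for n by (auto simp: space_PiM space_refm)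
      \<comment> \<open>Since \<open>ennreal\<close> truncates negative reals, commuting it with the
        product uses the positivity of the policies.\<close>
      then have "ennreal (joint_policy G \<theta> s a) = (\<Prod>n\<in>UNIV. ennreal (policy G n \<theta> s (a n)))"
        unfolding joint_policy_def
        by (intro prod_ennreal[symmetric] less_imp_le policy_pos s)
      moreover have "(indicator (Pi\<^sub>E UNIV A) a :: ennreal) = (\<Prod>n\<in>UNIV. indicator (A n) (a n))"
      proof (cases "\<forall>n. a n \<in> A n")
        case False
        then obtain n where "a n \<notin> A n" by auto
        moreover from this have "(\<Prod>n\<in>UNIV. indicator (A n) (a n)) = (0::ennreal)"
          by (intro prod_zero) (auto intro!: exI[of _ n])
        ultimately show ?thesis by (auto simp: indicator_def)
      qed (auto simp: indicator_def)
      ultimately show "ennreal (joint_policy G \<theta> s a) * indicator (Pi\<^sub>E UNIV A) a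
          = (\<Prod>n\<in>UNIV. ennreal (policy G n \<theta> s (a n)) * indicator (A n) (a n))"
        by (simp add: prod.distrib)
    qed
    also have "\<dots> = (\<Prod>n\<in>UNIV. \<integral>\<^sup>+x. ennreal (policy G n \<theta> s x) * indicator (A n) x \<partial>refm G n)"
      using A pm by (intro R.product_nn_integral_prod) auto
    also have "\<dots> = (\<Prod>n\<in>UNIV. emeasure (agent_law G n \<theta> s) (A n))"
      unfolding agent_law_def using A pm by (intro prod.cong refl emeasure_density[symmetric]) auto
    finally show "emeasure (joint_law G \<theta> s) (Pi\<^sub>E UNIV A)
        = (\<Prod>i\<in>UNIV. emeasure (agent_law G i \<theta> s) (A i))" .
  qed simp
qed

lemma prob_space_joint_law: "s \<in> space (states G) \<Longrightarrow> prob_space (joint_law G \<theta> s)"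
  unfolding joint_law_eq_PiM by (intro prob_space_PiM prob_space_agent_law)

lemma sets_joint_law: "sets (joint_law G \<theta> s) = sets (joint_action_space G)"
  by (simp add: joint_law_def sets_PiM_refm)

text \<open>Moment assumptions concern the action of a single agent; this marginal carries them over
  to the joint law.\<close>

lemma joint_law_component:
  assumes "s \<in> space (states G)"
  shows "distr (joint_law G \<theta> s) (action_space G) (\<lambda>a. a n) = agent_law G n \<theta> s"
proof -
  have "distr (joint_law G \<theta> s) (agent_law G n \<theta> s) (\<lambda>a. a n) = agent_law G n \<theta> s"
    unfolding joint_law_eq_PiM[OF assms]
    by (rule distr_PiM_component) (auto intro: prob_space_agent_law assms)
  moreover have "distr (joint_law G \<theta> s) (action_space G) (\<lambda>a. a n)
      = distr (joint_law G \<theta> s) (agent_law G n \<theta> s) (\<lambda>a. a n)"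
    by (intro distr_cong refl) (simp add: sets_agent_law)
  ultimately show ?thesis by simp
qed

text \<open>The mass of a fixed set is an integral of a jointly measurable density against one
  sigma-finite measure that does not depend on the state.\<close>

lemma measurable_joint_law: "joint_law G \<theta> \<in> states G \<rightarrow>\<^sub>M prob_algebra (joint_action_space G)"
proof (intro measurable_prob_algebraI measurable_subprob_algebra)
  fix A assume A: "A \<in> sets (joint_action_space G)"
  interpret sigma_finite_measure "PiM UNIV (refm G)" by (rule sigma_finite_PiM_refm)
  have sp: "sets (states G \<Otimes>\<^sub>M PiM UNIV (refm G)) = sets (states G \<Otimes>\<^sub>M joint_action_space G)"
    by (intro sets_pair_measure_cong refl sets_PiM_refm)
  have "(\<lambda>(s, a). joint_policy G \<theta> s a) \<in> borel_measurable (states G \<Otimes>\<^sub>M PiM UNIV (refm G))"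
    using measurable_joint_policy by (simp add: measurable_cong_sets[OF sp refl])
  moreover have "A \<in> sets (PiM UNIV (refm G))" using A by (simp add: sets_PiM_refm)
  ultimately have "(\<lambda>(s, a). ennreal (joint_policy G \<theta> s a) * indicator A a)
      \<in> borel_measurable (states G \<Otimes>\<^sub>M PiM UNIV (refm G))"
    by (auto simp: split_beta')
  from borel_measurable_nn_integral[OF this]
  show "(\<lambda>s. emeasure (joint_law G \<theta> s) A) \<in> borel_measurable (states G)"
    unfolding joint_law_def
    using A measurable_joint_policy_action
    by (subst measurable_cong[OF emeasure_density]) (auto simp: measurable_PiM_refm sets_PiM_refm)
qed (auto simp: sets_joint_law intro: prob_space_joint_law prob_space_imp_subprob_space)

lemma measurable_start_law [measurable]: "start_law G \<theta> \<in> states G \<rightarrow>\<^sub>M prob_algebra (sa_space G)"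
  unfolding start_law_def[abs_def]
  by (rule measurable_distr_prob_space2[OF measurable_joint_law]) (simp add: sa_space_def)

lemma prob_space_start_law: "s \<in> space (states G) \<Longrightarrow> prob_space (start_law G \<theta> s)"
  using measurable_space[OF measurable_start_law] by (simp add: space_prob_algebra)

lemma sets_start_law [simp, measurable_cong]: "sets (start_law G \<theta> s) = sets (sa_space G)"
  by (simp add: start_law_def)

lemma measurable_step_law [measurable]: "step_law G \<theta> \<in> sa_space G \<rightarrow>\<^sub>M prob_algebra (sa_space G)"
  unfolding step_law_def[abs_def]
  by (rule measurable_bind_prob_space[OF transition measurable_start_law])

lemma prob_space_step_law: "sa \<in> space (sa_space G) \<Longrightarrow> prob_space (step_law G \<theta> sa)"
  using measurable_space[OF measurable_step_law] by (simp add: space_prob_algebra)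

lemma sets_step_law: "sa \<in> space (sa_space G) \<Longrightarrow> sets (step_law G \<theta> sa) = sets (sa_space G)"
  using measurable_space[OF measurable_step_law] by (simp add: space_prob_algebra)

lemma prob_space_transition: "sa \<in> space (sa_space G) \<Longrightarrow> prob_space (transition G sa)"
  using measurable_space[OF transition] by (simp add: space_prob_algebra)

lemma sets_transition: "sa \<in> space (sa_space G) \<Longrightarrow> sets (transition G sa) = sets (states G)"
  using measurable_space[OF transition] by (simp add: space_prob_algebra)


section \<open>The trajectory law as a kernel in the start state\<close>

text \<open>The start state stays a variable because the trajectory law has to be a kernel in it:
  the fresh trajectories behind the value estimates start in a random state.\<close>

lemma measurable_traj_kernel:
  "(\<lambda>(s, \<omega>). traj_kernel G \<theta> s n \<omega>) \<in>
     states G \<Otimes>\<^sub>M PiM {0..<n} (\<lambda>_. sa_space G) \<rightarrow>\<^sub>M prob_algebra (sa_space G)"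
proof (cases n)
  case 0
  then show ?thesis
    by (simp add: traj_kernel_def split_beta' measurable_compose[OF measurable_fst measurable_start_law])
next
  case (Suc k)
  have "(\<lambda>x. snd x k) \<in> states G \<Otimes>\<^sub>M PiM {0..<Suc k} (\<lambda>_. sa_space G) \<rightarrow>\<^sub>M sa_space G"
    by (rule measurable_compose[OF measurable_snd measurable_component_singleton]) simp
  from measurable_compose[OF this measurable_step_law] Suc show ?thesis
    by (simp add: traj_kernel_def split_beta')
qed

lemma Ionescu_Tulcea_traj:
  assumes s: "s \<in> space (states G)"
  shows "Ionescu_Tulcea (traj_kernel G \<theta> s) (\<lambda>_. sa_space G)"
proof (rule Ionescu_Tulcea.intro)
  fix n
  have *: "traj_kernel G \<theta> s n \<in> PiM {0..<n} (\<lambda>_. sa_space G) \<rightarrow>\<^sub>M prob_algebra (sa_space G)"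
    using measurable_Pair2[OF measurable_traj_kernel s] by simp
  then show "traj_kernel G \<theta> s n \<in> PiM {0..<n} (\<lambda>_. sa_space G) \<rightarrow>\<^sub>M subprob_algebra (sa_space G)"
    by (rule measurable_prob_algebraD)
  fix x assume "x \<in> space (PiM {0..<n} (\<lambda>_. sa_space G))"
  then show "prob_space (traj_kernel G \<theta> s n x)"
    using measurable_space[OF *] by (simp add: space_prob_algebra)
qed

lemma sets_traj [simp, measurable_cong]:
  assumes "s \<in> space (states G)"
  shows "sets (traj G \<theta> s) = sets (PiM UNIV (\<lambda>_. sa_space G))"
proof -
  interpret IT: Ionescu_Tulcea "traj_kernel G \<theta> s" "\<lambda>_. sa_space G" by (rule Ionescu_Tulcea_traj[OF assms])
  show ?thesis unfolding traj_def by (rule IT.PF.sets_lim)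
qed

lemma space_traj [simp]:
  "s \<in> space (states G) \<Longrightarrow> space (traj G \<theta> s) = space (PiM UNIV (\<lambda>_. sa_space G))"
  using sets_eq_imp_space_eq[OF sets_traj] by simp

text \<open>Finite prefixes, covering the times before \<open>n\<close>, obey a recursion in
  \<open>n\<close> that the projective limit itself does not offer; facts about finitely many
  coordinates of \<open>traj\<close> are proved on them.\<close>

definition history_law ::
  "real ^ 'm \<Rightarrow> 's \<Rightarrow> nat \<Rightarrow> (nat \<Rightarrow> 's \<times> ('n \<Rightarrow> real ^ 'k)) measure" where
  "history_law \<theta> s n = distr (traj G \<theta> s) (PiM {0..<n} (\<lambda>_. sa_space G)) (\<lambda>\<omega>. restrict \<omega> {0..<n})"

lemma measurable_restrict_traj:
  "s \<in> space (states G) \<Longrightarrow> (\<lambda>\<omega>. restrict \<omega> J) \<in> traj G \<theta> s \<rightarrow>\<^sub>M PiM J (\<lambda>_. sa_space G)"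
  by (simp add: measurable_cong_sets[OF sets_traj refl] measurable_restrict_subset)

lemma history_law_eq_C:
  assumes s: "s \<in> space (states G)"
  shows "history_law \<theta> s n = Ionescu_Tulcea.C (traj_kernel G \<theta> s) (\<lambda>_. sa_space G) 0 n (\<lambda>_. undefined)"
proof -
  interpret IT: Ionescu_Tulcea "traj_kernel G \<theta> s" "\<lambda>_. sa_space G" by (rule Ionescu_Tulcea_traj[OF s])
  \<comment> \<open>The measure \<open>IT.CI J\<close> runs the chain up to
    \<open>IT.up_to J\<close>, which may exceed what \<open>J\<close> asks for, and then restricts;
    only this inequality is needed to cut back to \<open>n\<close> steps.\<close>
  have le: "n \<le> IT.up_to {0..<n}"
    using IT.up_to[of "{0..<n}"] by auto
  have "history_law \<theta> s n = IT.CI {0..<n}"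
    unfolding history_law_def traj_def by (rule IT.distr_lim) simp
  also have "\<dots> = IT.C 0 n (\<lambda>_. undefined)"
    using IT.distr_C[OF le, of "\<lambda>_. undefined" 0] unfolding IT.CI_def by (simp add: space_PiM)
  finally show ?thesis .
qed

lemma history_law_0:
  "s \<in> space (states G) \<Longrightarrow>
     history_law \<theta> s 0 = return (PiM {0..<0} (\<lambda>_. sa_space G)) (\<lambda>_. undefined)"
  using Ionescu_Tulcea.C.simps(1)[OF Ionescu_Tulcea_traj] by (simp add: history_law_eq_C)

lemma history_law_Suc:
  assumes s: "s \<in> space (states G)"
  shows "history_law \<theta> s (Suc n) = history_law \<theta> s n \<bind> (\<lambda>\<omega>.
     distr (traj_kernel G \<theta> s n \<omega>) (PiM {0..<Suc n} (\<lambda>_. sa_space G)) (fun_upd \<omega> n))"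
proof -
  interpret IT: Ionescu_Tulcea "traj_kernel G \<theta> s" "\<lambda>_. sa_space G" by (rule Ionescu_Tulcea_traj[OF s])
  show ?thesis using s by (simp add: history_law_eq_C IT.eP_def[abs_def])
qed

lemma sets_history_law [simp]: "sets (history_law \<theta> s n) = sets (PiM {0..<n} (\<lambda>_. sa_space G))"
  by (simp add: history_law_def)

lemma measurable_history_step:
  "(\<lambda>(s, \<omega>). distr (traj_kernel G \<theta> s n \<omega>) (PiM {0..<Suc n} (\<lambda>_. sa_space G)) (fun_upd \<omega> n)) \<in>
     states G \<Otimes>\<^sub>M PiM {0..<n} (\<lambda>_. sa_space G) \<rightarrow>\<^sub>M prob_algebra (PiM {0..<Suc n} (\<lambda>_. sa_space G))"
  unfolding split_beta'
proof (rule measurable_distr_prob_space2[where M="sa_space G"])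
  show "(\<lambda>x. traj_kernel G \<theta> (fst x) n (snd x)) \<in>
     states G \<Otimes>\<^sub>M PiM {0..<n} (\<lambda>_. sa_space G) \<rightarrow>\<^sub>M prob_algebra (sa_space G)"
    using measurable_traj_kernel by (simp add: split_beta')
  show "(\<lambda>(x, y). (snd x)(n := y)) \<in>
     (states G \<Otimes>\<^sub>M PiM {0..<n} (\<lambda>_. sa_space G)) \<Otimes>\<^sub>M sa_space G \<rightarrow>\<^sub>M PiM {0..<Suc n} (\<lambda>_. sa_space G)"
    unfolding split_beta' by (rule measurable_fun_upd[where J="{0..<n}"]) auto
qed

lemma measurable_history_law:
  "(\<lambda>s. history_law \<theta> s n) \<in> states G \<rightarrow>\<^sub>M prob_algebra (PiM {0..<n} (\<lambda>_. sa_space G))"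
proof (induction n)
  case 0
  have "(\<lambda>s. return (PiM {0::nat..<0} (\<lambda>_. sa_space G)) (\<lambda>_. undefined)) \<in>
      states G \<rightarrow>\<^sub>M prob_algebra (PiM {0..<0} (\<lambda>_. sa_space G))"
    by (intro measurable_const) (auto simp: space_prob_algebra space_PiM intro!: prob_space_return)
  then show ?case by (subst measurable_cong[OF history_law_0])
next
  case (Suc n)
  have "(\<lambda>s. history_law \<theta> s n \<bind> (\<lambda>\<omega>.
     distr (traj_kernel G \<theta> s n \<omega>) (PiM {0..<Suc n} (\<lambda>_. sa_space G)) (fun_upd \<omega> n)))
    \<in> states G \<rightarrow>\<^sub>M prob_algebra (PiM {0..<Suc n} (\<lambda>_. sa_space G))"
    by (rule measurable_bind_prob_space2[OF Suc measurable_history_step])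
  then show ?case by (simp add: history_law_Suc cong: measurable_cong)
qed

text \<open>A pushforward preserves total mass, so the prefix of length 0 already decides
  it.\<close>

lemma prob_space_traj:
  assumes s: "s \<in> space (states G)"
  shows "prob_space (traj G \<theta> s)"
proof (rule prob_space_distrD[OF measurable_restrict_traj[OF s, where J="{0..<0}"]])
  show "prob_space (distr (traj G \<theta> s) (PiM {0..<0} (\<lambda>_. sa_space G)) (\<lambda>\<omega>. restrict \<omega> {0..<0}))"
    using measurable_space[OF measurable_history_law s, of \<theta> 0]
    by (simp add: history_law_def space_prob_algebra)
qed

text \<open>Cylinders generate the product and are stable under intersection, and the mass of a
  cylinder is that of its base under a finite \<open>history_law\<close>, which is measurable in the
  start state.\<close>

lemma measurable_traj [measurable]:
  "traj G \<theta> \<in> states G \<rightarrow>\<^sub>M prob_algebra (PiM UNIV (\<lambda>_. sa_space G))"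
proof -
  \<comment> \<open>The cylinder sets do not depend on the start state; interpreting at
    \<open>init_state G\<close> merely makes them available.\<close>
  interpret IT: Ionescu_Tulcea "traj_kernel G \<theta> (init_state G)" "\<lambda>_. sa_space G"
    by (rule Ionescu_Tulcea_traj[OF init_state])
  interpret gen: algebra "space (PiM UNIV (\<lambda>_. sa_space G))" IT.PF.generator
    by (rule IT.PF.algebra_generator)
  show ?thesis
  proof (rule measurable_prob_algebra_generated[OF IT.PF.sets_PiM_generator])
    show "Int_stable IT.PF.generator" by (auto simp: Int_stable_def)
    show "IT.PF.generator \<subseteq> Pow (space (PiM UNIV (\<lambda>_. sa_space G)))" by (rule gen.space_closed)
    fix A assume "A \<in> IT.PF.generator"
    then obtain J X where A: "A = IT.PF.emb UNIV J X" "finite J" "X \<in> sets (PiM J (\<lambda>_. sa_space G))"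
      by (auto elim: IT.PF.generator.cases)
    define n where "n = IT.up_to J"
    have J: "J \<subseteq> {0..<n}" unfolding n_def by (rule IT.up_to[OF A(2)])
    have X: "IT.PF.emb {0..<n} J X \<in> sets (PiM {0..<n} (\<lambda>_. sa_space G))"
      using J A(3) by (intro measurable_prod_emb) auto
    have eq: "emeasure (traj G \<theta> s) A = emeasure (history_law \<theta> s n) (IT.PF.emb {0..<n} J X)"
      if s: "s \<in> space (states G)" for s
    proof -
      have "emeasure (history_law \<theta> s n) (IT.PF.emb {0..<n} J X)
          = emeasure (traj G \<theta> s) ((\<lambda>\<omega>. restrict \<omega> {0..<n}) -` IT.PF.emb {0..<n} J X \<inter> space (traj G \<theta> s))"
        unfolding history_law_def by (rule emeasure_distr[OF measurable_restrict_traj[OF s] X])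
      also have "(\<lambda>\<omega>. restrict \<omega> {0..<n}) -` IT.PF.emb {0..<n} J X \<inter> space (traj G \<theta> s)
          = IT.PF.emb UNIV {0..<n} (IT.PF.emb {0..<n} J X)"
        using s by (simp add: prod_emb_def space_PiM)
      also have "\<dots> = A" using J A(1) by simp
      finally show ?thesis by simp
    qed
    have "(\<lambda>s. emeasure (history_law \<theta> s n) (IT.PF.emb {0..<n} J X)) \<in> borel_measurable (states G)"
      by (rule measurable_emeasure_kernel[OF measurable_prob_algebraD[OF measurable_history_law] X])
    then show "(\<lambda>s. emeasure (traj G \<theta> s) A) \<in> borel_measurable (states G)"
      by (simp add: eq cong: measurable_cong)
  qed (auto intro: prob_space_traj)
qed

lemma measurable_coordinate: "s \<in> space (states G) \<Longrightarrow> (\<lambda>\<omega>. \<omega> t) \<in> traj G \<theta> s \<rightarrow>\<^sub>M sa_space G"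
  by (simp add: measurable_cong_sets[OF sets_traj refl])

lemma space_traj_coordinate:
  "s \<in> space (states G) \<Longrightarrow> \<omega> \<in> space (traj G \<theta> s) \<Longrightarrow> \<omega> t \<in> space (sa_space G)"
  by (auto simp: space_PiM)

lemma prob_space_history_law: "s \<in> space (states G) \<Longrightarrow> prob_space (history_law \<theta> s n)"
  using measurable_space[OF measurable_history_law] by (simp add: space_prob_algebra)

lemma traj_coordinate_0:
  assumes s: "s \<in> space (states G)"
  shows "distr (traj G \<theta> s) (sa_space G) (\<lambda>\<omega>. \<omega> 0) = start_law G \<theta> s"
proof -
  have m: "(\<lambda>\<omega>. \<omega> 0) \<in> PiM {0..<Suc 0} (\<lambda>_. sa_space G) \<rightarrow>\<^sub>M sa_space G"
    by (rule measurable_component_singleton) simp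
  have u: "fun_upd (\<lambda>_. undefined) 0 \<in> start_law G \<theta> s \<rightarrow>\<^sub>M PiM {0..<Suc 0} (\<lambda>_. sa_space G)"
  proof (rule measurable_fun_upd[where J="{0::nat..<0}"])
    show "(\<lambda>x. \<lambda>_. undefined) \<in> start_law G \<theta> s \<rightarrow>\<^sub>M PiM {0::nat..<0} (\<lambda>_. sa_space G)"
      by (rule measurable_const) (auto simp: space_PiM extensional_def)
  qed auto
  have k: "(\<lambda>\<omega>. distr (traj_kernel G \<theta> s 0 \<omega>) (PiM {0..<Suc 0} (\<lambda>_. sa_space G)) (fun_upd \<omega> 0))
      \<in> PiM {0..<0} (\<lambda>_. sa_space G) \<rightarrow>\<^sub>M subprob_algebra (PiM {0..<Suc 0} (\<lambda>_. sa_space G))"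
    using measurable_Pair2[OF measurable_prob_algebraD[OF measurable_history_step] s, of \<theta> 0] by simp
  have "history_law \<theta> s (Suc 0)
      = distr (start_law G \<theta> s) (PiM {0..<Suc 0} (\<lambda>_. sa_space G)) (fun_upd (\<lambda>_. undefined) 0)"
    unfolding history_law_Suc[OF s] history_law_0[OF s]
    by (subst bind_return[OF k]) (simp_all add: traj_kernel_def space_PiM)
  then have "distr (history_law \<theta> s (Suc 0)) (sa_space G) (\<lambda>\<omega>. \<omega> 0)
      = distr (distr (start_law G \<theta> s) (PiM {0..<Suc 0} (\<lambda>_. sa_space G)) (fun_upd (\<lambda>_. undefined) 0))
          (sa_space G) (\<lambda>\<omega>. \<omega> 0)"
    by (rule arg_cong)
  also have "\<dots> = distr (start_law G \<theta> s) (sa_space G) (\<lambda>x. x)"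
    unfolding distr_distr[OF m u] by (simp add: comp_def)
  also have "\<dots> = start_law G \<theta> s" by (rule distr_id2) simp
  finally show ?thesis
    unfolding history_law_def distr_distr[OF m measurable_restrict_traj[OF s]] by (simp add: comp_def)
qed

lemma history_law_Suc_Suc:
  assumes s: "s \<in> space (states G)"
  shows "history_law \<theta> s (Suc (Suc n)) = history_law \<theta> s (Suc n) \<bind> (\<lambda>\<omega>.
     distr (step_law G \<theta> (\<omega> n)) (PiM {0..<Suc (Suc n)} (\<lambda>_. sa_space G)) (fun_upd \<omega> (Suc n)))"
  unfolding history_law_Suc[OF s, of \<theta> "Suc n"] by (simp add: traj_kernel_def)

lemma measurable_step_history:
  assumes s: "s \<in> space (states G)"
  shows "(\<lambda>\<omega>. distr (step_law G \<theta> (\<omega> n)) (PiM {0..<Suc (Suc n)} (\<lambda>_. sa_space G)) (fun_upd \<omega> (Suc n)))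
     \<in> history_law \<theta> s (Suc n) \<rightarrow>\<^sub>M prob_algebra (PiM {0..<Suc (Suc n)} (\<lambda>_. sa_space G))"
  using measurable_Pair2[OF measurable_history_step[of \<theta> "Suc n"] s]
  by (simp add: traj_kernel_def measurable_cong_sets[OF sets_history_law refl])

lemma measurable_fun_upd_history:
  assumes "\<omega> \<in> space (PiM {0..<Suc n} (\<lambda>_. sa_space G))"
  shows "fun_upd \<omega> (Suc n) \<in> step_law G \<theta> (\<omega> n) \<rightarrow>\<^sub>M PiM {0..<Suc (Suc n)} (\<lambda>_. sa_space G)"
proof (rule measurable_fun_upd[where J="{0..<Suc n}"])
  show "(\<lambda>x. \<omega>) \<in> step_law G \<theta> (\<omega> n) \<rightarrow>\<^sub>M PiM {0..<Suc n} (\<lambda>_. sa_space G)"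
    by (rule measurable_const) (rule assms)
  have "\<omega> n \<in> space (sa_space G)" using assms by (auto simp: space_PiM)
  then show "(\<lambda>x. x) \<in> step_law G \<theta> (\<omega> n) \<rightarrow>\<^sub>M sa_space G"
    by (simp add: measurable_cong_sets[OF sets_step_law refl])
qed auto

text \<open>One Chapman-Kolmogorov step: when only the newest coordinate of the extended history is
  kept, its kernel reduces to \<open>step_law\<close> at the last pair.\<close>

lemma traj_coordinate_Suc:
  assumes s: "s \<in> space (states G)"
  shows "distr (traj G \<theta> s) (sa_space G) (\<lambda>\<omega>. \<omega> (Suc n))
     = distr (traj G \<theta> s) (sa_space G) (\<lambda>\<omega>. \<omega> n) \<bind> step_law G \<theta>"
proof -
  let ?K = "\<lambda>\<omega>. distr (step_law G \<theta> (\<omega> n)) (PiM {0..<Suc (Suc n)} (\<lambda>_. sa_space G)) (fun_upd \<omega> (Suc n))"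
  have m: "(\<lambda>\<omega>. \<omega> t) \<in> PiM {0..<m} (\<lambda>_. sa_space G) \<rightarrow>\<^sub>M sa_space G" if "t < m" for t m :: nat
    using that by (intro measurable_component_singleton) simp
  have hist: "distr (traj G \<theta> s) (sa_space G) (\<lambda>\<omega>. \<omega> t) = distr (history_law \<theta> s m) (sa_space G) (\<lambda>\<omega>. \<omega> t)"
    if "t < m" for t m
    unfolding history_law_def using that
    by (simp add: distr_distr[OF m measurable_restrict_traj[OF s]] comp_def)
  have ne: "space (history_law \<theta> s (Suc n)) \<noteq> {}"
    by (rule prob_space.not_empty[OF prob_space_history_law[OF s]])
  have "distr (traj G \<theta> s) (sa_space G) (\<lambda>\<omega>. \<omega> (Suc n))
      = distr (history_law \<theta> s (Suc n) \<bind> ?K) (sa_space G) (\<lambda>\<omega>. \<omega> (Suc n))"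
    using hist[of "Suc n" "Suc (Suc n)"] by (simp add: history_law_Suc_Suc[OF s])
  also have "\<dots> = history_law \<theta> s (Suc n) \<bind> (\<lambda>\<omega>. distr (?K \<omega>) (sa_space G) (\<lambda>\<omega>. \<omega> (Suc n)))"
    by (rule distr_bind[OF measurable_prob_algebraD[OF measurable_step_history[OF s]] ne m]) simp
  also have "\<dots> = history_law \<theta> s (Suc n) \<bind> (\<lambda>\<omega>. step_law G \<theta> (\<omega> n))"
  proof (intro bind_cong refl)
    fix \<omega> assume "\<omega> \<in> space (history_law \<theta> s (Suc n))"
    then have \<omega>: "\<omega> \<in> space (PiM {0..<Suc n} (\<lambda>_. sa_space G))"
      by (simp add: history_law_def)
    then have "\<omega> n \<in> space (sa_space G)" by (auto simp: space_PiM)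
    then show "distr (?K \<omega>) (sa_space G) (\<lambda>\<omega>. \<omega> (Suc n)) = step_law G \<theta> (\<omega> n)"
      by (subst distr_distr[OF m measurable_fun_upd_history[OF \<omega>]]) (simp_all add: comp_def distr_id2 sets_step_law)
  qed
  also have "\<dots> = distr (history_law \<theta> s (Suc n)) (sa_space G) (\<lambda>\<omega>. \<omega> n) \<bind> step_law G \<theta>"
    using ne by (intro bind_distr[symmetric, OF _ measurable_prob_algebraD[OF measurable_step_law]])
      (simp_all add: measurable_cong_sets[OF sets_history_law refl] m)
  finally show ?thesis using hist[of n "Suc n"] by simp
qed

section \<open>The transition operator and the Markov property\<close>

text \<open>This is the Markov operator on functions of a state-action pair; its k-th power is the
  conditional expectation k steps ahead given the current pair.\<close>

definition step_op :: "real ^ 'm \<Rightarrow> ('s \<times> ('n \<Rightarrow> real ^ 'k) \<Rightarrow> real) \<Rightarrow> 's \<times> ('n \<Rightarrow> real ^ 'k) \<Rightarrow> real" where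
  "step_op \<theta> g sa = (\<integral>x. g x \<partial>step_law G \<theta> sa)"

lemma measurable_step_op:
  "g \<in> borel_measurable (sa_space G) \<Longrightarrow> step_op \<theta> g \<in> borel_measurable (sa_space G)"
  unfolding step_op_def[abs_def] by (rule measurable_integral_kernel[OF measurable_step_law])

lemma space_step_law: "sa \<in> space (sa_space G) \<Longrightarrow> space (step_law G \<theta> sa) = space (sa_space G)"
  by (rule sets_eq_imp_space_eq[OF sets_step_law])

lemma space_start_law: "space (start_law G \<theta> s) = space (sa_space G)"
  by (rule sets_eq_imp_space_eq[OF sets_start_law])

lemma space_transition: "sa \<in> space (sa_space G) \<Longrightarrow> space (transition G sa) = space (states G)"
  by (rule sets_eq_imp_space_eq[OF sets_transition])

lemma abs_step_op_le:
  assumes "\<And>x. x \<in> space (sa_space G) \<Longrightarrow> \<bar>g x\<bar> \<le> C" "sa \<in> space (sa_space G)"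
  shows "\<bar>step_op \<theta> g sa\<bar> \<le> C"
proof -
  have "0 \<le> C" using assms abs_ge_zero order_trans by blast
  then show ?thesis
    unfolding step_op_def
    using assms by (intro prob_space.abs_integral_le_const prob_space_step_law) (auto simp: space_step_law)
qed

lemma measurable_step_op_funpow:
  "g \<in> borel_measurable (sa_space G) \<Longrightarrow> (step_op \<theta> ^^ k) g \<in> borel_measurable (sa_space G)"
  by (induction k) (auto intro: measurable_step_op)

lemma abs_step_op_funpow_le:
  assumes "\<And>x. x \<in> space (sa_space G) \<Longrightarrow> \<bar>g x\<bar> \<le> C" "sa \<in> space (sa_space G)"
  shows "\<bar>(step_op \<theta> ^^ k) g sa\<bar> \<le> C"
  using assms(2)
proof (induction k arbitrary: sa)
  case (Suc k)
  then show ?case by (simp add: abs_step_op_le)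
qed (use assms in simp)

text \<open>Given the pairs up to time \<open>n\<close>, the next one depends on the last alone, and
  writing coordinate \<open>Suc n\<close> leaves coordinate \<open>t\<close> unchanged. Times
  \<open>t\<close> before \<open>n\<close> are allowed so that the step can be iterated;
  \<open>f\<close> may be an unbounded score while \<open>g\<close> is bounded.\<close>

lemma integral_traj_Suc:
  assumes s: "s \<in> space (states G)" and t: "t \<le> n"
    and f: "f \<in> borel_measurable (sa_space G)" "integrable (traj G \<theta> s) (\<lambda>\<omega>. f (\<omega> t))"
    and g: "g \<in> borel_measurable (sa_space G)" "\<And>x. x \<in> space (sa_space G) \<Longrightarrow> \<bar>g x\<bar> \<le> C"
  shows "(\<integral>\<omega>. f (\<omega> t) * g (\<omega> (Suc n)) \<partial>traj G \<theta> s) = (\<integral>\<omega>. f (\<omega> t) * step_op \<theta> g (\<omega> n) \<partial>traj G \<theta> s)"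
proof -
  let ?K = "\<lambda>\<omega>. distr (step_law G \<theta> (\<omega> n)) (PiM {0..<Suc (Suc n)} (\<lambda>_. sa_space G)) (fun_upd \<omega> (Suc n))"
  let ?H = "history_law \<theta> s (Suc n)"
  have m: "(\<lambda>\<omega>. h (\<omega> t)) \<in> borel_measurable (PiM {0..<m} (\<lambda>_. sa_space G))"
    if "t < m" "h \<in> borel_measurable (sa_space G)" for t m :: nat and h :: "_ \<Rightarrow> real"
    using that by (intro measurable_compose[OF measurable_component_singleton]) simp_all
  obtain x where "x \<in> space (start_law G \<theta> s)"
    using prob_space.not_empty[OF prob_space_start_law[OF s]] by blast
  then have "\<bar>g x\<bar> \<le> C" using g(2) by (simp add: space_start_law)
  then have C: "0 \<le> C" by linarith
  have mfg: "(\<lambda>\<omega>. f (\<omega> t) * g (\<omega> (Suc n))) \<in> borel_measurable (PiM {0..<Suc (Suc n)} (\<lambda>_. sa_space G))"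
    using t by (intro borel_measurable_times m f g) auto
  have fint: "integrable ?H (\<lambda>\<omega>. f (\<omega> t))"
    unfolding history_law_def using t f
    by (subst integrable_distr_eq[OF measurable_restrict_traj[OF s]]) (auto intro!: m)
  have nn: "(\<integral>\<^sup>+\<omega>. \<integral>\<^sup>+y. ennreal \<bar>f (y t) * g (y (Suc n))\<bar> \<partial>?K \<omega> \<partial>?H) < \<infinity>"
  proof -
    have "(\<integral>\<^sup>+y. ennreal \<bar>f (y t) * g (y (Suc n))\<bar> \<partial>?K \<omega>) \<le> ennreal (C * \<bar>f (\<omega> t)\<bar>)"
      if "\<omega> \<in> space ?H" for \<omega>
    proof -
      have \<omega>: "\<omega> \<in> space (PiM {0..<Suc n} (\<lambda>_. sa_space G))"
        using that by (simp add: history_law_def)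
      then have \<omega>n: "\<omega> n \<in> space (sa_space G)" by (auto simp: space_PiM)
      interpret prob_space "step_law G \<theta> (\<omega> n)" by (rule prob_space_step_law[OF \<omega>n])
      have "(\<integral>\<^sup>+y. ennreal \<bar>f (y t) * g (y (Suc n))\<bar> \<partial>?K \<omega>)
          = (\<integral>\<^sup>+x. ennreal \<bar>f (\<omega> t) * g x\<bar> \<partial>step_law G \<theta> (\<omega> n))"
        using t mfg by (subst nn_integral_distr[OF measurable_fun_upd_history[OF \<omega>]]) auto
      also have "\<dots> \<le> (\<integral>\<^sup>+x. ennreal (C * \<bar>f (\<omega> t)\<bar>) \<partial>step_law G \<theta> (\<omega> n))"
      proof (rule nn_integral_mono)
        fix x assume "x \<in> space (step_law G \<theta> (\<omega> n))"
        then have "\<bar>g x\<bar> \<le> C" using g(2) by (simp add: space_step_law[OF \<omega>n])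
        then show "ennreal \<bar>f (\<omega> t) * g x\<bar> \<le> ennreal (C * \<bar>f (\<omega> t)\<bar>)"
          by (intro ennreal_leI) (simp add: abs_mult mult.commute mult_right_mono)
      qed
      finally show ?thesis by (simp add: emeasure_space_1)
    qed
    then have "(\<integral>\<^sup>+\<omega>. \<integral>\<^sup>+y. ennreal \<bar>f (y t) * g (y (Suc n))\<bar> \<partial>?K \<omega> \<partial>?H) \<le> (\<integral>\<^sup>+\<omega>. ennreal (C * \<bar>f (\<omega> t)\<bar>) \<partial>?H)"
      by (rule nn_integral_mono)
    also have "\<dots> < \<infinity>"
      using C fint by (subst nn_integral_eq_integral) auto
    finally show ?thesis .
  qed
  have "(\<integral>\<omega>. f (\<omega> t) * g (\<omega> (Suc n)) \<partial>traj G \<theta> s) = (\<integral>\<omega>. f (\<omega> t) * g (\<omega> (Suc n)) \<partial>history_law \<theta> s (Suc (Suc n)))"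
    unfolding history_law_def using t mfg by (subst integral_distr[OF measurable_restrict_traj[OF s]]) auto
  also have "\<dots> = (\<integral>\<omega>. \<integral>y. f (y t) * g (y (Suc n)) \<partial>?K \<omega> \<partial>?H)"
    unfolding history_law_Suc_Suc[OF s]
    by (rule integral_bind_kernel[OF measurable_prob_algebraD[OF measurable_step_history[OF s]] mfg nn])
  also have "\<dots> = (\<integral>\<omega>. f (\<omega> t) * step_op \<theta> g (\<omega> n) \<partial>?H)"
  proof (intro Bochner_Integration.integral_cong refl)
    fix \<omega> assume "\<omega> \<in> space ?H"
    then have \<omega>: "\<omega> \<in> space (PiM {0..<Suc n} (\<lambda>_. sa_space G))" by (simp add: history_law_def)
    show "(\<integral>y. f (y t) * g (y (Suc n)) \<partial>?K \<omega>) = f (\<omega> t) * step_op \<theta> g (\<omega> n)"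
      unfolding step_op_def
      using t by (subst integral_distr[OF measurable_fun_upd_history[OF \<omega>] mfg]) auto
  qed
  also have "\<dots> = (\<integral>\<omega>. f (\<omega> t) * step_op \<theta> g (\<omega> n) \<partial>traj G \<theta> s)"
    unfolding history_law_def using t
    by (subst integral_distr[OF measurable_restrict_traj[OF s]])
       (auto intro!: borel_measurable_times m f measurable_step_op g)
  finally show ?thesis .
qed

text \<open>The later time is pulled back one step at a time towards the fixed time
  \<open>t\<close>. Each step replaces \<open>g\<close> by its image under the Markov operator,
  which is why the induction generalises \<open>g\<close>.\<close>

lemma integral_traj_add:
  assumes s: "s \<in> space (states G)"
    and f: "f \<in> borel_measurable (sa_space G)" "integrable (traj G \<theta> s) (\<lambda>\<omega>. f (\<omega> t))"
    and g: "g \<in> borel_measurable (sa_space G)" "\<And>x. x \<in> space (sa_space G) \<Longrightarrow> \<bar>g x\<bar> \<le> C"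
  shows "(\<integral>\<omega>. f (\<omega> t) * g (\<omega> (t + k)) \<partial>traj G \<theta> s) = (\<integral>\<omega>. f (\<omega> t) * (step_op \<theta> ^^ k) g (\<omega> t) \<partial>traj G \<theta> s)"
  using g
proof (induction k arbitrary: g)
  case (Suc k)
  have "(\<integral>\<omega>. f (\<omega> t) * g (\<omega> (t + Suc k)) \<partial>traj G \<theta> s)
      = (\<integral>\<omega>. f (\<omega> t) * step_op \<theta> g (\<omega> (t + k)) \<partial>traj G \<theta> s)"
    using integral_traj_Suc[OF s _ f Suc.prems, of "t + k"] by simp
  also have "\<dots> = (\<integral>\<omega>. f (\<omega> t) * (step_op \<theta> ^^ k) (step_op \<theta> g) (\<omega> t) \<partial>traj G \<theta> s)"
    using Suc.prems by (intro Suc.IH measurable_step_op abs_step_op_le) auto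
  finally show ?case by (simp add: funpow_swap1)
qed simp

end


section \<open>Value functions and the performance difference\<close>

locale bounded_reward_game = markov_game G for G :: "('s, 'n::finite, 'k::finite, 'm::finite) game" +
  fixes R :: real
  assumes R_pos: "0 < R"
    and reward_bound: "\<And>i s a. s \<in> space (states G) \<Longrightarrow> (\<And>n. a n \<in> actions G) \<Longrightarrow> \<bar>reward G i (s, a)\<bar> \<le> R"
begin

lemma abs_reward_le: "sa \<in> space (sa_space G) \<Longrightarrow> \<bar>reward G i sa\<bar> \<le> R"
  using reward_bound[of "fst sa" "snd sa"] by (simp add: space_sa_space)

lemma discount_bounds: "0 \<le> discount G" "discount G < 1"
  using discount by auto

section \<open>Action values, state values and the Bellman equation\<close>

text \<open>The action value is encoded as the Neumann series of the discounted Markov operator: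
  trajectories here start from states, so none starts from a prescribed state-action pair.\<close>

definition q_fun :: "real ^ 'm \<Rightarrow> 'n \<Rightarrow> 's \<times> ('n \<Rightarrow> real ^ 'k) \<Rightarrow> real" where
  "q_fun \<theta> i sa = (\<Sum>k. discount G ^ k * (step_op \<theta> ^^ k) (reward G i) sa)"

definition v_fun :: "real ^ 'm \<Rightarrow> 'n \<Rightarrow> 's \<Rightarrow> real" where
  "v_fun \<theta> i s = (\<integral>sa. q_fun \<theta> i sa \<partial>start_law G \<theta> s)"

lemma measurable_q_fun: "q_fun \<theta> i \<in> borel_measurable (sa_space G)"
  unfolding q_fun_def[abs_def]
  by (intro borel_measurable_suminf borel_measurable_times borel_measurable_const
        measurable_step_op_funpow reward)

lemma abs_q_fun_le: "sa \<in> space (sa_space G) \<Longrightarrow> \<bar>q_fun \<theta> i sa\<bar> \<le> R / (1 - discount G)"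
  unfolding q_fun_def
  by (intro abs_suminf_geometric_le discount_bounds abs_step_op_funpow_le abs_reward_le)

lemma value_bound_nonneg: "0 \<le> R / (1 - discount G)"
  using R_pos discount by simp

lemma measurable_v_fun: "v_fun \<theta> i \<in> borel_measurable (states G)"
  unfolding v_fun_def[abs_def]
  by (rule measurable_integral_kernel[OF measurable_start_law measurable_q_fun])

lemma abs_v_fun_le: "s \<in> space (states G) \<Longrightarrow> \<bar>v_fun \<theta> i s\<bar> \<le> R / (1 - discount G)"
  unfolding v_fun_def
  by (intro prob_space.abs_integral_le_const prob_space_start_law abs_q_fun_le value_bound_nonneg)
     (auto simp: space_start_law)

lemma step_op_eq_transition:
  assumes sa: "sa \<in> space (sa_space G)"
    and g: "g \<in> borel_measurable (sa_space G)" "\<And>x. x \<in> space (sa_space G) \<Longrightarrow> \<bar>g x\<bar> \<le> C"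
  shows "step_op \<theta> g sa = (\<integral>s. (\<integral>x. g x \<partial>start_law G \<theta> s) \<partial>transition G sa)"
  unfolding step_op_def step_law_def
proof (rule integral_bind_bounded[OF prob_space_transition[OF sa] _ g])
  show "start_law G \<theta> \<in> transition G sa \<rightarrow>\<^sub>M prob_algebra (sa_space G)"
    using measurable_start_law by (simp add: measurable_cong_sets[OF sets_transition[OF sa] refl])
qed

text \<open>The term k = 0 is the reward; in the remaining terms the outermost application of the
  operator is moved outside the series.\<close>

lemma q_fun_bellman:
  assumes sa: "sa \<in> space (sa_space G)"
  shows "q_fun \<theta> i sa = reward G i sa + discount G * (\<integral>s. v_fun \<theta> i s \<partial>transition G sa)"
proof -
  interpret prob_space "step_law G \<theta> sa" by (rule prob_space_step_law[OF sa])
  have "summable (\<lambda>k. discount G ^ k * (step_op \<theta> ^^ k) (reward G i) sa)"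
    by (intro summable_geometric_bounded[where R=R] discount_bounds abs_step_op_funpow_le abs_reward_le sa)
  from suminf_split_head[OF this]
  have "q_fun \<theta> i sa = reward G i sa + (\<Sum>k. discount G ^ Suc k * (step_op \<theta> ^^ Suc k) (reward G i) sa)"
    by (simp add: q_fun_def)
  also have "(\<Sum>k. discount G ^ Suc k * (step_op \<theta> ^^ Suc k) (reward G i) sa)
      = (\<Sum>k. discount G * (discount G ^ k * (\<integral>x. (step_op \<theta> ^^ k) (reward G i) x \<partial>step_law G \<theta> sa)))"
    by (simp add: step_op_def mult.assoc)
  also have "\<dots> = discount G * (\<Sum>k. discount G ^ k * (\<integral>x. (step_op \<theta> ^^ k) (reward G i) x \<partial>step_law G \<theta> sa))"
    by (intro suminf_mult summable_geometric_bounded[where R=R] discount_bounds abs_integral_le_const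
          abs_step_op_funpow_le abs_reward_le less_imp_le R_pos) (auto simp: space_step_law[OF sa])
  also have "(\<Sum>k. discount G ^ k * (\<integral>x. (step_op \<theta> ^^ k) (reward G i) x \<partial>step_law G \<theta> sa)) = step_op \<theta> (q_fun \<theta> i) sa"
    unfolding step_op_def[of _ "q_fun \<theta> i"] q_fun_def
  proof (rule integral_discounted_suminf[symmetric, OF discount_bounds])
    show "(step_op \<theta> ^^ k) (reward G i) \<in> borel_measurable (step_law G \<theta> sa)" for k
      using measurable_step_op_funpow[OF reward]
      by (simp add: measurable_cong_sets[OF sets_step_law[OF sa] refl])
    show "\<bar>(step_op \<theta> ^^ k) (reward G i) x\<bar> \<le> R" if "x \<in> space (step_law G \<theta> sa)" for k x
      using that by (intro abs_step_op_funpow_le abs_reward_le) (simp_all add: space_step_law[OF sa])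
  qed
  also have "step_op \<theta> (q_fun \<theta> i) sa = (\<integral>s. v_fun \<theta> i s \<partial>transition G sa)"
    unfolding v_fun_def by (rule step_op_eq_transition[OF sa measurable_q_fun abs_q_fun_le])
  finally show ?thesis .
qed

text \<open>The series is pulled out of the integral, the Markov property turns each reward k steps
  later into a k-th operator power at time \<open>t\<close>, and the series is put back.\<close>

lemma integral_traj_discounted_return:
  assumes s: "s \<in> space (states G)"
    and f: "f \<in> borel_measurable (sa_space G)" "integrable (traj G \<theta> s) (\<lambda>\<omega>. f (\<omega> t))"
  shows "(\<integral>\<omega>. f (\<omega> t) * (\<Sum>k. discount G ^ k * reward G i (\<omega> (t + k))) \<partial>traj G \<theta> s)
    = (\<integral>\<omega>. f (\<omega> t) * q_fun \<theta> i (\<omega> t) \<partial>traj G \<theta> s)"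
proof -
  have "(\<integral>\<omega>. f (\<omega> t) * (\<Sum>k. discount G ^ k * reward G i (\<omega> (t + k))) \<partial>traj G \<theta> s)
      = (\<Sum>k. discount G ^ k * (\<integral>\<omega>. f (\<omega> t) * reward G i (\<omega> (t + k)) \<partial>traj G \<theta> s))"
    by (rule integral_mult_discounted_suminf[OF discount_bounds f(2)])
       (intro measurable_compose[OF measurable_coordinate[OF s] reward],
        rule abs_reward_le[OF space_traj_coordinate[OF s]])
  also have "\<dots> = (\<Sum>k. discount G ^ k * (\<integral>\<omega>. f (\<omega> t) * (step_op \<theta> ^^ k) (reward G i) (\<omega> t) \<partial>traj G \<theta> s))"
    by (simp add: integral_traj_add[OF s f reward abs_reward_le])
  also have "\<dots> = (\<integral>\<omega>. f (\<omega> t) * q_fun \<theta> i (\<omega> t) \<partial>traj G \<theta> s)"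
    unfolding q_fun_def
    by (rule integral_mult_discounted_suminf[symmetric, OF discount_bounds f(2)])
       (intro measurable_compose[OF measurable_coordinate[OF s] measurable_step_op_funpow[OF reward]],
        rule abs_step_op_funpow_le[OF abs_reward_le space_traj_coordinate[OF s]])
  finally show ?thesis .
qed

lemma v_fun_eq_integral_traj:
  assumes s: "s \<in> space (states G)"
  shows "(\<integral>\<omega>. (\<Sum>k. discount G ^ k * reward G i (\<omega> k)) \<partial>traj G \<theta> s) = v_fun \<theta> i s"
proof -
  interpret prob_space "traj G \<theta> s" by (rule prob_space_traj[OF s])
  have "(\<integral>\<omega>. (\<Sum>k. discount G ^ k * reward G i (\<omega> k)) \<partial>traj G \<theta> s) = (\<integral>\<omega>. q_fun \<theta> i (\<omega> 0) \<partial>traj G \<theta> s)"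
    using integral_traj_discounted_return[OF s, of "\<lambda>_. 1" \<theta> 0 i]
    by (simp only: mult_1 add_0 integrable_const borel_measurable_const simp_thms)
  also have "\<dots> = (\<integral>sa. q_fun \<theta> i sa \<partial>distr (traj G \<theta> s) (sa_space G) (\<lambda>\<omega>. \<omega> 0))"
    by (rule integral_distr[symmetric, OF measurable_coordinate[OF s] measurable_q_fun])
  finally show ?thesis by (simp add: traj_coordinate_0[OF s] v_fun_def)
qed

lemma utility_eq: "utility G i \<theta> = v_fun \<theta> i (init_state G)"
  unfolding utility_def by (rule v_fun_eq_integral_traj[OF init_state])

section \<open>State marginals and the performance difference\<close>

text \<open>The marginal of the state at time t is kept apart from the action drawn there:
  expansions in the policy are carried out at a fixed state and averaged over this law
  afterwards.\<close>

primrec state_law :: "real ^ 'm \<Rightarrow> nat \<Rightarrow> 's measure" where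
  "state_law \<theta> 0 = return (states G) (init_state G)"
| "state_law \<theta> (Suc t) = (state_law \<theta> t \<bind> start_law G \<theta>) \<bind> transition G"

lemma state_law_in_prob_algebra: "state_law \<theta> t \<in> space (prob_algebra (states G))"
proof (induction t)
  case 0
  then show ?case using init_state by (simp add: space_prob_algebra prob_space_return)
next
  case (Suc t)
  have "state_law \<theta> t \<bind> start_law G \<theta> \<in> space (prob_algebra (sa_space G))"
    using prob_space_bind'[OF Suc measurable_start_law] sets_bind'[OF Suc measurable_start_law]
    by (simp add: space_prob_algebra)
  from prob_space_bind'[OF this transition] sets_bind'[OF this transition]
  show ?case by (simp add: space_prob_algebra)
qed

lemma prob_space_state_law: "prob_space (state_law \<theta> t)"
  and sets_state_law: "sets (state_law \<theta> t) = sets (states G)"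
  using state_law_in_prob_algebra[of \<theta> t] by (auto simp: space_prob_algebra)

lemma space_state_law: "space (state_law \<theta> t) = space (states G)"
  by (rule sets_eq_imp_space_eq[OF sets_state_law])

lemma measurable_state_law: "measurable (state_law \<theta> t) N = measurable (states G) N"
  by (rule measurable_cong_sets[OF sets_state_law refl])

text \<open>The trajectory moves from pair to pair by transition and then policy;
  \<open>state_law\<close> cuts the same chain half a step earlier, so associativity of
  \<open>bind\<close> matches the two.\<close>

lemma traj_coordinate_eq_bind:
  "distr (traj G \<theta> (init_state G)) (sa_space G) (\<lambda>\<omega>. \<omega> t) = state_law \<theta> t \<bind> start_law G \<theta>"
proof (induction t)
  case 0
  show ?case
    by (simp add: traj_coordinate_0[OF init_state]
        bind_return[OF measurable_prob_algebraD[OF measurable_start_law] init_state])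
next
  case (Suc t)
  have "((state_law \<theta> t \<bind> start_law G \<theta>) \<bind> transition G) \<bind> start_law G \<theta>
      = (state_law \<theta> t \<bind> start_law G \<theta>) \<bind> (\<lambda>sa. transition G sa \<bind> start_law G \<theta>)"
  proof (rule bind_assoc[OF _ measurable_prob_algebraD[OF measurable_start_law]])
    have "sets (state_law \<theta> t \<bind> start_law G \<theta>) = sets (sa_space G)"
      by (rule sets_bind'[OF state_law_in_prob_algebra measurable_start_law])
    then show "transition G \<in> (state_law \<theta> t \<bind> start_law G \<theta>) \<rightarrow>\<^sub>M subprob_algebra (states G)"
      using measurable_prob_algebraD[OF transition] by (simp cong: measurable_cong_sets)
  qed
  then show ?case
    by (simp add: traj_coordinate_Suc[OF init_state] Suc step_law_def[abs_def])
qed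

lemma integral_state_law_Suc:
  fixes f :: "'s \<Rightarrow> real"
  assumes f: "f \<in> borel_measurable (states G)" "\<And>s. s \<in> space (states G) \<Longrightarrow> \<bar>f s\<bar> \<le> C"
  shows "(\<integral>s. (\<integral>sa. (\<integral>s'. f s' \<partial>transition G sa) \<partial>start_law G \<theta> s) \<partial>state_law \<theta> t) = (\<integral>s. f s \<partial>state_law \<theta> (Suc t))"
proof -
  have C: "0 \<le> C" using f(2)[OF init_state] by linarith
  have sb: "sets (state_law \<theta> t \<bind> start_law G \<theta>) = sets (sa_space G)"
    by (rule sets_bind'[OF state_law_in_prob_algebra measurable_start_law])
  have "(\<integral>s. f s \<partial>state_law \<theta> (Suc t)) = (\<integral>sa. (\<integral>s'. f s' \<partial>transition G sa) \<partial>(state_law \<theta> t \<bind> start_law G \<theta>))"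
    unfolding state_law.simps
    by (rule integral_bind_bounded[OF prob_space_bind'[OF state_law_in_prob_algebra measurable_start_law] _ f])
       (use transition sb in \<open>simp cong: measurable_cong_sets\<close>)
  also have "\<dots> = (\<integral>s. (\<integral>sa. (\<integral>s'. f s' \<partial>transition G sa) \<partial>start_law G \<theta> s) \<partial>state_law \<theta> t)"
  proof (rule integral_bind_bounded[OF prob_space_state_law])
    show "start_law G \<theta> \<in> state_law \<theta> t \<rightarrow>\<^sub>M prob_algebra (sa_space G)"
      using measurable_start_law by (simp add: measurable_state_law)
    show "(\<lambda>sa. \<integral>s'. f s' \<partial>transition G sa) \<in> borel_measurable (sa_space G)"
      by (rule measurable_integral_kernel[OF transition f(1)])
    show "\<bar>\<integral>s'. f s' \<partial>transition G x\<bar> \<le> C" if "x \<in> space (sa_space G)" for x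
      using that C f(2)
      by (intro prob_space.abs_integral_le_const[OF prob_space_transition[OF that]]) (auto simp: space_transition)
  qed
  finally show ?thesis ..
qed

lemma integrable_start_law_bounded:
  fixes g :: "'s \<times> ('n \<Rightarrow> real ^ 'k) \<Rightarrow> real"
  assumes "s \<in> space (states G)" "g \<in> borel_measurable (sa_space G)"
    "\<And>x. x \<in> space (sa_space G) \<Longrightarrow> \<bar>g x\<bar> \<le> C"
  shows "integrable (start_law G \<theta> s) g"
proof (rule prob_space.integrable_bounded_on_space[OF prob_space_start_law[OF assms(1)]])
  show "g \<in> borel_measurable (start_law G \<theta> s)"
    using assms(2) by (simp only: measurable_cong_sets[OF sets_start_law refl])
  show "\<bar>g x\<bar> \<le> C" if "x \<in> space (start_law G \<theta> s)" for x
    using that by (intro assms(3)) (simp only: space_start_law)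
qed

definition policy_gap :: "real ^ 'm \<Rightarrow> real ^ 'm \<Rightarrow> 'n \<Rightarrow> 's \<Rightarrow> real" where
  "policy_gap \<theta>' \<theta> i s =
     (\<integral>sa. q_fun \<theta>' i sa \<partial>start_law G \<theta>' s) - (\<integral>sa. q_fun \<theta>' i sa \<partial>start_law G \<theta> s)"

lemma measurable_policy_gap: "policy_gap \<theta>' \<theta> i \<in> borel_measurable (states G)"
  unfolding policy_gap_def[abs_def]
  by (intro borel_measurable_diff measurable_integral_kernel[OF measurable_start_law measurable_q_fun])

lemma q_fun_diff:
  assumes sa: "sa \<in> space (sa_space G)"
  shows "q_fun \<theta>' i sa - q_fun \<theta> i sa = discount G * (\<integral>s. v_fun \<theta>' i s - v_fun \<theta> i s \<partial>transition G sa)"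
proof -
  have i: "integrable (transition G sa) (v_fun \<theta> i)" for \<theta>
    using measurable_v_fun abs_v_fun_le sa
    by (intro prob_space.integrable_bounded_on_space[where C="R / (1 - discount G)"] prob_space_transition)
       (auto simp: space_transition measurable_cong_sets[OF sets_transition refl])
  show ?thesis
    by (simp add: q_fun_bellman[OF sa] right_diff_distrib Bochner_Integration.integral_diff[OF i i])
qed

text \<open>Insert the integral of the new action value under the old policy. One difference is the
  gap; in the other the rewards of the two Bellman equations cancel and the discounted value
  difference at the next state remains.\<close>

lemma v_fun_diff:
  assumes s: "s \<in> space (states G)"
  shows "v_fun \<theta>' i s - v_fun \<theta> i s = policy_gap \<theta>' \<theta> i s
     + discount G * (\<integral>sa. (\<integral>s'. v_fun \<theta>' i s' - v_fun \<theta> i s' \<partial>transition G sa) \<partial>start_law G \<theta> s)"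
proof -
  have i: "integrable (start_law G \<theta> s) (q_fun \<theta>' i)" for \<theta>'
    by (rule integrable_start_law_bounded[OF s measurable_q_fun abs_q_fun_le])
  have "(\<integral>sa. q_fun \<theta>' i sa - q_fun \<theta> i sa \<partial>start_law G \<theta> s)
      = (\<integral>sa. discount G * (\<integral>s. v_fun \<theta>' i s - v_fun \<theta> i s \<partial>transition G sa) \<partial>start_law G \<theta> s)"
    by (intro Bochner_Integration.integral_cong refl q_fun_diff) (simp add: space_start_law)
  then have "(\<integral>sa. q_fun \<theta>' i sa \<partial>start_law G \<theta> s) - v_fun \<theta> i s
      = discount G * (\<integral>sa. (\<integral>s. v_fun \<theta>' i s - v_fun \<theta> i s \<partial>transition G sa) \<partial>start_law G \<theta> s)"
    by (simp add: Bochner_Integration.integral_diff[OF i i] v_fun_def)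
  then show ?thesis unfolding policy_gap_def v_fun_def by linarith
qed

text \<open>By \<open>v_fun_diff\<close>, any uniform bound b improves to c + \<gamma> b. Iterating
  from the a priori bound 2 R / (1 - \<gamma>) converges to the fixed point c / (1 - \<gamma>),
  without forming a supremum over states.\<close>

lemma abs_v_fun_diff_le:
  assumes s: "s \<in> space (states G)" and gap: "\<And>s. s \<in> space (states G) \<Longrightarrow> \<bar>policy_gap \<theta>' \<theta> i s\<bar> \<le> c"
  shows "\<bar>v_fun \<theta>' i s - v_fun \<theta> i s\<bar> \<le> c / (1 - discount G)"
proof -
  let ?D = "\<lambda>s. v_fun \<theta>' i s - v_fun \<theta> i s"
  let ?C = "2 * (R / (1 - discount G))"
  have c: "0 \<le> c" using gap[OF s] by linarith
  have step: "\<bar>?D s\<bar> \<le> c + discount G * b"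
    if b: "\<And>s. s \<in> space (states G) \<Longrightarrow> \<bar>?D s\<bar> \<le> b" and s: "s \<in> space (states G)" for s b
  proof -
    have b0: "0 \<le> b" using b[OF s] by linarith
    have "\<bar>\<integral>sa. (\<integral>s'. ?D s' \<partial>transition G sa) \<partial>start_law G \<theta> s\<bar> \<le> b"
      using b b0 s
      by (intro prob_space.abs_integral_le_const prob_space_start_law prob_space_transition)
         (auto simp: space_start_law space_transition)
    then have "discount G * \<bar>\<integral>sa. (\<integral>s'. ?D s' \<partial>transition G sa) \<partial>start_law G \<theta> s\<bar> \<le> discount G * b"
      using discount by (intro mult_left_mono) auto
    then have "\<bar>discount G * (\<integral>sa. (\<integral>s'. ?D s' \<partial>transition G sa) \<partial>start_law G \<theta> s)\<bar> \<le> discount G * b"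
      using discount by (simp add: abs_mult)
    with gap[OF s] v_fun_diff[OF s, of \<theta>' i \<theta>] show ?thesis by linarith
  qed
  have bd: "\<bar>?D s\<bar> \<le> c / (1 - discount G) + discount G ^ n * ?C" if "s \<in> space (states G)" for n s
    using that
  proof (induction n arbitrary: s)
    case 0
    have "\<bar>?D s\<bar> \<le> ?C" using abs_v_fun_le[OF 0, of \<theta> i] abs_v_fun_le[OF 0, of \<theta>' i] by linarith
    moreover have "0 \<le> c / (1 - discount G)" using c discount by simp
    ultimately show ?case by simp
  next
    case (Suc n)
    have "\<bar>?D s\<bar> \<le> c + discount G * (c / (1 - discount G) + discount G ^ n * ?C)"
      by (rule step[OF Suc.IH Suc.prems])
    also have "\<dots> = (c + discount G * (c / (1 - discount G))) + discount G ^ Suc n * ?C"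
      by (simp add: algebra_simps)
    also have "c + discount G * (c / (1 - discount G)) = c / (1 - discount G)"
      using discount by (simp add: field_simps)
    finally show ?case .
  qed
  have "(\<lambda>n. discount G ^ n) \<longlonglongrightarrow> 0"
    using discount by (intro LIMSEQ_realpow_zero) auto
  then have "(\<lambda>n. c / (1 - discount G) + discount G ^ n * ?C) \<longlonglongrightarrow> c / (1 - discount G) + 0 * ?C"
    by (intro tendsto_add tendsto_mult tendsto_const)
  then show ?thesis
    using bd[OF s] by (intro LIMSEQ_le_const[of _ "c / (1 - discount G)"]) auto
qed

text \<open>
  The states are distributed as under \<open>\<theta>\<close>, so \<open>\<theta>'\<close> enters only through \<open>policy_gap\<close>, which pairs \<open>Q\<^bsub>\<theta>'\<^esub>\<close>
  with the policy difference.
\<close>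

lemma utility_diff:
  "(\<lambda>t. discount G ^ t * (\<integral>s. policy_gap \<theta>' \<theta> i s \<partial>state_law \<theta> t))
     sums (utility G i \<theta>' - utility G i \<theta>)"
proof -
  let ?D = "\<lambda>s. v_fun \<theta>' i s - v_fun \<theta> i s"
  let ?C = "2 * (R / (1 - discount G))"
  have D_le: "\<bar>?D s\<bar> \<le> ?C" if "s \<in> space (states G)" for s
    using abs_v_fun_le[OF that, of \<theta> i] abs_v_fun_le[OF that, of \<theta>' i] by linarith
  have D_m: "?D \<in> borel_measurable (states G)"
    by (intro borel_measurable_diff measurable_v_fun)
  have TD_m: "(\<lambda>sa. \<integral>s'. ?D s' \<partial>transition G sa) \<in> borel_measurable (sa_space G)"
    by (rule measurable_integral_kernel[OF transition D_m])
  have TD_le: "\<bar>\<integral>s'. ?D s' \<partial>transition G sa\<bar> \<le> ?C" if "sa \<in> space (sa_space G)" for sa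
    using that D_le value_bound_nonneg
    by (intro prob_space.abs_integral_le_const prob_space_transition) (auto simp: space_transition)
  define A where "A s = (\<integral>sa. (\<integral>s'. ?D s' \<partial>transition G sa) \<partial>start_law G \<theta> s)" for s
  have A_m: "A \<in> borel_measurable (states G)"
    unfolding A_def by (rule measurable_integral_kernel[OF measurable_start_law TD_m])
  have A_le: "\<bar>A s\<bar> \<le> ?C" if "s \<in> space (states G)" for s
    unfolding A_def using TD_le value_bound_nonneg
    by (intro prob_space.abs_integral_le_const[OF prob_space_start_law[OF that]]) (simp_all add: space_start_law)
  have int: "integrable (state_law \<theta> t) f"
    if "f \<in> borel_measurable (states G)" "\<And>s. s \<in> space (states G) \<Longrightarrow> \<bar>f s\<bar> \<le> c" for f :: "'s \<Rightarrow> real" and c t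
    using that by (intro prob_space.integrable_bounded_on_space[OF prob_space_state_law, where C=c])
      (auto simp: measurable_state_law space_state_law)
  have gap: "(\<integral>s. policy_gap \<theta>' \<theta> i s \<partial>state_law \<theta> t)
      = (\<integral>s. ?D s \<partial>state_law \<theta> t) - discount G * (\<integral>s. ?D s \<partial>state_law \<theta> (Suc t))" for t
  proof -
    have "(\<integral>s. policy_gap \<theta>' \<theta> i s \<partial>state_law \<theta> t) = (\<integral>s. ?D s - discount G * A s \<partial>state_law \<theta> t)"
      using v_fun_diff[of _ \<theta>' i \<theta>] unfolding A_def
      by (intro Bochner_Integration.integral_cong refl) (simp add: space_state_law)
    also have "\<dots> = (\<integral>s. ?D s \<partial>state_law \<theta> t) - discount G * (\<integral>s. A s \<partial>state_law \<theta> t)"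
      using int[OF D_m D_le] int[OF A_m A_le]
      by (subst Bochner_Integration.integral_diff) auto
    also have "(\<integral>s. A s \<partial>state_law \<theta> t) = (\<integral>s. ?D s \<partial>state_law \<theta> (Suc t))"
      unfolding A_def by (rule integral_state_law_Suc[OF D_m D_le])
    finally show ?thesis .
  qed
  \<comment> \<open>The averaged gap at time t is a difference of consecutive averages of
    \<open>?D\<close>, so the discounted sum telescopes; the boundary term vanishes because
    \<open>?D\<close> is bounded.\<close>
  have partial: "(\<Sum>t<n. discount G ^ t * (\<integral>s. policy_gap \<theta>' \<theta> i s \<partial>state_law \<theta> t))
      = (\<integral>s. ?D s \<partial>state_law \<theta> 0) - discount G ^ n * (\<integral>s. ?D s \<partial>state_law \<theta> n)" for n
    by (induction n) (simp_all add: gap algebra_simps del: state_law.simps)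
  have "(\<integral>s. ?D s \<partial>state_law \<theta> 0) = utility G i \<theta>' - utility G i \<theta>"
    using integral_return[OF init_state D_m] by (simp add: utility_eq)
  moreover have "(\<lambda>n. discount G ^ n * (\<integral>s. ?D s \<partial>state_law \<theta> n)) \<longlonglongrightarrow> 0"
  proof (rule Lim_null_comparison)
    show "\<forall>\<^sub>F n in sequentially. norm (discount G ^ n * (\<integral>s. ?D s \<partial>state_law \<theta> n)) \<le> discount G ^ n * ?C"
    proof (rule always_eventually, rule allI)
      fix n
      have "\<bar>\<integral>s. ?D s \<partial>state_law \<theta> n\<bar> \<le> ?C"
        using D_le value_bound_nonneg
        by (intro prob_space.abs_integral_le_const prob_space_state_law) (auto simp: space_state_law)
      then have "discount G ^ n * \<bar>\<integral>s. ?D s \<partial>state_law \<theta> n\<bar> \<le> discount G ^ n * ?C"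
        using discount by (intro mult_left_mono) auto
      moreover have "norm (discount G ^ n * (\<integral>s. ?D s \<partial>state_law \<theta> n)) = discount G ^ n * \<bar>\<integral>s. ?D s \<partial>state_law \<theta> n\<bar>"
        using discount by (simp add: abs_mult)
      ultimately show "norm (discount G ^ n * (\<integral>s. ?D s \<partial>state_law \<theta> n)) \<le> discount G ^ n * ?C"
        by linarith
    qed
    have "(\<lambda>n. discount G ^ n) \<longlonglongrightarrow> 0"
      using discount by (intro LIMSEQ_realpow_zero) auto
    then show "(\<lambda>n. discount G ^ n * ?C) \<longlonglongrightarrow> 0" by (rule tendsto_mult_left_zero)
  qed
  ultimately show ?thesis
    using tendsto_diff[OF tendsto_const, of "\<lambda>n. discount G ^ n * (\<integral>s. ?D s \<partial>state_law \<theta> n)" 0 sequentially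
        "\<integral>s. ?D s \<partial>state_law \<theta> 0"]
    unfolding sums_def partial by (simp del: state_law.simps)
qed

end


section \<open>The policy gradient theorem\<close>

context markov_game
begin

section \<open>Scores as derivatives of log policies\<close>

text \<open>The score is a definite description. Positivity and differentiability of the policy
  provide a gradient of its logarithm by the chain rule, and uniqueness of gradients identifies
  it.\<close>

lemma GDERIV_score:
  assumes s: "s \<in> space (states G)" and a: "a \<in> actions G"
  shows "GDERIV (\<lambda>h. ln (policy G n (\<theta> + block_part (owner G) i h) s a)) 0 :> score G i n \<theta> s a"
proof -
  obtain f' where "((\<lambda>\<theta>'. policy G n \<theta>' s a) has_derivative f') (at \<theta>)"
    using policy_differentiable[OF s a] by (auto simp: differentiable_def)
  then have "((\<lambda>\<theta>'. policy G n \<theta>' s a) has_derivative f') (at (\<theta> + block_part (owner G) i 0))"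
    by simp
  from has_derivative_compose[OF has_derivative_add_block_part this]
  have "((\<lambda>h. policy G n (\<theta> + block_part (owner G) i h) s a) has_derivative (\<lambda>h. f' (block_part (owner G) i h))) (at 0)" .
  from has_derivative_ln[OF _ this]
  have "(\<lambda>h. ln (policy G n (\<theta> + block_part (owner G) i h) s a)) differentiable (at 0)"
    using policy_pos[OF s a, of n \<theta>] unfolding differentiable_def by auto
  then obtain D where D: "GDERIV (\<lambda>h. ln (policy G n (\<theta> + block_part (owner G) i h) s a)) 0 :> D"
    using differentiable_imp_GDERIV by blast
  moreover have "score G i n \<theta> s a = D"
    unfolding score_def block_grad_def by (rule the_equality) (use D GDERIV_unique in blast)+
  ultimately show ?thesis by simp
qed

text \<open>Recentering at the point reached after time \<open>t\<close> and using linearity of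
  \<open>block_part\<close> reduces the claim to the derivative at 0.\<close>

lemma DERIV_log_policy_line:
  assumes s: "s \<in> space (states G)" and a: "a \<in> actions G"
  shows "((\<lambda>t. ln (policy G n (\<theta> + block_part (owner G) i (t *\<^sub>R h)) s a))
     has_real_derivative (h \<bullet> score G i n (\<theta> + block_part (owner G) i (t *\<^sub>R h)) s a)) (at t)"
proof -
  interpret b: bounded_linear "block_part (owner G) i" by (rule bounded_linear_block_part)
  have "((\<lambda>u. ln (policy G n ((\<theta> + block_part (owner G) i (t *\<^sub>R h)) + block_part (owner G) i (u *\<^sub>R h)) s a))
     has_real_derivative (h \<bullet> score G i n (\<theta> + block_part (owner G) i (t *\<^sub>R h)) s a)) (at 0)"
    by (rule GDERIV_imp_DERIV_line[OF GDERIV_score[OF s a]])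
  then have "((\<lambda>u. ln (policy G n (\<theta> + block_part (owner G) i ((u + t) *\<^sub>R h)) s a))
     has_real_derivative (h \<bullet> score G i n (\<theta> + block_part (owner G) i (t *\<^sub>R h)) s a)) (at 0)"
    by (simp add: scaleR_add_left b.add add_ac)
  then show ?thesis using DERIV_shift[of _ _ 0 t] by fastforce
qed

text \<open>Measurability of the policy is known for each fixed parameter only. Every component of
  the score is the limit of difference quotients with increments 1 / (k + 1), each using two fixed
  parameters.\<close>

lemma measurable_score:
  "(\<lambda>(s, a). score G i n \<theta> s a) \<in> borel_measurable (states G \<Otimes>\<^sub>M action_space G)"
proof (rule borel_measurable_euclidean_space[THEN iffD2], rule ballI)
  fix b :: "real ^ 'm" assume "b \<in> Basis"
  define p where "p t x = ln (policy G n (\<theta> + block_part (owner G) i (t *\<^sub>R b)) (fst x) (snd x))" for t x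
  have [measurable]: "p t \<in> borel_measurable (states G \<Otimes>\<^sub>M action_space G)" for t
    unfolding p_def using policy_measurable[of n] by (intro borel_measurable_ln) (simp add: split_beta')
  show "(\<lambda>x. (case x of (s, a) \<Rightarrow> score G i n \<theta> s a) \<bullet> b) \<in> borel_measurable (states G \<Otimes>\<^sub>M action_space G)"
  proof (rule borel_measurable_LIMSEQ_real)
    fix x assume "x \<in> space (states G \<Otimes>\<^sub>M action_space G)"
    then have x: "fst x \<in> space (states G)" "snd x \<in> actions G"
      by (auto simp: space_pair_measure space_action_space)
    have "((\<lambda>t. p t x) has_real_derivative (b \<bullet> score G i n \<theta> (fst x) (snd x))) (at 0)"
      unfolding p_def by (rule GDERIV_imp_DERIV_line[OF GDERIV_score[OF x]])
    then have "((\<lambda>h. (p h x - p 0 x) / h) \<longlongrightarrow> b \<bullet> score G i n \<theta> (fst x) (snd x)) (at 0)"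
      by (simp add: DERIV_def)
    moreover have "filterlim (\<lambda>k. 1 / real (Suc k)) (at 0) sequentially"
      unfolding filterlim_at
      by (intro conjI always_eventually allI LIMSEQ_inverse_real_of_nat[unfolded inverse_eq_divide]) simp_all
    ultimately have "(\<lambda>k. (p (1 / real (Suc k)) x - p 0 x) / (1 / real (Suc k)))
        \<longlonglongrightarrow> b \<bullet> score G i n \<theta> (fst x) (snd x)"
      by (rule filterlim_compose)
    then show "(\<lambda>k. (p (1 / real (Suc k)) x - p 0 x) / (1 / real (Suc k)))
        \<longlonglongrightarrow> (case x of (s, a) \<Rightarrow> score G i n \<theta> s a) \<bullet> b"
      by (simp add: split_beta' inner_commute)
  qed measurable
qed

text \<open>This is the block gradient of the log of the joint policy; all agents enter because each
  policy may depend on the whole parameter vector.\<close>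

definition total_score :: "'n \<Rightarrow> real ^ 'm \<Rightarrow> 's \<times> ('n \<Rightarrow> real ^ 'k) \<Rightarrow> real ^ 'm" where
  "total_score i \<theta> sa = (\<Sum>n\<in>UNIV. score G i n \<theta> (fst sa) (snd sa n))"

lemma measurable_score_sa: "(\<lambda>sa. score G i n \<theta> (fst sa) (snd sa n)) \<in> borel_measurable (sa_space G)"
proof -
  have "(\<lambda>sa. (fst sa, snd sa n)) \<in> sa_space G \<rightarrow>\<^sub>M states G \<Otimes>\<^sub>M action_space G"
    by measurable
  from measurable_compose[OF this measurable_score] show ?thesis by simp
qed

lemma measurable_total_score [measurable]: "total_score i \<theta> \<in> borel_measurable (sa_space G)"
  unfolding total_score_def[abs_def] by (intro borel_measurable_sum measurable_score_sa)

lemma measurable_inner_total_score: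
  "(\<lambda>sa. h \<bullet> total_score i \<theta> sa) \<in> borel_measurable (sa_space G)"
  by measurable

abbreviation ref_measure :: "('n \<Rightarrow> real ^ 'k) measure" where
  "ref_measure \<equiv> PiM UNIV (refm G)"

lemma space_ref_measure: "a \<in> space ref_measure \<longleftrightarrow> (\<forall>n. a n \<in> actions G)"
  using sets_eq_imp_space_eq[OF sets_PiM_refm] by (simp add: space_joint_action_space)

lemma joint_policy_pos:
  "s \<in> space (states G) \<Longrightarrow> a \<in> space ref_measure \<Longrightarrow> 0 < joint_policy G \<theta> s a"
  unfolding joint_policy_def by (intro prod_pos policy_pos) (auto simp: space_ref_measure)

lemma measurable_ref_measure_sa:
  assumes "s \<in> space (states G)" "f \<in> sa_space G \<rightarrow>\<^sub>M N"
  shows "(\<lambda>a. f (s, a)) \<in> ref_measure \<rightarrow>\<^sub>M N"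
  using measurable_compose[OF measurable_Pair_sa[OF assms(1)] assms(2)] by (simp only: measurable_PiM_refm)

lemma measurable_joint_policy_ref:
  "s \<in> space (states G) \<Longrightarrow> joint_policy G \<theta> s \<in> borel_measurable ref_measure"
  using measurable_joint_policy_action by (simp only: measurable_PiM_refm)

text \<open>Integrals under different parameters become integrals against one reference measure, so
  that the two densities can be compared pointwise.\<close>

lemma
  fixes f :: "'s \<times> ('n \<Rightarrow> real ^ 'k) \<Rightarrow> real"
  assumes s: "s \<in> space (states G)" and f: "f \<in> borel_measurable (sa_space G)"
  shows integral_start_law: "(\<integral>x. f x \<partial>start_law G \<theta> s) = (\<integral>a. joint_policy G \<theta> s a * f (s, a) \<partial>ref_measure)"
    and integrable_start_law_iff:
      "integrable (start_law G \<theta> s) f \<longleftrightarrow> integrable ref_measure (\<lambda>a. joint_policy G \<theta> s a * f (s, a))"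
proof -
  have P: "Pair s \<in> joint_law G \<theta> s \<rightarrow>\<^sub>M sa_space G"
    using measurable_Pair_sa[OF s] by (simp only: measurable_cong_sets[OF sets_joint_law refl])
  have fm: "(\<lambda>a. f (s, a)) \<in> borel_measurable ref_measure"
    by (rule measurable_ref_measure_sa[OF s f])
  have pos: "AE a in ref_measure. 0 \<le> joint_policy G \<theta> s a"
    using joint_policy_pos[OF s] by (intro AE_I2 less_imp_le)
  show "(\<integral>x. f x \<partial>start_law G \<theta> s) = (\<integral>a. joint_policy G \<theta> s a * f (s, a) \<partial>ref_measure)"
    unfolding start_law_def integral_distr[OF P f] unfolding joint_law_def
    by (subst integral_density[OF fm measurable_joint_policy_ref[OF s] pos]) simp
  show "integrable (start_law G \<theta> s) f \<longleftrightarrow> integrable ref_measure (\<lambda>a. joint_policy G \<theta> s a * f (s, a))"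
    unfolding start_law_def integrable_distr_eq[OF P f] unfolding joint_law_def
    by (subst integrable_density[OF fm measurable_joint_policy_ref[OF s] pos]) simp
qed

end

locale score_game = bounded_reward_game G R
  for G :: "('s, 'n::finite, 'k::finite, 'm::finite) game" and R :: real +
  fixes V L :: real
  assumes L_nonneg: "0 \<le> L"
    and score_second_moment: "\<And>i n \<theta> s. s \<in> space (states G) \<Longrightarrow>
      (\<integral>\<^sup>+ a. ennreal ((norm (score G i n \<theta> s a))\<^sup>2) \<partial>agent_law G n \<theta> s) \<le> ennreal (V\<^sup>2)"
    and score_lipschitz: "\<And>i n \<theta>1 \<theta>2 s a. s \<in> space (states G) \<Longrightarrow> a \<in> actions G \<Longrightarrow>
      norm (score G i n \<theta>1 s a - score G i n \<theta>2 s a) \<le> L * norm (\<theta>1 - \<theta>2)"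
begin

section \<open>Second moments and the first-order expansion of the policy\<close>

lemma total_score_lipschitz:
  assumes "sa \<in> space (sa_space G)"
  shows "norm (total_score i \<theta>1 sa - total_score i \<theta>2 sa) \<le> real CARD('n) * L * norm (\<theta>1 - \<theta>2)"
proof -
  have "norm (total_score i \<theta>1 sa - total_score i \<theta>2 sa)
      \<le> (\<Sum>n\<in>UNIV. norm (score G i n \<theta>1 (fst sa) (snd sa n) - score G i n \<theta>2 (fst sa) (snd sa n)))"
    unfolding total_score_def sum_subtractf[symmetric] by (rule norm_sum)
  also have "\<dots> \<le> (\<Sum>n\<in>(UNIV::'n set). L * norm (\<theta>1 - \<theta>2))"
    using assms by (intro sum_mono score_lipschitz) (auto simp: space_sa_space)
  finally show ?thesis by simp
qed

text \<open>One factor \<open>CARD('n)\<close> comes from Cauchy-Schwarz for the sum of scores, the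
  other from adding the bound V^2 over the agents.\<close>

lemma
  assumes s: "s \<in> space (states G)"
  shows integrable_norm_total_score_squared:
      "integrable (start_law G \<theta> s) (\<lambda>sa. (norm (total_score i \<theta> sa))\<^sup>2)"
    and integral_norm_total_score_squared_le:
      "(\<integral>sa. (norm (total_score i \<theta> sa))\<^sup>2 \<partial>start_law G \<theta> s) \<le> (real CARD('n))\<^sup>2 * V\<^sup>2"
    and nn_integral_norm_total_score_squared_le:
      "(\<integral>\<^sup>+sa. ennreal ((norm (total_score i \<theta> sa))\<^sup>2) \<partial>start_law G \<theta> s) \<le> ennreal ((real CARD('n))\<^sup>2 * V\<^sup>2)"
proof -
  have P: "Pair s \<in> joint_law G \<theta> s \<rightarrow>\<^sub>M sa_space G"
    using measurable_Pair_sa[OF s] by (simp only: measurable_cong_sets[OF sets_joint_law refl])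
  have sc: "(\<lambda>a. score G i n \<theta> s a) \<in> borel_measurable (action_space G)" for n
    using measurable_Pair2[OF measurable_score s] by simp
  have comp: "(\<lambda>a. a n) \<in> joint_law G \<theta> s \<rightarrow>\<^sub>M action_space G" for n
    by (simp add: measurable_cong_sets[OF sets_joint_law refl] joint_action_space_def)
  have sc': "(\<lambda>a. score G i n \<theta> s (a n)) \<in> borel_measurable (joint_law G \<theta> s)" for n
    by (rule measurable_compose[OF comp sc])
  have "(\<integral>\<^sup>+sa. ennreal ((norm (total_score i \<theta> sa))\<^sup>2) \<partial>start_law G \<theta> s)
      = (\<integral>\<^sup>+a. ennreal ((norm (\<Sum>n\<in>UNIV. score G i n \<theta> s (a n)))\<^sup>2) \<partial>joint_law G \<theta> s)"
    unfolding start_law_def by (subst nn_integral_distr[OF P], measurable) (simp add: total_score_def)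
  also have "\<dots> \<le> (\<integral>\<^sup>+a. (\<Sum>n\<in>UNIV. ennreal (real CARD('n)) * ennreal ((norm (score G i n \<theta> s (a n)))\<^sup>2)) \<partial>joint_law G \<theta> s)"
  proof (rule nn_integral_mono)
    fix a
    have "ennreal ((norm (\<Sum>n\<in>UNIV. score G i n \<theta> s (a n)))\<^sup>2)
        \<le> ennreal (real CARD('n) * (\<Sum>n\<in>UNIV. (norm (score G i n \<theta> s (a n)))\<^sup>2))"
      by (intro ennreal_leI norm_sum_squared_le)
    also have "\<dots> = (\<Sum>n\<in>UNIV. ennreal (real CARD('n)) * ennreal ((norm (score G i n \<theta> s (a n)))\<^sup>2))"
      by (simp add: sum_distrib_left sum_ennreal ennreal_mult[symmetric])
    finally show "ennreal ((norm (\<Sum>n\<in>UNIV. score G i n \<theta> s (a n)))\<^sup>2)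
        \<le> (\<Sum>n\<in>UNIV. ennreal (real CARD('n)) * ennreal ((norm (score G i n \<theta> s (a n)))\<^sup>2))" .
  qed
  also have "\<dots> = (\<Sum>n\<in>UNIV. ennreal (real CARD('n)) * (\<integral>\<^sup>+a. ennreal ((norm (score G i n \<theta> s (a n)))\<^sup>2) \<partial>joint_law G \<theta> s))"
    using sc' by (subst nn_integral_sum) (auto intro!: sum.cong nn_integral_cmult)
  also have "\<dots> = (\<Sum>n\<in>UNIV. ennreal (real CARD('n)) * (\<integral>\<^sup>+a. ennreal ((norm (score G i n \<theta> s a))\<^sup>2) \<partial>agent_law G n \<theta> s))"
    using sc by (simp add: joint_law_component[OF s, symmetric] nn_integral_distr[OF comp])
  also have "\<dots> \<le> (\<Sum>n\<in>(UNIV::'n set). ennreal (real CARD('n)) * ennreal (V\<^sup>2))"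
    by (intro sum_mono mult_left_mono score_second_moment[OF s]) simp
  also have "\<dots> = ennreal ((real CARD('n))\<^sup>2 * V\<^sup>2)"
    by (simp add: ennreal_of_nat_eq_real_of_nat ennreal_mult[symmetric] power2_eq_square mult.assoc)
  finally show nn: "(\<integral>\<^sup>+sa. ennreal ((norm (total_score i \<theta> sa))\<^sup>2) \<partial>start_law G \<theta> s) \<le> ennreal ((real CARD('n))\<^sup>2 * V\<^sup>2)" .
  have m: "(\<lambda>sa. (norm (total_score i \<theta> sa))\<^sup>2) \<in> borel_measurable (start_law G \<theta> s)"
    by measurable
  show int: "integrable (start_law G \<theta> s) (\<lambda>sa. (norm (total_score i \<theta> sa))\<^sup>2)"
    by (rule integrableI_nonneg[OF m]) (use nn in \<open>auto intro: le_less_trans\<close>)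
  show "(\<integral>sa. (norm (total_score i \<theta> sa))\<^sup>2 \<partial>start_law G \<theta> s) \<le> (real CARD('n))\<^sup>2 * V\<^sup>2"
    using nn by (subst (asm) nn_integral_eq_integral[OF int]) (auto simp: ennreal_le_iff)
qed

text \<open>By the mean value theorem the increment is h paired with a score at an intermediate
  parameter, which the Lipschitz condition compares with the score at \<theta>;
  \<open>block_part\<close> does not increase norms.\<close>

lemma log_policy_first_order:
  assumes s: "s \<in> space (states G)" and a: "a \<in> actions G"
  shows "\<bar>ln (policy G n (\<theta> + block_part (owner G) i h) s a) - ln (policy G n \<theta> s a) - h \<bullet> score G i n \<theta> s a\<bar>
    \<le> L * (norm h)\<^sup>2"
proof -
  define \<phi> where "\<phi> t = ln (policy G n (\<theta> + block_part (owner G) i (t *\<^sub>R h)) s a)" for t :: real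
  define \<phi>' where "\<phi>' t = h \<bullet> score G i n (\<theta> + block_part (owner G) i (t *\<^sub>R h)) s a" for t :: real
  have "(\<phi> has_real_derivative \<phi>' t) (at t)" for t
    unfolding \<phi>_def \<phi>'_def by (rule DERIV_log_policy_line[OF s a])
  then obtain t where t: "0 < t" "t < 1" "\<phi> 1 - \<phi> 0 = \<phi>' t"
    using MVT2[of 0 1 \<phi> \<phi>'] by auto
  have "norm (block_part (owner G) i (t *\<^sub>R h)) \<le> norm (t *\<^sub>R h)" by (rule norm_block_part_le)
  also have "\<dots> \<le> norm h" using t by (simp add: mult_left_le_one_le)
  finally have th: "norm (block_part (owner G) i (t *\<^sub>R h)) \<le> norm h" .
  have "\<bar>\<phi>' t - h \<bullet> score G i n \<theta> s a\<bar>
      = \<bar>h \<bullet> (score G i n (\<theta> + block_part (owner G) i (t *\<^sub>R h)) s a - score G i n \<theta> s a)\<bar>"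
    by (simp add: \<phi>'_def inner_diff_right)
  also have "\<dots> \<le> norm h * norm (score G i n (\<theta> + block_part (owner G) i (t *\<^sub>R h)) s a - score G i n \<theta> s a)"
    by (rule Cauchy_Schwarz_ineq2)
  also have "\<dots> \<le> norm h * (L * norm h)"
  proof (rule mult_left_mono)
    have "norm (score G i n (\<theta> + block_part (owner G) i (t *\<^sub>R h)) s a - score G i n \<theta> s a)
        \<le> L * norm (block_part (owner G) i (t *\<^sub>R h))"
      using score_lipschitz[OF s a, of i n "\<theta> + block_part (owner G) i (t *\<^sub>R h)" \<theta>] by simp
    also have "\<dots> \<le> L * norm h" by (rule mult_left_mono[OF th L_nonneg])
    finally show "norm (score G i n (\<theta> + block_part (owner G) i (t *\<^sub>R h)) s a - score G i n \<theta> s a) \<le> L * norm h" .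
  qed simp
  finally show ?thesis using t(3) by (simp add: \<phi>_def power2_eq_square mult_ac)
qed

text \<open>The witness x is the log-likelihood ratio, the sum over the agents of their log policy
  increments.\<close>

lemma joint_policy_ratio:
  assumes s: "s \<in> space (states G)" and a: "a \<in> space ref_measure"
  obtains x where "joint_policy G (\<theta> + block_part (owner G) i h) s a = joint_policy G \<theta> s a * exp x"
    and "\<bar>x - h \<bullet> total_score i \<theta> (s, a)\<bar> \<le> real CARD('n) * L * (norm h)\<^sup>2"
proof
  let ?\<theta>' = "\<theta> + block_part (owner G) i h"
  let ?x = "\<Sum>n\<in>UNIV. ln (policy G n ?\<theta>' s (a n)) - ln (policy G n \<theta> s (a n))"
  have an: "a n \<in> actions G" for n using a by (simp add: space_ref_measure)
  have "exp ?x = (\<Prod>n\<in>UNIV. policy G n ?\<theta>' s (a n) / policy G n \<theta> s (a n))"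
    using policy_pos[OF s an] by (simp add: exp_sum exp_diff)
  also have "\<dots> = joint_policy G ?\<theta>' s a / joint_policy G \<theta> s a"
    by (simp add: joint_policy_def prod_dividef)
  finally show "joint_policy G ?\<theta>' s a = joint_policy G \<theta> s a * exp ?x"
    using joint_policy_pos[OF s a, of \<theta>] by simp
  have "?x - h \<bullet> total_score i \<theta> (s, a)
      = (\<Sum>n\<in>UNIV. ln (policy G n ?\<theta>' s (a n)) - ln (policy G n \<theta> s (a n)) - h \<bullet> score G i n \<theta> s (a n))"
    by (simp add: total_score_def inner_sum_right sum_subtractf)
  also have "\<bar>\<dots>\<bar> \<le> (\<Sum>n\<in>(UNIV::'n set). L * (norm h)\<^sup>2)"
    by (intro order_trans[OF sum_abs] sum_mono log_policy_first_order s an)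
  finally show "\<bar>?x - h \<bullet> total_score i \<theta> (s, a)\<bar> \<le> real CARD('n) * L * (norm h)\<^sup>2" by simp
qed

text \<open>
  Only second moments of the scores are available, so \<open>e\<^sup>x - 1 - x\<close> is bounded by \<open>x\<^sup>2 (1 + e\<^sup>x)\<close>: the two
  summands are squares of scores weighted by the old and by the new policy.
\<close>

lemma joint_policy_first_order:
  fixes \<theta> :: "real ^ 'm" and i :: 'n
  assumes s: "s \<in> space (states G)" and a: "a \<in> space ref_measure" and h: "norm h \<le> 1"
  defines "\<theta>' \<equiv> \<theta> + block_part (owner G) i h" and "c \<equiv> real CARD('n) * L"
  shows "\<bar>joint_policy G \<theta>' s a - joint_policy G \<theta> s a - joint_policy G \<theta> s a * (h \<bullet> total_score i \<theta> (s, a))\<bar>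
    \<le> (norm h)\<^sup>2 * (joint_policy G \<theta> s a * (2 * (norm (total_score i \<theta> (s, a)))\<^sup>2 + (2 * c\<^sup>2 + c))
       + joint_policy G \<theta>' s a * (2 * (norm (total_score i \<theta>' (s, a)))\<^sup>2 + 8 * c\<^sup>2))"
proof -
  let ?S = "total_score i \<theta> (s, a)" and ?S' = "total_score i \<theta>' (s, a)"
  let ?P = "joint_policy G \<theta> s a" and ?P' = "joint_policy G \<theta>' s a"
  obtain x where x: "?P' = ?P * exp x" "\<bar>x - h \<bullet> ?S\<bar> \<le> c * (norm h)\<^sup>2"
    using joint_policy_ratio[OF s a, where \<theta>=\<theta> and i=i and h=h] unfolding \<theta>'_def c_def by blast
  have c: "0 \<le> c" using L_nonneg by (simp add: c_def)
  have P: "0 < ?P" "0 < ?P'" by (rule joint_policy_pos[OF s a])+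
  have h2: "(norm h)\<^sup>2 \<le> norm h" using h by (simp add: power2_eq_square mult_left_le)
  have "\<bar>x\<bar> \<le> \<bar>h \<bullet> ?S\<bar> + c * (norm h)\<^sup>2" using x(2) by linarith
  also have "\<dots> \<le> norm h * norm ?S + c * norm h"
    using Cauchy_Schwarz_ineq2[of h ?S] mult_left_mono[OF h2 c] by linarith
  finally have x_le: "\<bar>x\<bar> \<le> norm h * (norm ?S + c)" by (simp add: algebra_simps)
  have sq: "(u + v)\<^sup>2 \<le> 2 * u\<^sup>2 + 2 * v\<^sup>2" for u v :: real
    using sum_squares_bound[of u v] by (simp add: power2_sum)
  have x2: "x\<^sup>2 \<le> (norm h)\<^sup>2 * b" if "norm ?S + c \<le> w" "w\<^sup>2 \<le> b" for w b
  proof -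
    have "\<bar>x\<bar> \<le> norm h * w"
      using x_le mult_left_mono[OF that(1), of "norm h"] by simp
    then have "x\<^sup>2 \<le> (norm h * w)\<^sup>2"
      using power_mono[of "\<bar>x\<bar>" "norm h * w" 2] by simp
    also have "\<dots> \<le> (norm h)\<^sup>2 * b"
      using that(2) by (simp add: power_mult_distrib mult_left_mono)
    finally show ?thesis .
  qed
  have x2S: "x\<^sup>2 \<le> (norm h)\<^sup>2 * (2 * (norm ?S)\<^sup>2 + 2 * c\<^sup>2)"
    by (rule x2[OF order_refl sq])
  \<comment> \<open>The part of x^2 weighted by the new policy needs the score at \<theta>', whose
    second moment is the one controlled there. Replacing the score at \<theta> costs at most c, as
    the parameters are at distance at most 1; the offset c + c = 2c becomes 8 c^2 after
    squaring.\<close>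
  have "norm (\<theta>' - \<theta>) \<le> 1"
    unfolding \<theta>'_def using norm_block_part_le[of "owner G" i h] h by simp
  then have "norm (\<theta> - \<theta>') \<le> 1" by (simp add: norm_minus_commute)
  then have "c * norm (\<theta> - \<theta>') \<le> c" using c by (simp add: mult_left_le)
  moreover have "norm (?S - ?S') \<le> c * norm (\<theta> - \<theta>')"
    unfolding c_def using s a by (intro total_score_lipschitz) (auto simp: space_sa_space space_ref_measure)
  ultimately have "norm ?S + c \<le> norm ?S' + 2 * c"
    using norm_triangle_sub[of ?S ?S'] by linarith
  then have x2S': "x\<^sup>2 \<le> (norm h)\<^sup>2 * (2 * (norm ?S')\<^sup>2 + 8 * c\<^sup>2)"
    by (rule x2) (use sq[of "norm ?S'" "2 * c"] in \<open>simp add: power_mult_distrib\<close>)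
  have "?P' - ?P - ?P * (h \<bullet> ?S) = ?P * (exp x - 1 - x) + ?P * (x - h \<bullet> ?S)"
    by (simp add: x(1) algebra_simps)
  also have "\<bar>\<dots>\<bar> \<le> ?P * \<bar>exp x - 1 - x\<bar> + ?P * \<bar>x - h \<bullet> ?S\<bar>"
    using P by (intro order_trans[OF abs_triangle_ineq]) (simp add: abs_mult)
  also have "\<dots> \<le> ?P * (x\<^sup>2 * (1 + exp x)) + ?P * (c * (norm h)\<^sup>2)"
    using P x(2) by (intro add_mono mult_left_mono abs_exp_minus_1_minus_le) auto
  also have "\<dots> = ?P * x\<^sup>2 + ?P' * x\<^sup>2 + ?P * (c * (norm h)\<^sup>2)"
    by (simp add: x(1) algebra_simps)
  also have "\<dots> \<le> ?P * ((norm h)\<^sup>2 * (2 * (norm ?S)\<^sup>2 + 2 * c\<^sup>2)) + ?P' * ((norm h)\<^sup>2 * (2 * (norm ?S')\<^sup>2 + 8 * c\<^sup>2))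
      + ?P * (c * (norm h)\<^sup>2)"
    using P c by (intro add_mono mult_left_mono x2S x2S') auto
  finally show ?thesis by (simp add: algebra_simps)
qed

definition moment_const :: real where
  "moment_const = (real CARD('n))\<^sup>2 * V\<^sup>2"

text \<open>With c = N L, this integrates the two weights of
  \<open>joint_policy_first_order\<close>: twice the second moment under each policy gives
  \<open>4 * moment_const\<close>, and (2 c^2 + c) + 8 c^2 gives the rest.\<close>

definition expansion_const :: real where
  "expansion_const = 4 * moment_const + (10 * (real CARD('n) * L)\<^sup>2 + real CARD('n) * L)"

lemma moment_const_nonneg: "0 \<le> moment_const"
  by (simp add: moment_const_def)

lemma expansion_const_nonneg: "0 \<le> expansion_const"
  using L_nonneg by (simp add: expansion_const_def moment_const_nonneg)

text \<open>The factor \<open>1 + moment_const\<close> comes from |S| <= 1 + |S|^2, itself a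
  consequence of 2 |S| <= |S|^2 + 1.\<close>

lemma
  fixes f :: "'s \<times> ('n \<Rightarrow> real ^ 'k) \<Rightarrow> real"
  assumes s: "s \<in> space (states G)" and f: "f \<in> borel_measurable (sa_space G)"
    and C: "\<And>sa. sa \<in> space (sa_space G) \<Longrightarrow> \<bar>f sa\<bar> \<le> C"
  shows integrable_bounded_mult_score:
      "integrable (start_law G \<theta> s) (\<lambda>sa. f sa * (h \<bullet> total_score i \<theta> sa))"
    and abs_integral_bounded_mult_score_le:
      "\<bar>\<integral>sa. f sa * (h \<bullet> total_score i \<theta> sa) \<partial>start_law G \<theta> s\<bar> \<le> C * norm h * (1 + moment_const)"
    and integral_abs_bounded_mult_score_le:
      "(\<integral>sa. \<bar>f sa * (h \<bullet> total_score i \<theta> sa)\<bar> \<partial>start_law G \<theta> s) \<le> C * norm h * (1 + moment_const)"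
proof -
  interpret prob_space "start_law G \<theta> s" by (rule prob_space_start_law[OF s])
  have C0: "0 \<le> C"
  proof -
    obtain x where "x \<in> space (start_law G \<theta> s)" using not_empty by blast
    then have "\<bar>f x\<bar> \<le> C" by (intro C) (simp add: space_start_law)
    then show ?thesis by linarith
  qed
  let ?w = "\<lambda>sa. C * norm h * (1 + (norm (total_score i \<theta> sa))\<^sup>2)"
  have w: "integrable (start_law G \<theta> s) ?w"
    using integrable_norm_total_score_squared[OF s, where i=i and \<theta>=\<theta>] by simp
  have le: "\<bar>f sa * (h \<bullet> total_score i \<theta> sa)\<bar> \<le> ?w sa" if "sa \<in> space (start_law G \<theta> s)" for sa
  proof -
    have "norm (total_score i \<theta> sa) \<le> 2 * norm (total_score i \<theta> sa) * 1" by simp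
    also have "\<dots> \<le> (norm (total_score i \<theta> sa))\<^sup>2 + 1\<^sup>2" by (rule sum_squares_bound)
    finally have n: "norm (total_score i \<theta> sa) \<le> 1 + (norm (total_score i \<theta> sa))\<^sup>2"
      by (simp only: one_power2 add.commute)
    have "\<bar>f sa * (h \<bullet> total_score i \<theta> sa)\<bar> \<le> C * (norm h * norm (total_score i \<theta> sa))"
      unfolding abs_mult using that C0 by (intro mult_mono C Cauchy_Schwarz_ineq2) (auto simp: space_start_law)
    also have "\<dots> \<le> C * (norm h * (1 + (norm (total_score i \<theta> sa))\<^sup>2))"
      using C0 n by (intro mult_left_mono) auto
    finally show ?thesis by (simp add: mult.assoc)
  qed
  have m: "(\<lambda>sa. f sa * (h \<bullet> total_score i \<theta> sa)) \<in> borel_measurable (start_law G \<theta> s)"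
    using f by measurable
  show int: "integrable (start_law G \<theta> s) (\<lambda>sa. f sa * (h \<bullet> total_score i \<theta> sa))"
    by (rule Bochner_Integration.integrable_bound[OF w m])
       (intro AE_I2, unfold real_norm_def, rule order_trans[OF le abs_ge_self])
  have "(\<integral>sa. \<bar>f sa * (h \<bullet> total_score i \<theta> sa)\<bar> \<partial>start_law G \<theta> s) \<le> (\<integral>sa. ?w sa \<partial>start_law G \<theta> s)"
    by (rule integral_mono[OF integrable_abs[OF int] w le])
  also have "\<dots> = C * norm h * (1 + (\<integral>sa. (norm (total_score i \<theta> sa))\<^sup>2 \<partial>start_law G \<theta> s))"
    using integrable_norm_total_score_squared[OF s, where i=i and \<theta>=\<theta>] by (simp add: prob_space)
  also have "\<dots> \<le> C * norm h * (1 + moment_const)"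
    using C0 integral_norm_total_score_squared_le[OF s, where i=i and \<theta>=\<theta>]
    by (intro mult_left_mono) (auto simp: moment_const_def)
  finally show "(\<integral>sa. \<bar>f sa * (h \<bullet> total_score i \<theta> sa)\<bar> \<partial>start_law G \<theta> s) \<le> C * norm h * (1 + moment_const)" .
  then show "\<bar>\<integral>sa. f sa * (h \<bullet> total_score i \<theta> sa) \<partial>start_law G \<theta> s\<bar> \<le> C * norm h * (1 + moment_const)"
    by (rule order_trans[OF integral_abs_bound])
qed

text \<open>The pointwise expansion of the joint density is integrated over the reference measure.
  The error depends on \<open>f\<close> only through its bound and is uniform in the state, so it
  applies to action values and survives averaging over the states at any time.\<close>

lemma integral_start_law_first_order:
  fixes f :: "'s \<times> ('n \<Rightarrow> real ^ 'k) \<Rightarrow> real" and \<theta> :: "real ^ 'm" and i :: 'n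
  assumes s: "s \<in> space (states G)" and f: "f \<in> borel_measurable (sa_space G)"
    and C: "\<And>sa. sa \<in> space (sa_space G) \<Longrightarrow> \<bar>f sa\<bar> \<le> C" and h: "norm h \<le> 1"
  defines "\<theta>' \<equiv> \<theta> + block_part (owner G) i h"
  shows "\<bar>(\<integral>sa. f sa \<partial>start_law G \<theta>' s) - (\<integral>sa. f sa \<partial>start_law G \<theta> s)
      - (\<integral>sa. f sa * (h \<bullet> total_score i \<theta> sa) \<partial>start_law G \<theta> s)\<bar> \<le> C * expansion_const * (norm h)\<^sup>2"
proof -
  interpret p: prob_space "start_law G \<theta> s" by (rule prob_space_start_law[OF s])
  interpret p': prob_space "start_law G \<theta>' s" by (rule prob_space_start_law[OF s])
  define c where "c = real CARD('n) * L"
  let ?P = "joint_policy G \<theta> s" and ?P' = "joint_policy G \<theta>' s"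
  let ?F = "\<lambda>sa. f sa * (h \<bullet> total_score i \<theta> sa)"
  let ?u = "\<lambda>sa. 2 * (norm (total_score i \<theta> sa))\<^sup>2 + (2 * c\<^sup>2 + c)"
  let ?u' = "\<lambda>sa. 2 * (norm (total_score i \<theta>' sa))\<^sup>2 + 8 * c\<^sup>2"
  have C0: "0 \<le> C"
  proof -
    obtain x where "x \<in> space (start_law G \<theta> s)" using p.not_empty by blast
    then have "\<bar>f x\<bar> \<le> C" by (intro C) (simp add: space_start_law)
    then show ?thesis by linarith
  qed
  have Fm: "?F \<in> borel_measurable (sa_space G)" using f by measurable
  have um: "?u \<in> borel_measurable (sa_space G)" "?u' \<in> borel_measurable (sa_space G)" by measurable
  have u: "integrable (start_law G \<theta> s) ?u" "integrable (start_law G \<theta>' s) ?u'"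
    using integrable_norm_total_score_squared[OF s, where i=i] by simp_all
  have uP: "integrable ref_measure (\<lambda>a. ?P a * ?u (s, a))" "integrable ref_measure (\<lambda>a. ?P' a * ?u' (s, a))"
    using u um by (simp_all only: integrable_start_law_iff[OF s])
  have iF: "integrable ref_measure (\<lambda>a. ?P a * ?F (s, a))"
    using integrable_bounded_mult_score[OF s f C, where \<theta>=\<theta> and h=h and i=i] by (simp only: integrable_start_law_iff[OF s Fm])
  have iP: "integrable ref_measure (\<lambda>a. ?P a * f (s, a))" "integrable ref_measure (\<lambda>a. ?P' a * f (s, a))"
    using integrable_start_law_bounded[OF s f C] by (simp_all only: integrable_start_law_iff[OF s f])
  let ?r = "\<lambda>a. ?P' a * f (s, a) - ?P a * f (s, a) - ?P a * ?F (s, a)"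
  let ?w = "\<lambda>a. C * (norm h)\<^sup>2 * (?P a * ?u (s, a) + ?P' a * ?u' (s, a))"
  have ir: "integrable ref_measure ?r" by (intro Bochner_Integration.integrable_diff iP iF)
  have iw: "integrable ref_measure ?w"
    by (intro integrable_mult_right Bochner_Integration.integrable_add uP)
  have "(\<integral>sa. f sa \<partial>start_law G \<theta>' s) - (\<integral>sa. f sa \<partial>start_law G \<theta> s) - (\<integral>sa. ?F sa \<partial>start_law G \<theta> s)
      = (\<integral>a. ?r a \<partial>ref_measure)"
    unfolding integral_start_law[OF s f] integral_start_law[OF s Fm]
    by (simp only: Bochner_Integration.integral_diff Bochner_Integration.integrable_diff iP iF)
  also have "\<bar>\<dots>\<bar> \<le> (\<integral>a. \<bar>?r a\<bar> \<partial>ref_measure)" by (rule integral_abs_bound)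
  also have "\<dots> \<le> (\<integral>a. ?w a \<partial>ref_measure)"
  proof (rule integral_mono[OF integrable_abs[OF ir] iw])
    fix a assume a: "a \<in> space ref_measure"
    have "?r a = f (s, a) * (?P' a - ?P a - ?P a * (h \<bullet> total_score i \<theta> (s, a)))"
      by (simp add: algebra_simps)
    also have "\<bar>\<dots>\<bar> \<le> C * ((norm h)\<^sup>2 * (?P a * ?u (s, a) + ?P' a * ?u' (s, a)))"
      unfolding abs_mult \<theta>'_def c_def
      using s a C0 by (intro mult_mono C joint_policy_first_order h) (auto simp: space_sa_space space_ref_measure)
    finally show "\<bar>?r a\<bar> \<le> ?w a" by (simp add: mult.assoc)
  qed
  also have "\<dots> = C * (norm h)\<^sup>2 * ((\<integral>sa. ?u sa \<partial>start_law G \<theta> s) + (\<integral>sa. ?u' sa \<partial>start_law G \<theta>' s))"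
    unfolding integral_start_law[OF s um(1)] integral_start_law[OF s um(2)]
    by (simp only: integral_mult_right_zero Bochner_Integration.integral_add uP)
  also have "\<dots> \<le> C * (norm h)\<^sup>2 * ((2 * moment_const + (2 * c\<^sup>2 + c)) + (2 * moment_const + 8 * c\<^sup>2))"
    using C0 integral_norm_total_score_squared_le[OF s, where i=i and \<theta>=\<theta>] integral_norm_total_score_squared_le[OF s, where i=i and \<theta>=\<theta>']
      integrable_norm_total_score_squared[OF s, where i=i]
    by (intro mult_left_mono add_mono) (auto simp: moment_const_def p.prob_space p'.prob_space)
  also have "\<dots> = C * expansion_const * (norm h)\<^sup>2"
    by (simp add: expansion_const_def c_def algebra_simps)
  finally show ?thesis .
qed

text \<open>On the unit ball |h|^2 <= |h|, so the quadratic remainder is absorbed by the bound for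
  the linear term.\<close>

lemma integral_start_law_lipschitz:
  fixes f :: "'s \<times> ('n \<Rightarrow> real ^ 'k) \<Rightarrow> real"
  assumes s: "s \<in> space (states G)" and f: "f \<in> borel_measurable (sa_space G)"
    and C: "\<And>sa. sa \<in> space (sa_space G) \<Longrightarrow> \<bar>f sa\<bar> \<le> C" and h: "norm h \<le> 1"
  shows "\<bar>(\<integral>sa. f sa \<partial>start_law G (\<theta> + block_part (owner G) i h) s) - (\<integral>sa. f sa \<partial>start_law G \<theta> s)\<bar>
     \<le> C * (expansion_const + 1 + moment_const) * norm h"
proof -
  have C0: "0 \<le> C"
  proof -
    obtain x where "x \<in> space (start_law G \<theta> s)"
      using prob_space.not_empty[OF prob_space_start_law[OF s]] by blast
    then have "\<bar>f x\<bar> \<le> C" by (intro C) (simp add: space_start_law)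
    then show ?thesis by linarith
  qed
  have "(norm h)\<^sup>2 \<le> norm h" using h by (simp add: power2_eq_square mult_left_le)
  then have "C * expansion_const * (norm h)\<^sup>2 \<le> C * expansion_const * norm h"
    using C0 expansion_const_nonneg by (intro mult_left_mono) auto
  then show ?thesis
    using integral_start_law_first_order[OF s f C h, where \<theta>=\<theta> and i=i] abs_integral_bounded_mult_score_le[OF s f C, where \<theta>=\<theta> and h=h and i=i]
    by (simp add: algebra_simps)
qed

text \<open>Apply the expansion to the constant 1: both laws have mass 1, so the linear term is
  itself O(|h|^2). A linear functional of quadratic size vanishes, as the scaled vectors h / n show
  when n tends to infinity.\<close>

lemma integral_score_eq_0:
  assumes s: "s \<in> space (states G)"
  shows "(\<integral>sa. h \<bullet> total_score i \<theta> sa \<partial>start_law G \<theta> s) = 0"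
proof -
  let ?c = "\<lambda>h. \<integral>sa. h \<bullet> total_score i \<theta> sa \<partial>start_law G \<theta> s"
  have small: "\<bar>?c h\<bar> \<le> expansion_const * (norm h)\<^sup>2" if "norm h \<le> 1" for h
    using integral_start_law_first_order[OF s, where f="\<lambda>_. 1" and C=1 and h=h and \<theta>=\<theta> and i=i] that
      prob_space.prob_space[OF prob_space_start_law[OF s]]
    by simp
  have "\<bar>?c h\<bar> \<le> expansion_const * (norm h)\<^sup>2 * (1 / real n)" if "norm h \<le> real n" "0 < n" for n
  proof -
    have "\<bar>?c ((1 / real n) *\<^sub>R h)\<bar> \<le> expansion_const * (norm ((1 / real n) *\<^sub>R h))\<^sup>2"
      using that by (intro small) (simp add: divide_simps)
    then have "\<bar>?c h\<bar> / real n \<le> (expansion_const * (norm h)\<^sup>2 * (1 / real n)) / real n"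
      using that by (simp add: power_divide power2_eq_square)
    from mult_right_mono[OF this, of "real n"] show ?thesis
      using that by simp
  qed
  moreover have "\<forall>\<^sub>F n in sequentially. norm h \<le> real n \<and> 0 < n"
    using eventually_ge_at_top[of "nat \<lceil>norm h\<rceil>"] eventually_gt_at_top[of 0]
    by eventually_elim linarith
  ultimately have "\<forall>\<^sub>F n in sequentially. \<bar>?c h\<bar> \<le> expansion_const * (norm h)\<^sup>2 * (1 / real n)"
    by (auto elim: eventually_mono)
  moreover have "(\<lambda>n. expansion_const * (norm h)\<^sup>2 * (1 / real n)) \<longlonglongrightarrow> expansion_const * (norm h)\<^sup>2 * 0"
    by (intro tendsto_mult tendsto_const lim_1_over_n)
  ultimately have "\<bar>?c h\<bar> \<le> expansion_const * (norm h)\<^sup>2 * 0"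
    by (intro tendsto_lowerbound[of _ _ sequentially]) auto
  then show ?thesis by simp
qed

text \<open>
  Weighted by \<open>\<gamma>\<^sup>t\<close> and summed over \<open>t\<close>, this is the derivative of the utility in the direction \<open>h\<close>.
\<close>

definition gradient_pairing :: "'n \<Rightarrow> real ^ 'm \<Rightarrow> real ^ 'm \<Rightarrow> nat \<Rightarrow> real" where
  "gradient_pairing i \<theta> h t =
     (\<integral>s. (\<integral>sa. q_fun \<theta> i sa * (h \<bullet> total_score i \<theta> sa) \<partial>start_law G \<theta> s) \<partial>state_law \<theta> t)"

section \<open>First-order expansion of the utility\<close>

text \<open>Split the new action value into the old one and the difference. The old one gives the
  linear term. The difference is O(|h|), because the gap is O(|h|) by boundedness alone and hence so
  is the change of values; paired with a policy difference of the same order it is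
  quadratic.\<close>

lemma policy_gap_first_order:
  fixes \<theta> :: "real ^ 'm" and i :: 'n
  assumes h: "norm h \<le> 1" and s: "s \<in> space (states G)"
  defines "\<theta>' \<equiv> \<theta> + block_part (owner G) i h"
    and "Q \<equiv> R / (1 - discount G)" and "K \<equiv> expansion_const + 1 + moment_const"
  shows "\<bar>policy_gap \<theta>' \<theta> i s - (\<integral>sa. q_fun \<theta> i sa * (h \<bullet> total_score i \<theta> sa) \<partial>start_law G \<theta> s)\<bar>
    \<le> (Q * expansion_const + Q * K / (1 - discount G) * K) * (norm h)\<^sup>2"
proof -
  have K: "0 \<le> K" unfolding K_def using expansion_const_nonneg moment_const_nonneg by simp
  have Q: "0 \<le> Q" unfolding Q_def by (rule value_bound_nonneg)
  have gap: "\<bar>policy_gap \<theta>' \<theta> i s\<bar> \<le> Q * K * norm h" if "s \<in> space (states G)" for s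
    unfolding policy_gap_def Q_def K_def \<theta>'_def
    by (rule integral_start_law_lipschitz[OF that measurable_q_fun abs_q_fun_le h])
  define b where "b = Q * K * norm h / (1 - discount G)"
  have b0: "0 \<le> b" unfolding b_def using Q K discount by simp
  have v: "\<bar>v_fun \<theta>' i s - v_fun \<theta> i s\<bar> \<le> b" if "s \<in> space (states G)" for s
    unfolding b_def by (rule abs_v_fun_diff_le[OF that gap])
  have q: "\<bar>q_fun \<theta>' i sa - q_fun \<theta> i sa\<bar> \<le> b" if sa: "sa \<in> space (sa_space G)" for sa
  proof -
    have "\<bar>\<integral>s. v_fun \<theta>' i s - v_fun \<theta> i s \<partial>transition G sa\<bar> \<le> b"
      using v b0 by (intro prob_space.abs_integral_le_const[OF prob_space_transition[OF sa]])
        (auto simp: space_transition[OF sa])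
    then have "discount G * \<bar>\<integral>s. v_fun \<theta>' i s - v_fun \<theta> i s \<partial>transition G sa\<bar> \<le> 1 * b"
      using discount b0 by (intro mult_mono) auto
    then show ?thesis using discount by (simp add: q_fun_diff[OF sa] abs_mult)
  qed
  let ?A = "\<lambda>\<theta> f. \<integral>sa. f sa \<partial>start_law G \<theta> s"
  let ?d = "\<lambda>sa. q_fun \<theta>' i sa - q_fun \<theta> i sa"
  have dm: "?d \<in> borel_measurable (sa_space G)" by (intro borel_measurable_diff measurable_q_fun)
  have iq: "integrable (start_law G \<eta> s) (q_fun \<xi> i)" for \<eta> \<xi>
    by (rule integrable_start_law_bounded[OF s measurable_q_fun abs_q_fun_le])
  have "policy_gap \<theta>' \<theta> i s = (?A \<theta>' (q_fun \<theta> i) - ?A \<theta> (q_fun \<theta> i)) + (?A \<theta>' ?d - ?A \<theta> ?d)"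
    unfolding policy_gap_def by (simp add: Bochner_Integration.integral_diff[OF iq iq])
  moreover have "\<bar>?A \<theta>' ?d - ?A \<theta> ?d\<bar> \<le> b * K * norm h"
    unfolding K_def using integral_start_law_lipschitz[OF s dm q h, where \<theta>=\<theta> and i=i] by (simp add: \<theta>'_def)
  moreover have "\<bar>?A \<theta>' (q_fun \<theta> i) - ?A \<theta> (q_fun \<theta> i)
      - (\<integral>sa. q_fun \<theta> i sa * (h \<bullet> total_score i \<theta> sa) \<partial>start_law G \<theta> s)\<bar> \<le> Q * expansion_const * (norm h)\<^sup>2"
    unfolding \<theta>'_def Q_def by (rule integral_start_law_first_order[OF s measurable_q_fun abs_q_fun_le h])
  ultimately have "\<bar>policy_gap \<theta>' \<theta> i s - (\<integral>sa. q_fun \<theta> i sa * (h \<bullet> total_score i \<theta> sa) \<partial>start_law G \<theta> s)\<bar>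
      \<le> Q * expansion_const * (norm h)\<^sup>2 + b * K * norm h" by linarith
  also have "b * K * norm h = Q * K / (1 - discount G) * K * (norm h)\<^sup>2"
    by (simp add: b_def power2_eq_square)
  finally show ?thesis by (simp add: distrib_right)
qed

lemma measurable_score_value:
  "(\<lambda>s. \<integral>sa. q_fun \<theta> i sa * (h \<bullet> total_score i \<theta> sa) \<partial>start_law G \<theta> s) \<in> borel_measurable (states G)"
  by (intro measurable_integral_kernel[OF measurable_start_law] borel_measurable_times measurable_q_fun
      measurable_inner_total_score)

lemma abs_gradient_pairing_le:
  "\<bar>gradient_pairing i \<theta> h t\<bar> \<le> R / (1 - discount G) * norm h * (1 + moment_const)"
  unfolding gradient_pairing_def
proof (rule prob_space.abs_integral_le_const[OF prob_space_state_law])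
  show "0 \<le> R / (1 - discount G) * norm h * (1 + moment_const)"
    using value_bound_nonneg moment_const_nonneg by (intro mult_nonneg_nonneg) auto
qed (intro abs_integral_bounded_mult_score_le measurable_q_fun abs_q_fun_le, simp_all add: space_state_law)

text \<open>The representing vector is a hypothesis, to be met later by the mean of the estimator,
  so linearity of the series in \<open>h\<close> needs no separate proof. Quadratic errors that are
  uniform in t sum to a factor 1 / (1 - \<gamma>).\<close>

lemma policy_gradient_theorem:
  assumes D: "\<And>h. h \<bullet> D = (\<Sum>t. discount G ^ t * gradient_pairing i \<theta> h t)"
  shows "GDERIV (\<lambda>h. utility G i (\<theta> + block_part (owner G) i h)) 0 :> D"
proof -
  define Q where "Q = R / (1 - discount G)"
  define K where "K = expansion_const + 1 + moment_const"
  define C where "C = Q * expansion_const + Q * K / (1 - discount G) * K"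
  show ?thesis
  proof (rule GDERIV_quadratic_bound[where C="C / (1 - discount G)"])
    fix h :: "real ^ 'm" assume h: "norm h \<le> 1"
    let ?\<theta>' = "\<theta> + block_part (owner G) i h"
    let ?g = "\<lambda>s. \<integral>sa. q_fun \<theta> i sa * (h \<bullet> total_score i \<theta> sa) \<partial>start_law G \<theta> s"
    have gap: "\<bar>policy_gap ?\<theta>' \<theta> i s - ?g s\<bar> \<le> C * (norm h)\<^sup>2" if "s \<in> space (states G)" for s
      unfolding C_def Q_def K_def by (rule policy_gap_first_order[OF h that])
    have C0: "0 \<le> C * (norm h)\<^sup>2" using gap[OF init_state] by linarith
    have ig: "integrable (state_law \<theta> t) ?g" for t
    proof (rule prob_space.integrable_bounded_on_space[OF prob_space_state_law])
      show "?g \<in> borel_measurable (state_law \<theta> t)"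
        by (simp add: measurable_state_law measurable_score_value)
      show "\<bar>?g s\<bar> \<le> R / (1 - discount G) * norm h * (1 + moment_const)" if "s \<in> space (state_law \<theta> t)" for s
        using that by (intro abs_integral_bounded_mult_score_le measurable_q_fun abs_q_fun_le) (simp_all add: space_state_law)
    qed
    have igap: "integrable (state_law \<theta> t) (policy_gap ?\<theta>' \<theta> i)" for t
    proof (rule prob_space.integrable_bounded_on_space[OF prob_space_state_law])
      show "policy_gap ?\<theta>' \<theta> i \<in> borel_measurable (state_law \<theta> t)"
        by (simp add: measurable_state_law measurable_policy_gap)
      show "\<bar>policy_gap ?\<theta>' \<theta> i s\<bar> \<le> Q * K * norm h" if "s \<in> space (state_law \<theta> t)" for s
        unfolding policy_gap_def Q_def K_def using that
        by (intro integral_start_law_lipschitz measurable_q_fun abs_q_fun_le h) (simp_all add: space_state_law)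
    qed
    have e: "\<bar>(\<integral>s. policy_gap ?\<theta>' \<theta> i s \<partial>state_law \<theta> t) - gradient_pairing i \<theta> h t\<bar> \<le> C * (norm h)\<^sup>2" for t
    proof -
      have "(\<integral>s. policy_gap ?\<theta>' \<theta> i s \<partial>state_law \<theta> t) - gradient_pairing i \<theta> h t
          = (\<integral>s. policy_gap ?\<theta>' \<theta> i s - ?g s \<partial>state_law \<theta> t)"
        unfolding gradient_pairing_def by (rule Bochner_Integration.integral_diff[symmetric, OF igap ig])
      also have "\<bar>\<dots>\<bar> \<le> C * (norm h)\<^sup>2"
        using gap C0 by (intro prob_space.abs_integral_le_const prob_space_state_law) (simp_all add: space_state_law)
      finally show ?thesis .
    qed
    have "(\<lambda>t. discount G ^ t * gradient_pairing i \<theta> h t) sums (h \<bullet> D)"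
      unfolding D
      by (rule summable_sums[OF summable_geometric_bounded[OF discount_bounds abs_gradient_pairing_le]])
    from sums_diff[OF utility_diff[where \<theta>'="?\<theta>'" and \<theta>=\<theta> and i=i] this]
    have "utility G i ?\<theta>' - utility G i \<theta> - h \<bullet> D = (\<Sum>t. discount G ^ t *
        ((\<integral>s. policy_gap ?\<theta>' \<theta> i s \<partial>state_law \<theta> t) - gradient_pairing i \<theta> h t))"
      unfolding right_diff_distrib by (rule sums_unique)
    also have "\<bar>\<dots>\<bar> \<le> C * (norm h)\<^sup>2 / (1 - discount G)"
      by (rule abs_suminf_geometric_le[OF discount_bounds e])
    finally show "\<bar>utility G i (\<theta> + block_part (owner G) i (0 + h)) - utility G i (\<theta> + block_part (owner G) i 0) - h \<bullet> D\<bar>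
        \<le> C / (1 - discount G) * (norm h)\<^sup>2"
      unfolding add_0 block_part_0 add_0_right times_divide_eq_left .
  qed
qed

end


section \<open>The law of the estimator\<close>

context bounded_reward_game
begin

section \<open>Sampled returns and their conditional means\<close>

text \<open>This number is both the weight per step of a sampled return and the survival probability
  per step of its random horizon; together they produce the discount \<gamma>.\<close>

definition half_discount :: real where
  "half_discount = discount G powr (1 / 2)"

lemma half_discount: "0 < half_discount" "half_discount < 1" "half_discount\<^sup>2 = discount G"
proof -
  show "0 < half_discount" "half_discount < 1"
    using discount by (simp_all add: half_discount_def powr_half_sqrt)
  show "half_discount\<^sup>2 = discount G"
    using discount by (simp add: half_discount_def powr_half_sqrt)
qed

lemma discount_powr_half: "discount G powr (real k / 2) = half_discount ^ k"
proof -
  have "half_discount ^ k = half_discount powr real k"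
    using half_discount by (simp add: powr_realpow)
  then show ?thesis by (simp add: half_discount_def powr_powr)
qed

text \<open>The weights of a sampled return are summable, so this bounds it for every horizon, not
  only in mean.\<close>

definition return_bound :: real where
  "return_bound = R / (1 - half_discount)"

lemma return_bound_nonneg: "0 \<le> return_bound"
  using R_pos half_discount by (simp add: return_bound_def)

lemma abs_half_discounted_sum_le:
  assumes "\<And>k. \<bar>x k\<bar> \<le> R"
  shows "\<bar>\<Sum>k = 0..T. discount G powr (real k / 2) * x k\<bar> \<le> return_bound"
  using abs_sum_geometric_le[of half_discount x R "Suc T"] assms half_discount
  unfolding discount_powr_half return_bound_def by (simp add: lessThan_Suc_atMost atMost_atLeast0)

lemma integral_short_horizon:
  assumes x: "\<And>k. \<bar>x k\<bar> \<le> R"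
  shows "(\<integral>T. (\<Sum>k = 0..T. discount G powr (real k / 2) * x k) \<partial>short_horizon G) = (\<Sum>k. discount G ^ k * x k)"
  using integral_geometric_pmf_partial_sums[OF half_discount(1,2) x]
  by (simp add: short_horizon_def discount_powr_half half_discount(3) atMost_atLeast0 half_discount_def[symmetric])

lemma prob_space_short_horizon: "prob_space (short_horizon G)"
  unfolding short_horizon_def by (rule prob_space_measure_pmf)

lemma sets_short_horizon [measurable_cong]: "sets (short_horizon G) = sets (count_space UNIV)"
  by (simp add: short_horizon_def)

lemma prob_space_long_horizon: "prob_space (long_horizon G)"
  unfolding long_horizon_def by (rule prob_space_measure_pmf)

lemma sets_long_horizon [measurable_cong]: "sets (long_horizon G) = sets (count_space UNIV)"
  by (simp add: long_horizon_def)

lemma Q_est_eq: "Q_est G i T1 T2 \<omega> = (\<Sum>k = 0..T2. discount G powr (real k / 2) * reward G i (\<omega> (T1 + k)))"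
  unfolding Q_est_def
  using sum.shift_bounds_cl_nat_ivl[of "\<lambda>t. discount G powr (real (t - T1) / 2) * reward G i (\<omega> t)" 0 T1 T2]
  by (simp add: add.commute)

lemma measurable_reward_coordinate [measurable]:
  "(\<lambda>\<omega>. reward G i (\<omega> t)) \<in> borel_measurable (PiM UNIV (\<lambda>_. sa_space G))"
  by (rule measurable_compose[OF _ reward]) (simp add: measurable_component_singleton)

lemma abs_reward_coordinate_le: "\<omega> \<in> space (PiM UNIV (\<lambda>_. sa_space G)) \<Longrightarrow> \<bar>reward G i (\<omega> t)\<bar> \<le> R"
  by (rule abs_reward_le) (auto simp: space_PiM)

lemma measurable_V_sum:
  "(\<lambda>(T, \<omega>). \<Sum>k = 0..T. discount G powr (real k / 2) * reward G i (\<omega> k))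
     \<in> borel_measurable (short_horizon G \<Otimes>\<^sub>M PiM UNIV (\<lambda>_. sa_space G))"
proof -
  have "(\<lambda>(T, \<omega>). \<Sum>k = 0..T. discount G powr (real k / 2) * reward G i (\<omega> k))
     \<in> borel_measurable (count_space UNIV \<Otimes>\<^sub>M PiM UNIV (\<lambda>_. sa_space G))"
    by (rule measurable_pair_measure_countable1) simp_all
  then show ?thesis by (simp cong: measurable_cong_sets sets_pair_measure_cong add: sets_short_horizon)
qed

lemma measurable_V_est_law: "V_est_law G i \<theta> \<in> states G \<rightarrow>\<^sub>M prob_algebra borel"
  unfolding V_est_law_def[abs_def]
proof (rule measurable_distr_prob_space2)
  have "short_horizon G \<in> space (prob_algebra (short_horizon G))"
    by (simp add: space_prob_algebra prob_space_short_horizon)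
  then show "(\<lambda>s. short_horizon G \<Otimes>\<^sub>M traj G \<theta> s)
      \<in> states G \<rightarrow>\<^sub>M prob_algebra (short_horizon G \<Otimes>\<^sub>M PiM UNIV (\<lambda>_. sa_space G))"
    by (intro measurable_pair_prob measurable_const measurable_traj)
  show "(\<lambda>(s, y). case y of (T, \<omega>) \<Rightarrow> \<Sum>k = 0..T. discount G powr (real k / 2) * reward G i (\<omega> k))
      \<in> borel_measurable (states G \<Otimes>\<^sub>M (short_horizon G \<Otimes>\<^sub>M PiM UNIV (\<lambda>_. sa_space G)))"
    using measurable_compose[OF measurable_snd measurable_V_sum] by (simp add: split_beta')
qed

lemma prob_space_V_est_law: "s \<in> space (states G) \<Longrightarrow> prob_space (V_est_law G i \<theta> s)"
  using measurable_space[OF measurable_V_est_law] by (simp add: space_prob_algebra)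

lemma sets_V_est_law [simp, measurable_cong]: "sets (V_est_law G i \<theta> s) = sets borel"
  by (simp add: V_est_law_def)

text \<open>The horizon is integrated first, with the trajectory fixed: this turns the random
  partial sum into the full discounted return, whose mean is the state value.\<close>

lemma
  assumes s: "s \<in> space (states G)"
  shows integrable_V_est_law: "integrable (V_est_law G i \<theta> s) (\<lambda>v. v)"
    and integral_V_est_law: "(\<integral>v. v \<partial>V_est_law G i \<theta> s) = v_fun \<theta> i s"
    and integral_abs_V_est_law_le: "(\<integral>v. \<bar>v\<bar> \<partial>V_est_law G i \<theta> s) \<le> return_bound"
proof -
  let ?f = "\<lambda>T \<omega>. \<Sum>k = 0..T. discount G powr (real k / 2) * reward G i (\<omega> k)"
  let ?M = "short_horizon G \<Otimes>\<^sub>M traj G \<theta> s"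
  interpret S: prob_space "short_horizon G" by (rule prob_space_short_horizon)
  interpret T: prob_space "traj G \<theta> s" by (rule prob_space_traj[OF s])
  interpret P: pair_prob_space "short_horizon G" "traj G \<theta> s" ..
  have sM: "sets ?M = sets (short_horizon G \<Otimes>\<^sub>M PiM UNIV (\<lambda>_. sa_space G))"
    by (intro sets_pair_measure_cong refl sets_traj s)
  have m: "case_prod ?f \<in> borel_measurable ?M"
    using measurable_V_sum by (simp only: measurable_cong_sets[OF sM refl])
  have le: "\<bar>case_prod ?f x\<bar> \<le> return_bound" if "x \<in> space ?M" for x
    unfolding split_beta' using that s
    by (intro abs_half_discounted_sum_le abs_reward_coordinate_le) (auto simp: space_pair_measure)
  have int: "integrable ?M (case_prod ?f)"
    by (rule P.integrable_bounded_on_space[OF m le])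
  show "integrable (V_est_law G i \<theta> s) (\<lambda>v. v)"
    unfolding V_est_law_def by (subst integrable_distr_eq[OF m]) (simp_all add: int)
  have "(\<integral>v. v \<partial>V_est_law G i \<theta> s) = (\<integral>x. case_prod ?f x \<partial>?M)"
    unfolding V_est_law_def by (rule integral_distr[OF m]) simp
  also have "\<dots> = (\<integral>\<omega>. (\<integral>T. ?f T \<omega> \<partial>short_horizon G) \<partial>traj G \<theta> s)"
    by (rule P.integral_snd[symmetric, OF int])
  also have "\<dots> = (\<integral>\<omega>. (\<Sum>k. discount G ^ k * reward G i (\<omega> k)) \<partial>traj G \<theta> s)"
    using s by (intro Bochner_Integration.integral_cong refl integral_short_horizon abs_reward_coordinate_le) simp
  also have "\<dots> = v_fun \<theta> i s" by (rule v_fun_eq_integral_traj[OF s])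
  finally show "(\<integral>v. v \<partial>V_est_law G i \<theta> s) = v_fun \<theta> i s" .
  have "(\<integral>v. \<bar>v\<bar> \<partial>V_est_law G i \<theta> s) = (\<integral>x. \<bar>case_prod ?f x\<bar> \<partial>?M)"
    unfolding V_est_law_def by (rule integral_distr[OF m]) simp
  also have "\<dots> \<le> (\<integral>x. return_bound \<partial>?M)"
    by (rule integral_mono[OF integrable_abs[OF int] _ le]) simp_all
  finally show "(\<integral>v. \<bar>v\<bar> \<partial>V_est_law G i \<theta> s) \<le> return_bound" by (simp add: P.prob_space)
qed

text \<open>This is the conditional mean of the return estimate given the horizon and the whole
  trajectory: the short horizons and the fresh trajectories are averaged out, while the continuation
  after \<open>t\<close> is still random.\<close>

definition mean_return :: "return_est \<Rightarrow> 'n \<Rightarrow> real ^ 'm \<Rightarrow> nat \<Rightarrow> (nat \<Rightarrow> 's \<times> ('n \<Rightarrow> real ^ 'k)) \<Rightarrow> real" where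
  "mean_return e i \<theta> t \<omega> = (case e of
     Q_return \<Rightarrow> (\<Sum>k. discount G ^ k * reward G i (\<omega> (t + k)))
   | Advantage_return \<Rightarrow> (\<Sum>k. discount G ^ k * reward G i (\<omega> (t + k))) - v_fun \<theta> i (fst (\<omega> t))
   | TD_return \<Rightarrow> reward G i (\<omega> t) + discount G * v_fun \<theta> i (fst (\<omega> (Suc t))) - v_fun \<theta> i (fst (\<omega> t)))"

text \<open>The common bound is set by the temporal difference: one reward and two value estimates.
  Its uniformity in the trajectory lets it be multiplied by the score before integration.\<close>

lemma
  assumes \<omega>: "\<omega> \<in> space (PiM UNIV (\<lambda>_. sa_space G))"
  shows integrable_R_est_law: "integrable (R_est_law G e i \<theta> t \<omega>) (\<lambda>r. r)"
    and integral_R_est_law: "(\<integral>r. r \<partial>R_est_law G e i \<theta> t \<omega>) = mean_return e i \<theta> t \<omega>"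
    and integral_abs_R_est_law_le: "(\<integral>r. \<bar>r\<bar> \<partial>R_est_law G e i \<theta> t \<omega>) \<le> R + 2 * return_bound"
proof -
  have st: "fst (\<omega> u) \<in> space (states G)" for u
    using \<omega> by (auto simp: space_PiM space_sa_space)
  have r: "\<bar>reward G i (\<omega> (t + k))\<bar> \<le> R" for k by (rule abs_reward_coordinate_le[OF \<omega>])
  interpret S: prob_space "short_horizon G" by (rule prob_space_short_horizon)
  let ?V = "\<lambda>u. V_est_law G i \<theta> (fst (\<omega> u))"
  let ?q = "\<lambda>T. Q_est G i t T \<omega>"
  have q_le: "\<bar>?q T\<bar> \<le> return_bound" for T
    unfolding Q_est_eq by (rule abs_half_discounted_sum_le[OF r])
  have qm: "?q \<in> borel_measurable (short_horizon G)" by simp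
  have q_int: "integrable (short_horizon G) ?q"
    by (rule S.integrable_bounded_on_space[OF qm q_le])
  have q_val: "(\<integral>T. ?q T \<partial>short_horizon G) = (\<Sum>k. discount G ^ k * reward G i (\<omega> (t + k)))"
    unfolding Q_est_eq by (rule integral_short_horizon[OF r])
  have q_abs: "(\<integral>T. \<bar>?q T\<bar> \<partial>short_horizon G) \<le> return_bound"
    using integral_mono[OF integrable_abs[OF q_int] S.integrable_const q_le] by (simp add: S.prob_space)
  have V: "prob_space (?V u)" "integrable (?V u) (\<lambda>v. v)" "(\<integral>v. v \<partial>?V u) = v_fun \<theta> i (fst (\<omega> u))"
    "(\<integral>v. \<bar>v\<bar> \<partial>?V u) \<le> return_bound" for u
    by (rule prob_space_V_est_law[OF st] integrable_V_est_law[OF st] integral_V_est_law[OF st]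
        integral_abs_V_est_law_le[OF st])+
  have "integrable (R_est_law G e i \<theta> t \<omega>) (\<lambda>r. r) \<and> (\<integral>r. r \<partial>R_est_law G e i \<theta> t \<omega>) = mean_return e i \<theta> t \<omega>
      \<and> (\<integral>r. \<bar>r\<bar> \<partial>R_est_law G e i \<theta> t \<omega>) \<le> R + 2 * return_bound"
  proof (cases e)
    case Q_return
    then show ?thesis
      using q_int q_val q_abs return_bound_nonneg R_pos
      by (simp add: R_est_law_def mean_return_def integrable_distr_eq[OF qm] integral_distr[OF qm])
  next
    case Advantage_return
    let ?M = "short_horizon G \<Otimes>\<^sub>M ?V t"
    have m: "(\<lambda>x. ?q (fst x) - snd x) \<in> borel_measurable ?M"
      by (intro borel_measurable_diff measurable_compose[OF measurable_fst qm]) simp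
    have mi: "integrable (?V t) (\<lambda>v. - v)" using V(2) by simp
    note p = S.prob_space_axioms V(1) q_int mi
    show ?thesis
      using integrable_pair_add[OF p] integral_pair_add[OF p] integral_abs_pair_add_le[OF p] q_val q_abs V(3)[of t]
        V(4)[of t] R_pos
      by (simp add: Advantage_return R_est_law_def mean_return_def integrable_distr_eq[OF m] integral_distr[OF m] split_beta')
  next
    case TD_return
    let ?M = "?V (Suc t) \<Otimes>\<^sub>M ?V t"
    interpret V': prob_space "?V (Suc t)" by (rule V(1))
    let ?f = "\<lambda>v. reward G i (\<omega> t) + discount G * v"
    have m: "(\<lambda>x. ?f (fst x) - snd x) \<in> borel_measurable ?M"
      by measurable
    have mi: "integrable (?V t) (\<lambda>v. - v)" using V(2) by simp
    have fi: "integrable (?V (Suc t)) ?f" using V(2) by simp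
    have fv: "(\<integral>v. ?f v \<partial>?V (Suc t)) = reward G i (\<omega> t) + discount G * v_fun \<theta> i (fst (\<omega> (Suc t)))"
      using V(2,3) by (simp add: V'.prob_space)
    have "(\<integral>v. \<bar>?f v\<bar> \<partial>?V (Suc t)) \<le> (\<integral>v. R + \<bar>v\<bar> \<partial>?V (Suc t))"
    proof (rule integral_mono[OF integrable_abs[OF fi]])
      show "integrable (?V (Suc t)) (\<lambda>v. R + \<bar>v\<bar>)" using V(2) by simp
      fix v :: real
      have "\<bar>?f v\<bar> \<le> \<bar>reward G i (\<omega> t)\<bar> + discount G * \<bar>v\<bar>"
        using discount by (intro order_trans[OF abs_triangle_ineq]) (simp add: abs_mult)
      also have "\<dots> \<le> R + \<bar>v\<bar>"
        using r[of 0] discount by (intro add_mono) (auto simp: mult_left_le_one_le)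
      finally show "\<bar>?f v\<bar> \<le> R + \<bar>v\<bar>" .
    qed
    also have "\<dots> = R + (\<integral>v. \<bar>v\<bar> \<partial>?V (Suc t))" using V(2) by (simp add: V'.prob_space)
    finally have fa: "(\<integral>v. \<bar>?f v\<bar> \<partial>?V (Suc t)) \<le> R + return_bound" using V(4)[of "Suc t"] by linarith
    note p = V(1) V(1) fi mi
    show ?thesis
      using integrable_pair_add[OF p] integral_pair_add[OF p] integral_abs_pair_add_le[OF p] fv fa V(3)[of t] V(4)[of t]
      by (simp add: TD_return R_est_law_def mean_return_def integrable_distr_eq[OF m] integral_distr[OF m] split_beta')
  qed
  then show "integrable (R_est_law G e i \<theta> t \<omega>) (\<lambda>r. r)"
    "(\<integral>r. r \<partial>R_est_law G e i \<theta> t \<omega>) = mean_return e i \<theta> t \<omega>"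
    "(\<integral>r. \<bar>r\<bar> \<partial>R_est_law G e i \<theta> t \<omega>) \<le> R + 2 * return_bound" by auto
qed

lemma measurable_R_est_law:
  "R_est_law G e i \<theta> t \<in> PiM UNIV (\<lambda>_. sa_space G) \<rightarrow>\<^sub>M prob_algebra borel"
proof -
  let ?T = "PiM UNIV (\<lambda>_. sa_space G) :: (nat \<Rightarrow> _) measure"
  have V: "(\<lambda>\<omega>. V_est_law G i \<theta> (fst (\<omega> u))) \<in> ?T \<rightarrow>\<^sub>M prob_algebra borel" for u
    by (rule measurable_compose[OF measurable_compose[OF _ measurable_fst_sa] measurable_V_est_law])
       (simp add: measurable_component_singleton)
  have S: "(\<lambda>\<omega>. short_horizon G) \<in> ?T \<rightarrow>\<^sub>M prob_algebra (count_space UNIV)"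
    by (rule measurable_const) (simp add: space_prob_algebra prob_space_short_horizon sets_short_horizon)
  have Q: "(\<lambda>x. Q_est G i t (snd x) (fst x)) \<in> borel_measurable (?T \<Otimes>\<^sub>M count_space UNIV)"
  proof -
    have "(\<lambda>x. Q_est G i t (fst x) (snd x)) \<in> borel_measurable (count_space UNIV \<Otimes>\<^sub>M ?T)"
      by (rule measurable_pair_measure_countable1) (simp_all add: Q_est_eq)
    from measurable_compose[OF measurable_pair_swap' this] show ?thesis
      by (simp add: split_beta')
  qed
  show ?thesis
  proof (cases e)
    case Q_return
    then show ?thesis
      unfolding R_est_law_def[abs_def] using Q
      by (simp add: split_beta' measurable_distr_prob_space2[OF S])
  next
    case Advantage_return
    have "(\<lambda>x. (fst x, fst (snd x))) \<in> ?T \<Otimes>\<^sub>M (count_space UNIV \<Otimes>\<^sub>M borel) \<rightarrow>\<^sub>M ?T \<Otimes>\<^sub>M count_space UNIV"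
      by measurable
    from measurable_compose[OF this Q]
    have "(\<lambda>x. Q_est G i t (fst (snd x)) (fst x) - snd (snd x)) \<in> borel_measurable (?T \<Otimes>\<^sub>M (count_space UNIV \<Otimes>\<^sub>M borel))"
      by (intro borel_measurable_diff) simp_all
    then show ?thesis
      unfolding R_est_law_def[abs_def] Advantage_return
      by (simp add: split_beta' measurable_distr_prob_space2[OF measurable_pair_prob[OF S V]])
  next
    case TD_return
    have "(\<lambda>x. reward G i (fst x t)) \<in> borel_measurable (?T \<Otimes>\<^sub>M (borel \<Otimes>\<^sub>M borel))"
      by (rule measurable_compose[OF measurable_fst measurable_reward_coordinate])
    then have "(\<lambda>x. reward G i (fst x t) + discount G * fst (snd x) - snd (snd x))
        \<in> borel_measurable (?T \<Otimes>\<^sub>M ((borel :: real measure) \<Otimes>\<^sub>M (borel :: real measure)))"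
      by measurable
    then show ?thesis
      unfolding R_est_law_def[abs_def] TD_return
      by (simp add: split_beta' measurable_distr_prob_space2[OF measurable_pair_prob[OF V V]])
  qed
qed

text \<open>An absolute moment bound that is uniform in the state passes to every time t, because
  \<open>state_law\<close> is a probability measure.\<close>

lemma
  fixes f :: "'s \<times> ('n \<Rightarrow> real ^ 'k) \<Rightarrow> real"
  assumes f: "f \<in> borel_measurable (sa_space G)"
    and b: "\<And>s. s \<in> space (states G) \<Longrightarrow> (\<integral>\<^sup>+sa. ennreal \<bar>f sa\<bar> \<partial>start_law G \<theta> s) \<le> ennreal b"
  shows nn_integral_traj_coordinate_le: "(\<integral>\<^sup>+\<omega>. ennreal \<bar>f (\<omega> t)\<bar> \<partial>traj G \<theta> (init_state G)) \<le> ennreal b"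
    and integrable_traj_coordinate: "integrable (traj G \<theta> (init_state G)) (\<lambda>\<omega>. f (\<omega> t))"
    and integral_traj_coordinate:
      "(\<integral>\<omega>. f (\<omega> t) \<partial>traj G \<theta> (init_state G)) = (\<integral>s. (\<integral>sa. f sa \<partial>start_law G \<theta> s) \<partial>state_law \<theta> t)"
proof -
  have m: "(\<lambda>\<omega>. \<omega> t) \<in> traj G \<theta> (init_state G) \<rightarrow>\<^sub>M sa_space G"
    by (rule measurable_coordinate[OF init_state])
  have k: "start_law G \<theta> \<in> state_law \<theta> t \<rightarrow>\<^sub>M subprob_algebra (sa_space G)"
    using measurable_prob_algebraD[OF measurable_start_law] by (simp only: measurable_state_law)
  have am: "(\<lambda>sa. ennreal \<bar>f sa\<bar>) \<in> borel_measurable (sa_space G)" using f by measurable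
  have "(\<integral>\<^sup>+s. \<integral>\<^sup>+sa. ennreal \<bar>f sa\<bar> \<partial>start_law G \<theta> s \<partial>state_law \<theta> t) \<le> (\<integral>\<^sup>+s. ennreal b \<partial>state_law \<theta> t)"
    using b by (intro nn_integral_mono) (simp add: space_state_law)
  also have "\<dots> = ennreal b"
    by (simp add: prob_space.emeasure_space_1[OF prob_space_state_law])
  finally have le: "(\<integral>\<^sup>+s. \<integral>\<^sup>+sa. ennreal \<bar>f sa\<bar> \<partial>start_law G \<theta> s \<partial>state_law \<theta> t) \<le> ennreal b" .
  then have fin: "(\<integral>\<^sup>+s. \<integral>\<^sup>+sa. ennreal \<bar>f sa\<bar> \<partial>start_law G \<theta> s \<partial>state_law \<theta> t) < \<infinity>"
    by (rule le_less_trans) simp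
  have "(\<integral>\<^sup>+\<omega>. ennreal \<bar>f (\<omega> t)\<bar> \<partial>traj G \<theta> (init_state G))
      = (\<integral>\<^sup>+sa. ennreal \<bar>f sa\<bar> \<partial>distr (traj G \<theta> (init_state G)) (sa_space G) (\<lambda>\<omega>. \<omega> t))"
    by (rule nn_integral_distr[symmetric, OF m]) (simp add: am)
  also have "\<dots> = (\<integral>\<^sup>+s. \<integral>\<^sup>+sa. ennreal \<bar>f sa\<bar> \<partial>start_law G \<theta> s \<partial>state_law \<theta> t)"
    unfolding traj_coordinate_eq_bind by (rule nn_integral_bind[OF am k])
  finally show "(\<integral>\<^sup>+\<omega>. ennreal \<bar>f (\<omega> t)\<bar> \<partial>traj G \<theta> (init_state G)) \<le> ennreal b" using le by simp
  show "integrable (traj G \<theta> (init_state G)) (\<lambda>\<omega>. f (\<omega> t))"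
    using integrable_bind_kernel[OF k f fin]
    unfolding traj_coordinate_eq_bind[symmetric] by (simp only: integrable_distr_eq[OF m f])
  show "(\<integral>\<omega>. f (\<omega> t) \<partial>traj G \<theta> (init_state G)) = (\<integral>s. (\<integral>sa. f sa \<partial>start_law G \<theta> s) \<partial>state_law \<theta> t)"
    using integral_bind_kernel[OF k f fin]
    unfolding traj_coordinate_eq_bind[symmetric] by (simp only: integral_distr[OF m f])
qed

end

section \<open>The mean of the gradient estimator\<close>

context score_game
begin

lemma nn_integral_abs_inner_total_score_le:
  assumes s: "s \<in> space (states G)"
  shows "(\<integral>\<^sup>+sa. ennreal \<bar>h \<bullet> total_score i \<theta> sa\<bar> \<partial>start_law G \<theta> s) \<le> ennreal (norm h * (1 + moment_const))"
proof -
  have "integrable (start_law G \<theta> s) (\<lambda>sa. \<bar>h \<bullet> total_score i \<theta> sa\<bar>)"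
    using integrable_bounded_mult_score[OF s, where f="\<lambda>_. 1" and C=1 and \<theta>=\<theta> and h=h and i=i] by simp
  then show ?thesis
    using integral_abs_bounded_mult_score_le[OF s, where f="\<lambda>_. 1" and C=1 and \<theta>=\<theta> and h=h and i=i]
    by (subst nn_integral_eq_integral) (simp_all add: ennreal_leI)
qed

lemma nn_integral_norm_total_score_le:
  assumes s: "s \<in> space (states G)"
  shows "(\<integral>\<^sup>+sa. ennreal \<bar>norm (total_score i \<theta> sa)\<bar> \<partial>start_law G \<theta> s) \<le> ennreal (1 + moment_const)"
proof -
  interpret prob_space "start_law G \<theta> s" by (rule prob_space_start_law[OF s])
  have "(\<integral>\<^sup>+sa. ennreal \<bar>norm (total_score i \<theta> sa)\<bar> \<partial>start_law G \<theta> s)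
      \<le> (\<integral>\<^sup>+sa. 1 + ennreal ((norm (total_score i \<theta> sa))\<^sup>2) \<partial>start_law G \<theta> s)"
  proof (rule nn_integral_mono)
    fix sa
    have "norm (total_score i \<theta> sa) \<le> 2 * norm (total_score i \<theta> sa) * 1" by simp
    also have "\<dots> \<le> (norm (total_score i \<theta> sa))\<^sup>2 + 1\<^sup>2" by (rule sum_squares_bound)
    finally have "\<bar>norm (total_score i \<theta> sa)\<bar> \<le> 1 + (norm (total_score i \<theta> sa))\<^sup>2"
      by (simp only: one_power2 add.commute abs_norm_cancel)
    then have "ennreal \<bar>norm (total_score i \<theta> sa)\<bar> \<le> ennreal (1 + (norm (total_score i \<theta> sa))\<^sup>2)"
      by (rule ennreal_leI)
    then show "ennreal \<bar>norm (total_score i \<theta> sa)\<bar> \<le> 1 + ennreal ((norm (total_score i \<theta> sa))\<^sup>2)"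
      by (simp add: ennreal_plus)
  qed
  also have "\<dots> = 1 + (\<integral>\<^sup>+sa. ennreal ((norm (total_score i \<theta> sa))\<^sup>2) \<partial>start_law G \<theta> s)"
    by (subst nn_integral_add) (auto simp: emeasure_space_1)
  also have "\<dots> \<le> 1 + ennreal moment_const"
    unfolding moment_const_def by (intro add_left_mono nn_integral_norm_total_score_squared_le[OF s])
  also have "\<dots> = ennreal (1 + moment_const)"
    using moment_const_nonneg by (simp add: ennreal_plus)
  finally show ?thesis .
qed

text \<open>Under \<open>start_law\<close> the state is fixed at \<open>s\<close>, so the weight is
  the constant \<open>w s\<close> and what remains is the mean of the score.\<close>

lemma integral_state_function_mult_score:
  fixes w :: "'s \<Rightarrow> real"
  assumes s: "s \<in> space (states G)" and w: "w \<in> borel_measurable (states G)"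
  shows "(\<integral>sa. h \<bullet> total_score i \<theta> sa * w (fst sa) \<partial>start_law G \<theta> s) = 0"
proof -
  have m: "(\<lambda>sa. h \<bullet> total_score i \<theta> sa * w (fst sa)) \<in> borel_measurable (sa_space G)"
    by (intro borel_measurable_times measurable_inner_total_score measurable_compose[OF measurable_fst_sa w])
  have "(\<integral>sa. h \<bullet> total_score i \<theta> sa * w (fst sa) \<partial>start_law G \<theta> s)
      = (\<integral>a. w s * (joint_policy G \<theta> s a * (h \<bullet> total_score i \<theta> (s, a))) \<partial>ref_measure)"
    unfolding integral_start_law[OF s m] by (simp add: mult_ac)
  also have "\<dots> = w s * (\<integral>sa. h \<bullet> total_score i \<theta> sa \<partial>start_law G \<theta> s)"
    unfolding integral_start_law[OF s measurable_inner_total_score] by simp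
  finally show ?thesis by (simp add: integral_score_eq_0[OF s])
qed

text \<open>All three returns give the same pairing. Sampled returns condition to the action value,
  the temporal difference does so by the Bellman equation, and the subtracted state value is
  orthogonal to the score.\<close>

lemma integral_score_mean_return:
  "(\<integral>\<omega>. h \<bullet> total_score i \<theta> (\<omega> t) * mean_return e i \<theta> t \<omega> \<partial>traj G \<theta> (init_state G)) = gradient_pairing i \<theta> h t"
proof -
  let ?T = "traj G \<theta> (init_state G)"
  let ?f = "\<lambda>sa. h \<bullet> total_score i \<theta> sa"
  note s0 = init_state
  note coord = measurable_coordinate[OF s0]
  have f: "?f \<in> borel_measurable (sa_space G)" by (rule measurable_inner_total_score)
  have fi: "integrable ?T (\<lambda>\<omega>. ?f (\<omega> t))"
    by (rule integrable_traj_coordinate[OF f nn_integral_abs_inner_total_score_le])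
  have prod: "integrable ?T (\<lambda>\<omega>. ?f (\<omega> t) * g \<omega>)"
    if "g \<in> borel_measurable ?T" "\<And>\<omega>. \<omega> \<in> space ?T \<Longrightarrow> \<bar>g \<omega>\<bar> \<le> C" for g C
  proof (rule Bochner_Integration.integrable_bound)
    show "integrable ?T (\<lambda>\<omega>. C * ?f (\<omega> t))" using fi by simp
    show "(\<lambda>\<omega>. ?f (\<omega> t) * g \<omega>) \<in> borel_measurable ?T"
      using that(1) borel_measurable_integrable[OF fi] by (rule borel_measurable_times[rotated])
    show "AE \<omega> in ?T. norm (?f (\<omega> t) * g \<omega>) \<le> norm (C * ?f (\<omega> t))"
    proof (rule AE_I2)
      fix \<omega> assume "\<omega> \<in> space ?T"
      then have "\<bar>g \<omega>\<bar> \<le> \<bar>C\<bar>" using that(2) by (meson abs_ge_self order_trans)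
      then show "norm (?f (\<omega> t) * g \<omega>) \<le> norm (C * ?f (\<omega> t))"
        by (simp add: abs_mult mult.commute[of "\<bar>?f (\<omega> t)\<bar>"] mult_right_mono)
    qed
  qed
  have vm: "(\<lambda>sa. v_fun \<theta> i (fst sa)) \<in> borel_measurable (sa_space G)"
    by (rule measurable_compose[OF measurable_fst_sa measurable_v_fun])
  have v_le: "\<bar>v_fun \<theta> i (fst sa)\<bar> \<le> R / (1 - discount G)" if "sa \<in> space (sa_space G)" for sa
    using that by (intro abs_v_fun_le) (simp add: space_sa_space)
  have vi: "integrable ?T (\<lambda>\<omega>. ?f (\<omega> t) * v_fun \<theta> i (fst (\<omega> u)))" for u
    by (rule prod[OF measurable_compose[OF coord vm] v_le[OF space_traj_coordinate[OF s0]]])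
  have fv_m: "(\<lambda>sa. ?f sa * v_fun \<theta> i (fst sa)) \<in> borel_measurable (sa_space G)"
    by (rule borel_measurable_times[OF f vm])
  have bnd: "(\<integral>\<^sup>+sa. ennreal \<bar>?f sa * g sa\<bar> \<partial>start_law G \<theta> s) \<le> ennreal (R / (1 - discount G) * norm h * (1 + moment_const))"
    if s: "s \<in> space (states G)" and g: "g \<in> borel_measurable (sa_space G)"
      "\<And>sa. sa \<in> space (sa_space G) \<Longrightarrow> \<bar>g sa\<bar> \<le> R / (1 - discount G)" for s g
    using integral_abs_bounded_mult_score_le[OF s g, where \<theta>=\<theta> and h=h and i=i]
      integrable_abs[OF integrable_bounded_mult_score[OF s g, where \<theta>=\<theta> and h=h and i=i]]
    by (subst nn_integral_eq_integral) (simp_all add: mult.commute[of "h \<bullet> _"] ennreal_leI)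
  have q: "(\<integral>\<omega>. ?f (\<omega> t) * q_fun \<theta> i (\<omega> t) \<partial>?T) = gradient_pairing i \<theta> h t"
    unfolding gradient_pairing_def
    using integral_traj_coordinate[OF borel_measurable_times[OF f measurable_q_fun] bnd[OF _ measurable_q_fun abs_q_fun_le]]
    by (simp only: mult.commute)
  have v: "(\<integral>\<omega>. ?f (\<omega> t) * v_fun \<theta> i (fst (\<omega> t)) \<partial>?T) = 0"
  proof -
    have "(\<integral>\<omega>. ?f (\<omega> t) * v_fun \<theta> i (fst (\<omega> t)) \<partial>?T)
        = (\<integral>s. (\<integral>sa. ?f sa * v_fun \<theta> i (fst sa) \<partial>start_law G \<theta> s) \<partial>state_law \<theta> t)"
      by (rule integral_traj_coordinate[OF fv_m bnd[OF _ vm v_le]])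
    also have "\<dots> = (\<integral>s. 0 \<partial>state_law \<theta> t)"
      by (intro Bochner_Integration.integral_cong refl integral_state_function_mult_score measurable_v_fun)
         (simp add: space_state_law)
    finally show ?thesis by simp
  qed
  have ret: "(\<integral>\<omega>. ?f (\<omega> t) * (\<Sum>k. discount G ^ k * reward G i (\<omega> (t + k))) \<partial>?T) = gradient_pairing i \<theta> h t"
    using integral_traj_discounted_return[OF s0 f fi] q by simp
  show ?thesis
  proof (cases e)
    case Q_return
    then show ?thesis using ret by (simp add: mean_return_def)
  next
    case Advantage_return
    have "integrable ?T (\<lambda>\<omega>. ?f (\<omega> t) * (\<Sum>k. discount G ^ k * reward G i (\<omega> (t + k))))"
    proof (rule prod)
      show "(\<lambda>\<omega>. \<Sum>k. discount G ^ k * reward G i (\<omega> (t + k))) \<in> borel_measurable ?T"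
        by (intro borel_measurable_suminf borel_measurable_times borel_measurable_const
            measurable_compose[OF coord reward])
      show "\<bar>\<Sum>k. discount G ^ k * reward G i (\<omega> (t + k))\<bar> \<le> R / (1 - discount G)" if "\<omega> \<in> space ?T" for \<omega>
        by (rule abs_suminf_geometric_le[OF discount_bounds abs_reward_le[OF space_traj_coordinate[OF s0 that]]])
    qed
    then show ?thesis
      using ret v vi by (simp add: Advantage_return mean_return_def right_diff_distrib)
  next
    case TD_return
    let ?g = "\<lambda>sa. v_fun \<theta> i (fst sa)"
    \<comment> \<open>The state value ignores the action drawn in the next state, so only the
      transition is integrated and the result is the expectation in the Bellman equation.\<close>
    have step: "step_op \<theta> ?g sa = (\<integral>s. v_fun \<theta> i s \<partial>transition G sa)" if sa: "sa \<in> space (sa_space G)" for sa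
    proof -
      have v_start: "(\<integral>x. ?g x \<partial>start_law G \<theta> s) = v_fun \<theta> i s" if s: "s \<in> space (states G)" for s
      proof -
        have P: "Pair s \<in> joint_law G \<theta> s \<rightarrow>\<^sub>M sa_space G"
          using measurable_Pair_sa[OF s] by (simp only: measurable_cong_sets[OF sets_joint_law refl])
        show ?thesis
          unfolding start_law_def integral_distr[OF P vm]
          by (simp add: prob_space.prob_space[OF prob_space_joint_law[OF s]])
      qed
      have "step_op \<theta> ?g sa = (\<integral>s. (\<integral>x. ?g x \<partial>start_law G \<theta> s) \<partial>transition G sa)"
        by (rule step_op_eq_transition[OF sa vm v_le])
      also have "\<dots> = (\<integral>s. v_fun \<theta> i s \<partial>transition G sa)"
        by (intro Bochner_Integration.integral_cong refl v_start) (simp add: space_transition[OF sa])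
      finally show ?thesis .
    qed
    have next_v: "(\<integral>\<omega>. ?f (\<omega> t) * v_fun \<theta> i (fst (\<omega> (Suc t))) \<partial>?T) = (\<integral>\<omega>. ?f (\<omega> t) * step_op \<theta> ?g (\<omega> t) \<partial>?T)"
      by (rule integral_traj_Suc[OF s0 order_refl f fi vm v_le])
    have ri: "integrable ?T (\<lambda>\<omega>. ?f (\<omega> t) * reward G i (\<omega> t))"
      by (rule prod[OF measurable_compose[OF coord reward] abs_reward_le[OF space_traj_coordinate[OF s0]]])
    have si: "integrable ?T (\<lambda>\<omega>. ?f (\<omega> t) * step_op \<theta> ?g (\<omega> t))"
      by (rule prod[OF measurable_compose[OF coord measurable_step_op[OF vm]]
            abs_step_op_le[OF v_le space_traj_coordinate[OF s0]]])
    have "(\<integral>\<omega>. ?f (\<omega> t) * mean_return e i \<theta> t \<omega> \<partial>?T)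
        = (\<integral>\<omega>. ?f (\<omega> t) * reward G i (\<omega> t) + discount G * (?f (\<omega> t) * v_fun \<theta> i (fst (\<omega> (Suc t))))
            - ?f (\<omega> t) * v_fun \<theta> i (fst (\<omega> t)) \<partial>?T)"
      by (simp add: TD_return mean_return_def algebra_simps)
    also have "\<dots> = (\<integral>\<omega>. ?f (\<omega> t) * reward G i (\<omega> t) \<partial>?T) + discount G * (\<integral>\<omega>. ?f (\<omega> t) * step_op \<theta> ?g (\<omega> t) \<partial>?T)"
      using ri vi v next_v by simp
    also have "\<dots> = (\<integral>\<omega>. ?f (\<omega> t) * reward G i (\<omega> t) + discount G * (?f (\<omega> t) * step_op \<theta> ?g (\<omega> t)) \<partial>?T)"
      using ri si by simp
    also have "\<dots> = (\<integral>\<omega>. ?f (\<omega> t) * q_fun \<theta> i (\<omega> t) \<partial>?T)"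
    proof (intro Bochner_Integration.integral_cong refl)
      fix \<omega> assume "\<omega> \<in> space ?T"
      then have sa: "\<omega> t \<in> space (sa_space G)" by (rule space_traj_coordinate[OF s0])
      show "?f (\<omega> t) * reward G i (\<omega> t) + discount G * (?f (\<omega> t) * step_op \<theta> ?g (\<omega> t)) = ?f (\<omega> t) * q_fun \<theta> i (\<omega> t)"
        unfolding q_fun_bellman[OF sa] step[OF sa] by (simp add: algebra_simps)
    qed
    finally show ?thesis using q by simp
  qed
qed

text \<open>For integrability, the conditional mean modulus of the return is bounded by a constant
  and the mean norm of the score is bounded uniformly in time. Pairing with an arbitrary
  \<open>h\<close> then reduces the vector-valued mean to real-valued iterated integrals.\<close>

lemma
  shows integrable_grad_est_law: "integrable (grad_est_law G e i \<theta>) (\<lambda>x. x)"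
    and inner_integral_grad_est_law:
      "h \<bullet> (\<integral>x. x \<partial>grad_est_law G e i \<theta>) = (\<Sum>t. discount G ^ t * gradient_pairing i \<theta> h t)"
proof -
  let ?T = "traj G \<theta> (init_state G)"
  let ?TT = "PiM UNIV (\<lambda>_. sa_space G) :: (nat \<Rightarrow> 's \<times> ('n \<Rightarrow> real ^ 'k)) measure"
  let ?M = "long_horizon G \<Otimes>\<^sub>M ?T"
  let ?c = "1 / (1 - discount G)"
  define b where "b = ?c * (R + 2 * return_bound)"
  define K where "K x = distr (R_est_law G e i \<theta> (fst x) (snd x)) borel
      (\<lambda>r. (?c * r) *\<^sub>R total_score i \<theta> (snd x (fst x)))" for x :: "nat \<times> (nat \<Rightarrow> 's \<times> ('n \<Rightarrow> real ^ 'k))"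
  have c: "0 < ?c" using discount by simp
  have b: "0 \<le> b" unfolding b_def using c R_pos return_bound_nonneg by (intro mult_nonneg_nonneg) auto
  interpret H: prob_space "long_horizon G" by (rule prob_space_long_horizon)
  interpret T: prob_space ?T by (rule prob_space_traj[OF init_state])
  interpret P: pair_prob_space "long_horizon G" ?T ..
  have law: "grad_est_law G e i \<theta> = ?M \<bind> K"
    unfolding grad_est_law_def K_def[abs_def] total_score_def by (simp only: split_beta')
  have sT: "sets ?T = sets ?TT" by (rule sets_traj[OF init_state])
  have sM: "sets ?M = sets (count_space UNIV \<Otimes>\<^sub>M ?TT)"
    by (intro sets_pair_measure_cong sets_long_horizon sT)
  have spM: "snd x \<in> space ?TT" if "x \<in> space ?M" for x
    using that unfolding space_pair_measure mem_Times_iff sets_eq_imp_space_eq[OF sT] by (rule conjunct2)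
  have sc_m: "(\<lambda>\<omega>. total_score i \<theta> (\<omega> t)) \<in> borel_measurable ?TT" for t
    by (rule measurable_compose[OF _ measurable_total_score]) (simp add: measurable_component_singleton)
  have "K \<in> count_space UNIV \<Otimes>\<^sub>M ?TT \<rightarrow>\<^sub>M prob_algebra borel"
  proof (rule measurable_pair_measure_countable1)
    fix t :: nat
    have "(\<lambda>(\<omega>, r). (?c * r) *\<^sub>R total_score i \<theta> (\<omega> t)) \<in> borel_measurable (?TT \<Otimes>\<^sub>M (borel :: real measure))"
      using measurable_compose[OF measurable_fst sc_m] unfolding split_beta'
      by (intro borel_measurable_scaleR) simp_all
    from measurable_distr_prob_space2[OF measurable_R_est_law this]
    show "(\<lambda>\<omega>. K (t, \<omega>)) \<in> ?TT \<rightarrow>\<^sub>M prob_algebra borel" by (simp add: K_def)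
  qed simp
  then have "K \<in> ?M \<rightarrow>\<^sub>M prob_algebra borel" by (simp only: measurable_cong_sets[OF sM refl])
  then have K: "K \<in> ?M \<rightarrow>\<^sub>M subprob_algebra borel" by (rule measurable_prob_algebraD)
  have Rm: "(\<lambda>r. (?c * r) *\<^sub>R v) \<in> borel_measurable (R_est_law G e i \<theta> t \<omega>)"
    if "\<omega> \<in> space ?TT" for t \<omega> and v :: "real ^ 'm"
  proof -
    have sR: "sets (R_est_law G e i \<theta> t \<omega>) = sets borel"
      using measurable_space[OF measurable_R_est_law that] by (simp add: space_prob_algebra)
    have "(\<lambda>r. (?c * r) *\<^sub>R v) \<in> borel_measurable borel" by measurable
    then show ?thesis by (simp only: measurable_cong_sets[OF sR refl])
  qed
  have norm_le: "(\<integral>\<^sup>+y. ennreal (norm y) \<partial>K x) \<le> ennreal b * ennreal (norm (total_score i \<theta> (snd x (fst x))))"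
    if x: "x \<in> space ?M" for x
  proof -
    let ?R = "R_est_law G e i \<theta> (fst x) (snd x)" and ?v = "total_score i \<theta> (snd x (fst x))"
    have i: "integrable ?R (\<lambda>r. \<bar>r\<bar>)" by (rule integrable_abs[OF integrable_R_est_law[OF spM[OF x]]])
    have "(\<integral>\<^sup>+y. ennreal (norm y) \<partial>K x) = (\<integral>\<^sup>+r. ennreal (norm ((?c * r) *\<^sub>R ?v)) \<partial>?R)"
      unfolding K_def by (rule nn_integral_distr[OF Rm[OF spM[OF x]]]) simp
    also have "\<dots> = (\<integral>\<^sup>+r. ennreal (?c * norm ?v * \<bar>r\<bar>) \<partial>?R)"
      using c by (intro nn_integral_cong arg_cong[where f=ennreal]) (simp add: abs_mult)
    also have "\<dots> = ennreal (\<integral>r. ?c * norm ?v * \<bar>r\<bar> \<partial>?R)"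
      using i c by (intro nn_integral_eq_integral) auto
    also have "\<dots> \<le> ennreal (b * norm ?v)"
    proof (rule ennreal_leI)
      have "(\<integral>r. ?c * norm ?v * \<bar>r\<bar> \<partial>?R) = ?c * norm ?v * (\<integral>r. \<bar>r\<bar> \<partial>?R)" by simp
      also have "\<dots> \<le> ?c * norm ?v * (R + 2 * return_bound)"
        using c by (intro mult_left_mono integral_abs_R_est_law_le spM x) auto
      finally show "(\<integral>r. ?c * norm ?v * \<bar>r\<bar> \<partial>?R) \<le> b * norm ?v" by (simp add: b_def mult_ac)
    qed
    finally show ?thesis using b by (simp add: ennreal_mult)
  qed
  have total_m: "(\<lambda>x. ennreal (norm (total_score i \<theta> (snd x (fst x))))) \<in> borel_measurable ?M"
  proof -
    have "(\<lambda>x. total_score i \<theta> (snd x (fst x))) \<in> borel_measurable (count_space UNIV \<Otimes>\<^sub>M ?TT)"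
      by (rule measurable_pair_measure_countable1) (simp_all add: sc_m)
    then have "(\<lambda>x. ennreal (norm (total_score i \<theta> (snd x (fst x))))) \<in> borel_measurable (count_space UNIV \<Otimes>\<^sub>M ?TT)"
      by measurable
    then show ?thesis by (simp only: measurable_cong_sets[OF sM refl])
  qed
  have total: "(\<integral>\<^sup>+x. ennreal (norm (total_score i \<theta> (snd x (fst x)))) \<partial>?M) \<le> ennreal (1 + moment_const)"
  proof -
    have "(\<integral>\<^sup>+x. ennreal (norm (total_score i \<theta> (snd x (fst x)))) \<partial>?M)
        = (\<integral>\<^sup>+t. (\<integral>\<^sup>+\<omega>. ennreal (norm (total_score i \<theta> (\<omega> t))) \<partial>?T) \<partial>long_horizon G)"
      using T.nn_integral_fst[OF total_m] by simp
    also have "\<dots> \<le> (\<integral>\<^sup>+t. ennreal (1 + moment_const) \<partial>long_horizon G)"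
    proof (rule nn_integral_mono)
      fix t
      have "(\<lambda>sa. norm (total_score i \<theta> sa)) \<in> borel_measurable (sa_space G)" by measurable
      from nn_integral_traj_coordinate_le[OF this nn_integral_norm_total_score_le]
      show "(\<integral>\<^sup>+\<omega>. ennreal (norm (total_score i \<theta> (\<omega> t))) \<partial>?T) \<le> ennreal (1 + moment_const)" by simp
    qed
    finally show ?thesis by (simp add: H.emeasure_space_1)
  qed
  have fin: "(\<integral>\<^sup>+x. \<integral>\<^sup>+y. ennreal (norm y) \<partial>K x \<partial>?M) < \<infinity>"
  proof -
    have "(\<integral>\<^sup>+x. \<integral>\<^sup>+y. ennreal (norm y) \<partial>K x \<partial>?M)
        \<le> (\<integral>\<^sup>+x. ennreal b * ennreal (norm (total_score i \<theta> (snd x (fst x)))) \<partial>?M)"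
      by (rule nn_integral_mono[OF norm_le])
    also have "\<dots> = ennreal b * (\<integral>\<^sup>+x. ennreal (norm (total_score i \<theta> (snd x (fst x)))) \<partial>?M)"
      by (rule nn_integral_cmult[OF total_m])
    also have "\<dots> \<le> ennreal b * ennreal (1 + moment_const)" by (intro mult_left_mono total) simp
    also have "\<dots> < \<infinity>" by (simp add: ennreal_mult_less_top)
    finally show ?thesis .
  qed
  have sets_law: "sets (grad_est_law G e i \<theta>) = sets borel"
    unfolding law by (rule sets_bind[OF sets_kernel[OF K] P.not_empty])
  show int: "integrable (grad_est_law G e i \<theta>) (\<lambda>x. x)"
    unfolding integrable_iff_bounded
  proof
    show "(\<lambda>x. x) \<in> borel_measurable (grad_est_law G e i \<theta>)"
      by (simp add: measurable_cong_sets[OF sets_law refl])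
    show "(\<integral>\<^sup>+x. ennreal (norm x) \<partial>grad_est_law G e i \<theta>) < \<infinity>"
      unfolding law using fin by (subst nn_integral_bind[OF _ K]) simp_all
  qed
  have hm: "(\<lambda>y. h \<bullet> y) \<in> borel_measurable borel" by simp
  have hfin: "(\<integral>\<^sup>+x. \<integral>\<^sup>+y. ennreal \<bar>h \<bullet> y\<bar> \<partial>K x \<partial>?M) < \<infinity>"
  proof -
    have Kn: "(\<lambda>y. ennreal (norm y)) \<in> borel_measurable (K x)" if "x \<in> space ?M" for x
      by (simp add: K_def)
    have meas: "(\<lambda>x. \<integral>\<^sup>+y. ennreal (norm y) \<partial>K x) \<in> borel_measurable ?M"
      by (rule measurable_compose[OF K nn_integral_measurable_subprob_algebra]) simp
    have "(\<integral>\<^sup>+x. \<integral>\<^sup>+y. ennreal \<bar>h \<bullet> y\<bar> \<partial>K x \<partial>?M) \<le> (\<integral>\<^sup>+x. ennreal (norm h) * (\<integral>\<^sup>+y. ennreal (norm y) \<partial>K x) \<partial>?M)"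
    proof (rule nn_integral_mono)
      fix x assume x: "x \<in> space ?M"
      have "(\<integral>\<^sup>+y. ennreal \<bar>h \<bullet> y\<bar> \<partial>K x) \<le> (\<integral>\<^sup>+y. ennreal (norm h) * ennreal (norm y) \<partial>K x)"
        by (intro nn_integral_mono) (simp add: ennreal_mult[symmetric] ennreal_leI Cauchy_Schwarz_ineq2)
      also have "\<dots> = ennreal (norm h) * (\<integral>\<^sup>+y. ennreal (norm y) \<partial>K x)"
        by (rule nn_integral_cmult[OF Kn[OF x]])
      finally show "(\<integral>\<^sup>+y. ennreal \<bar>h \<bullet> y\<bar> \<partial>K x) \<le> ennreal (norm h) * (\<integral>\<^sup>+y. ennreal (norm y) \<partial>K x)" .
    qed
    also have "\<dots> = ennreal (norm h) * (\<integral>\<^sup>+x. \<integral>\<^sup>+y. ennreal (norm y) \<partial>K x \<partial>?M)"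
      by (rule nn_integral_cmult[OF meas])
    also have "\<dots> < \<infinity>" using fin by (simp add: ennreal_mult_less_top)
    finally show ?thesis .
  qed
  have inner: "(\<integral>y. h \<bullet> y \<partial>K x) = ?c * (h \<bullet> total_score i \<theta> (snd x (fst x)) * mean_return e i \<theta> (fst x) (snd x))"
    if x: "x \<in> space ?M" for x
    unfolding K_def integral_distr[OF Rm[OF spM[OF x]] hm]
    using integral_R_est_law[OF spM[OF x], of e i \<theta> "fst x"] by (simp add: mult_ac)
  let ?F = "\<lambda>t \<omega>. ?c * (h \<bullet> total_score i \<theta> (\<omega> t) * mean_return e i \<theta> t \<omega>)"
  \<comment> \<open>Integrability of the conditional mean as a function of horizon and trajectory is
    inherited from that of the paired estimator.\<close>
  have Fint: "integrable ?M (\<lambda>(t, \<omega>). ?F t \<omega>)"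
    using integrable_integral_kernel[OF K hm hfin]
    by (subst Bochner_Integration.integrable_cong[OF refl, of _ _ "\<lambda>x. \<integral>y. h \<bullet> y \<partial>K x"]) (auto simp: inner)
  have Fbd: "\<bar>?c * gradient_pairing i \<theta> h t\<bar> \<le> ?c * (R / (1 - discount G) * norm h * (1 + moment_const))" for t
    unfolding abs_mult using c abs_gradient_pairing_le[of i \<theta> h t] by (intro mult_mono) auto
  have "h \<bullet> (\<integral>x. x \<partial>grad_est_law G e i \<theta>) = (\<integral>x. h \<bullet> x \<partial>grad_est_law G e i \<theta>)"
    using int by simp
  also have "\<dots> = (\<integral>x. (\<integral>y. h \<bullet> y \<partial>K x) \<partial>?M)"
    unfolding law by (rule integral_bind_kernel[OF K hm hfin])
  also have "\<dots> = (\<integral>x. (case x of (t, \<omega>) \<Rightarrow> ?F t \<omega>) \<partial>?M)"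
    by (intro Bochner_Integration.integral_cong refl) (simp add: inner split_beta')
  also have "\<dots> = (\<integral>t. (\<integral>\<omega>. ?F t \<omega> \<partial>?T) \<partial>long_horizon G)"
    using P.integral_fst[OF Fint] by simp
  also have "\<dots> = (\<integral>t. ?c * gradient_pairing i \<theta> h t \<partial>long_horizon G)"
    by (simp only: integral_mult_right_zero integral_score_mean_return)
  \<comment> \<open>The horizon has mass \<gamma>^t (1 - \<gamma>) at t; the factor 1 - \<gamma>
    cancels the normalisation 1 / (1 - \<gamma>) of the estimator.\<close>
  also have "\<dots> = (\<Sum>t. (1 - (1 - discount G)) ^ t * (1 - discount G) * (?c * gradient_pairing i \<theta> h t))"
    unfolding long_horizon_def using discount by (intro integral_geometric_pmf[OF _ _ Fbd]) auto
  also have "\<dots> = (\<Sum>t. discount G ^ t * gradient_pairing i \<theta> h t)"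
    using discount by (intro suminf_cong) simp
  finally show "h \<bullet> (\<integral>x. x \<partial>grad_est_law G e i \<theta>) = (\<Sum>t. discount G ^ t * gradient_pairing i \<theta> h t)" .
qed

text \<open>The mean of the estimator is itself the candidate gradient: its inner products with
  \<open>h\<close> form the series required by \<open>policy_gradient_theorem\<close>. This yields
  differentiability and the equality together, the latter by uniqueness of gradients.\<close>

lemma grad_est_unbiased:
  "block_differentiable (owner G) i (utility G i) \<theta>"
  "(\<integral>x. x \<partial>grad_est_law G e i \<theta>) = block_grad (owner G) i (utility G i) \<theta>"
proof -
  let ?D = "\<integral>x. x \<partial>grad_est_law G e i \<theta>"
  have D: "GDERIV (\<lambda>h. utility G i (\<theta> + block_part (owner G) i h)) 0 :> ?D"
    by (rule policy_gradient_theorem[OF inner_integral_grad_est_law])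
  then show "block_differentiable (owner G) i (utility G i) \<theta>"
    unfolding block_differentiable_def gderiv_def differentiable_def by blast
  show "?D = block_grad (owner G) i (utility G i) \<theta>"
    unfolding block_grad_def by (rule the_equality[symmetric]) (use D GDERIV_unique in blast)+
qed

end

theorem lemma3:
  fixes G :: "('s, 'n::finite, 'k::finite, 'm::finite) game"
    and R B V L :: real
  assumes game: "markov_game G"
    and R_pos: "0 < R"
    and A5: "\<And>i s a. s \<in> space (states G) \<Longrightarrow> (\<And>n. a n \<in> actions G) \<Longrightarrow>
               \<bar>reward G i (s, a)\<bar> \<le> R"
    and const_nonneg: "0 \<le> B" "0 \<le> V" "0 \<le> L"
    and A6_first: "\<And>i n \<theta> s. s \<in> space (states G) \<Longrightarrow>
               (\<integral>\<^sup>+ a. ennreal (norm (score G i n \<theta> s a)) \<partial>agent_law G n \<theta> s) \<le> ennreal B"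
    and A6_second: "\<And>i n \<theta> s. s \<in> space (states G) \<Longrightarrow>
               (\<integral>\<^sup>+ a. ennreal ((norm (score G i n \<theta> s a))\<^sup>2) \<partial>agent_law G n \<theta> s) \<le> ennreal (V\<^sup>2)"
    and A6_lipschitz: "\<And>i n \<theta>1 \<theta>2 s a. s \<in> space (states G) \<Longrightarrow> a \<in> actions G \<Longrightarrow>
               norm (score G i n \<theta>1 s a - score G i n \<theta>2 s a) \<le> L * norm (\<theta>1 - \<theta>2)"
  shows "\<forall>e i \<theta>. integrable (grad_est_law G e i \<theta>) (\<lambda>x. x)
           \<and> block_differentiable (owner G) i (utility G i) \<theta>
           \<and> (\<integral>x. x \<partial>grad_est_law G e i \<theta>) = block_grad (owner G) i (utility G i) \<theta>"
proof -
  interpret markov_game G by (rule game)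
  interpret score_game G R V L
    by unfold_locales (fact R_pos A5 const_nonneg(3) A6_second A6_lipschitz)+
  show ?thesis
    using integrable_grad_est_law grad_est_unbiased by blast
qed

end
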